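(* Let $\mathcal D=\langle\mathcal D_1,\mathcal D_2\rangle$ be a semiorthogonal decomposition of a triangulated category $\mathcal D$. For a real number $a\in(0,1)$ let $S(a)\subset\operatorname{Stab}(\mathcal D_1)\times\operatorname{Stab}(\mathcal D_2)$ denote the subset of pairs $(\sigma_1,\sigma_2)$, $\sigma_i=(Z_i,P_i)$, such that $\sigma_1$ and $\sigma_2$ are reasonable stability conditions satisfying (1) $\operatorname{Hom}_{\mathcal D}^{\le 0}(P_1(0,1],P_2(0,1])=0$, (2) $\operatorname{Hom}_{\mathcal D}^{\le 0}(P_1(a,a+1],P_2(a,a+1])=0$. Let $\operatorname{gl}:S(a)\to\operatorname{Stab}(\mathcal D)$ be the map associating to $(\sigma_1,\sigma_2)$ the stability condition on $\mathcal D$ glued from $\sigma_1$ and $\sigma_2$ (which exists under these hypotheses and is reasonable, hence locally finite). Then the map $\operatorname{gl}$ is continuous on $S(a)$.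
   Context: $\operatorname{Hom}^i(A,B)=\operatorname{Hom}(A,B[i])$; $\operatorname{Hom}^{\le m}(\mathcal A,\mathcal B)=0$ means $\operatorname{Hom}^i(A,B)=0$ for all $A\in\mathcal A$, $B\in\mathcal B$, $i\le m$. Stability conditions. A stability condition $\sigma=(Z,P)$ on a triangulated category $\mathcal D$ is a homomorphism $Z:K_0(\mathcal D)\to\mathbb C$ and a slicing $P$: full additive subcategories $P(\phi)\subset\mathcal D$, $\phi\in\mathbb R$ (semistable objects of phase $\phi$), with $P(\phi)[1]=P(\phi+1)$, $\operatorname{Hom}(P(\phi_1),P(\phi_2))=0$ for $\phi_1>\phi_2$, $Z(E)\in\mathbb R_{>0}e^{i\pi\phi}$ for $0\ne E\in P(\phi)$, and such that every nonzero object has a finite Harder-Narasimhan filtration by exact triangles with semistable factors of decreasing phases. For an interval $I\subset\mathbb R$, $PI$ (e.g. $P(0,1]$) is the extension-closed full subcategory generated by the $P(\phi)$, $\phi\in I$. The heart of $\sigma$ is $P(0,1]$. $\sigma$ is reasonable if $\inf|Z(E)|>0$ over all nonzero $\sigma$-semistable $E$. $\sigma$ is locally finite if there is $\eta>0$ such that each quasi-abelian category $P(\phi-\eta,\phi+\eta)$ is of finite length (chains of strict subobjects stabilize). $\operatorname{Stab}(\mathcal D)$ is the space of locally finite stability conditions, with the topology having as a basis of neighborhoods of $\sigma=(Z,P)$ the sets $B_\epsilon(\sigma)=\{\tau=(U,Q):\|U-Z\|_\sigma<\sin(\pi\epsilon),\ d(P,Q)<\epsilon\}$ (for small $\epsilon>0$),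 where $\|U\|_\sigma=\sup\{|U(E)|/|Z(E)|: E\ne0\ \sigma\text{-semistable}\}$ and $d(P,Q)=\inf\{\epsilon\ge0: Q(\phi)\subset P[\phi-\epsilon,\phi+\epsilon]\text{ for all }\phi\}$. Gluing. $\mathcal D=\langle\mathcal D_1,\mathcal D_2\rangle$ is a semiorthogonal decomposition if $\mathcal D_1,\mathcal D_2$ are triangulated subcategories, $\operatorname{Hom}(E_2,E_1)=0$ for $E_i\in\mathcal D_i$, and each $E\in\mathcal D$ fits into an exact triangle $E_2\to E\to E_1\to E_2[1]$ with $E_i\in\mathcal D_i$. Then $E_1=\lambda_1(E)$, $E_2=\rho_2(E)$, where $\lambda_1$ is left adjoint to $\mathcal D_1\hookrightarrow\mathcal D$ and $\rho_2$ is right adjoint to $\mathcal D_2\hookrightarrow\mathcal D$. A stability condition $\sigma=(Z,P)$ on $\mathcal D$ is glued from $\sigma_1=(Z_1,P_1)$ and $\sigma_2=(Z_2,P_2)$ if the hearts $H_i=P_i(0,1]$ satisfy $\operatorname{Hom}^{\le 0}(H_1,H_2)=0$, $P(0,1]=\{E\in\mathcal D:\lambda_1(E)\in H_1,\ \rho_2(E)\in H_2\}$, and $Z(E)=Z_1(\lambda_1(E))+Z_2(\rho_2(E))$ for all $E$. It is uniquely determined by $\sigma_1,\sigma_2$ if it exists. *)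

theory Defs
  imports "HOL-Analysis.Analysis" "HOL-Algebra.Free_Abelian_Groups"
begin

section \<open>Triangulated categories\<close>

text \<open>
  A category with objects in a carrier set, together with the data of a triangulated category.
  \<open>Sh\<close> and \<open>ShM\<close> are the shift functor on objects and on morphisms;
  \<open>Tri C X Y Z f g h\<close> says that \<open>X \<rightarrow> Y \<rightarrow> Z \<rightarrow> X[1]\<close> (with maps \<open>f\<close>, \<open>g\<close>, \<open>h\<close>) is
  a distinguished triangle. The fields are only meaningful on objects in \<open>Obj C\<close>.
\<close>

record ('o, 'm) tricat =
  Obj :: "'o set"
  Hom :: "'o \<Rightarrow> 'o \<Rightarrow> 'm set"
  Ide :: "'o \<Rightarrow> 'm"
  Comp :: "'m \<Rightarrow> 'm \<Rightarrow> 'm" (infixl "\<cdot>\<index>" 70)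
  Add :: "'m \<Rightarrow> 'm \<Rightarrow> 'm"
  Nul :: "'o \<Rightarrow> 'o \<Rightarrow> 'm"
  Sh :: "'o \<Rightarrow> 'o"
  ShM :: "'m \<Rightarrow> 'm"
  Tri :: "'o \<Rightarrow> 'o \<Rightarrow> 'o \<Rightarrow> 'm \<Rightarrow> 'm \<Rightarrow> 'm \<Rightarrow> bool"

definition HomG :: "('o, 'm) tricat \<Rightarrow> 'o \<Rightarrow> 'o \<Rightarrow> 'm monoid" where
  "HomG C A B = \<lparr>carrier = Hom C A B, mult = Add C, one = Nul C A B\<rparr>"

definition is_zero :: "('o, 'm) tricat \<Rightarrow> 'o \<Rightarrow> bool" where
  "is_zero C A \<longleftrightarrow> A \<in> Obj C \<and>
     (\<forall>B\<in>Obj C. Hom C A B = {Nul C A B} \<and> Hom C B A = {Nul C B A})"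

definition is_iso :: "('o, 'm) tricat \<Rightarrow> 'o \<Rightarrow> 'o \<Rightarrow> 'm \<Rightarrow> bool" where
  "is_iso C A B f \<longleftrightarrow> f \<in> Hom C A B \<and>
     (\<exists>g\<in>Hom C B A. g \<cdot>\<^bsub>C\<^esub> f = Ide C A \<and> f \<cdot>\<^bsub>C\<^esub> g = Ide C B)"

definition isomorphic :: "('o, 'm) tricat \<Rightarrow> 'o \<Rightarrow> 'o \<Rightarrow> bool" where
  "isomorphic C A B \<longleftrightarrow> A \<in> Obj C \<and> B \<in> Obj C \<and> (\<exists>f. is_iso C A B f)"

definition is_biproduct :: "('o, 'm) tricat \<Rightarrow> 'o \<Rightarrow> 'o \<Rightarrow> 'o \<Rightarrow> bool" where
  "is_biproduct C A B S \<longleftrightarrow> A \<in> Obj C \<and> B \<in> Obj C \<and> S \<in> Obj C \<and>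
     (\<exists>i\<in>Hom C A S. \<exists>j\<in>Hom C B S. \<exists>p\<in>Hom C S A. \<exists>q\<in>Hom C S B.
        p \<cdot>\<^bsub>C\<^esub> i = Ide C A \<and> q \<cdot>\<^bsub>C\<^esub> j = Ide C B \<and>
        q \<cdot>\<^bsub>C\<^esub> i = Nul C A B \<and> p \<cdot>\<^bsub>C\<^esub> j = Nul C B A \<and>
        Add C (i \<cdot>\<^bsub>C\<^esub> p) (j \<cdot>\<^bsub>C\<^esub> q) = Ide C S)"

locale additive_category =
  fixes C :: "('o, 'm) tricat" (structure)
  assumes Ide_in: "A \<in> Obj C \<Longrightarrow> Ide C A \<in> Hom C A A"
    and Comp_in: "\<lbrakk>X \<in> Obj C; Y \<in> Obj C; Z \<in> Obj C; f \<in> Hom C X Y; g \<in> Hom C Y Z\<rbrakk>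
          \<Longrightarrow> g \<cdot> f \<in> Hom C X Z"
    and Comp_assoc: "\<lbrakk>W \<in> Obj C; X \<in> Obj C; Y \<in> Obj C; Z \<in> Obj C;
          f \<in> Hom C W X; g \<in> Hom C X Y; h \<in> Hom C Y Z\<rbrakk> \<Longrightarrow> h \<cdot> g \<cdot> f = h \<cdot> (g \<cdot> f)"
    and Comp_Ide: "\<lbrakk>X \<in> Obj C; Y \<in> Obj C; f \<in> Hom C X Y\<rbrakk> \<Longrightarrow> f \<cdot> Ide C X = f"
    and Ide_Comp: "\<lbrakk>X \<in> Obj C; Y \<in> Obj C; f \<in> Hom C X Y\<rbrakk> \<Longrightarrow> Ide C Y \<cdot> f = f"
    and HomG_group: "\<lbrakk>X \<in> Obj C; Y \<in> Obj C\<rbrakk> \<Longrightarrow> comm_group (HomG C X Y)"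
    and Comp_Add: "\<lbrakk>X \<in> Obj C; Y \<in> Obj C; Z \<in> Obj C; f \<in> Hom C X Y; f' \<in> Hom C X Y; g \<in> Hom C Y Z\<rbrakk>
          \<Longrightarrow> g \<cdot> Add C f f' = Add C (g \<cdot> f) (g \<cdot> f')"
    and Add_Comp: "\<lbrakk>X \<in> Obj C; Y \<in> Obj C; Z \<in> Obj C; f \<in> Hom C X Y; g \<in> Hom C Y Z; g' \<in> Hom C Y Z\<rbrakk>
          \<Longrightarrow> Add C g g' \<cdot> f = Add C (g \<cdot> f) (g' \<cdot> f)"
    and ex_zero: "\<exists>O'. is_zero C O'"
    and ex_biproduct: "\<lbrakk>A \<in> Obj C; B \<in> Obj C\<rbrakk> \<Longrightarrow> \<exists>S. is_biproduct C A B S"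

locale triangulated_category = additive_category +
  assumes Sh_bij: "bij_betw (Sh C) (Obj C) (Obj C)"
    and ShM_bij: "\<lbrakk>X \<in> Obj C; Y \<in> Obj C\<rbrakk>
          \<Longrightarrow> bij_betw (ShM C) (Hom C X Y) (Hom C (Sh C X) (Sh C Y))"
    and ShM_Ide: "X \<in> Obj C \<Longrightarrow> ShM C (Ide C X) = Ide C (Sh C X)"
    and ShM_Comp: "\<lbrakk>X \<in> Obj C; Y \<in> Obj C; Z \<in> Obj C; f \<in> Hom C X Y; g \<in> Hom C Y Z\<rbrakk>
          \<Longrightarrow> ShM C (g \<cdot> f) = ShM C g \<cdot> ShM C f"
    and ShM_Add: "\<lbrakk>X \<in> Obj C; Y \<in> Obj C; f \<in> Hom C X Y; f' \<in> Hom C X Y\<rbrakk>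
          \<Longrightarrow> ShM C (Add C f f') = Add C (ShM C f) (ShM C f')"
    and Tri_type: "Tri C X Y Z f g h \<Longrightarrow> X \<in> Obj C \<and> Y \<in> Obj C \<and> Z \<in> Obj C \<and>
          f \<in> Hom C X Y \<and> g \<in> Hom C Y Z \<and> h \<in> Hom C Z (Sh C X)"
    and TR1_Ide: "\<lbrakk>X \<in> Obj C; is_zero C O'\<rbrakk>
          \<Longrightarrow> Tri C X X O' (Ide C X) (Nul C X O') (Nul C O' (Sh C X))"
    and TR1_iso: "\<lbrakk>Tri C X Y Z f g h; X' \<in> Obj C; Y' \<in> Obj C; Z' \<in> Obj C;
          f' \<in> Hom C X' Y'; g' \<in> Hom C Y' Z'; h' \<in> Hom C Z' (Sh C X');
          is_iso C X X' u; is_iso C Y Y' v; is_iso C Z Z' w;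
          v \<cdot> f = f' \<cdot> u; w \<cdot> g = g' \<cdot> v; ShM C u \<cdot> h = h' \<cdot> w\<rbrakk>
          \<Longrightarrow> Tri C X' Y' Z' f' g' h'"
    and TR1_cone: "\<lbrakk>X \<in> Obj C; Y \<in> Obj C; f \<in> Hom C X Y\<rbrakk> \<Longrightarrow> \<exists>Z g h. Tri C X Y Z f g h"
    and TR2: "\<lbrakk>X \<in> Obj C; Y \<in> Obj C; Z \<in> Obj C;
          f \<in> Hom C X Y; g \<in> Hom C Y Z; h \<in> Hom C Z (Sh C X)\<rbrakk>
          \<Longrightarrow> Tri C X Y Z f g h \<longleftrightarrow>
              Tri C Y Z (Sh C X) g h (inv\<^bsub>HomG C (Sh C X) (Sh C Y)\<^esub> (ShM C f))"
    and TR3: "\<lbrakk>Tri C X Y Z f g h; Tri C X' Y' Z' f' g' h';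
          u \<in> Hom C X X'; v \<in> Hom C Y Y'; v \<cdot> f = f' \<cdot> u\<rbrakk>
          \<Longrightarrow> \<exists>w\<in>Hom C Z Z'. w \<cdot> g = g' \<cdot> v \<and> ShM C u \<cdot> h = h' \<cdot> w"
    and TR4: "\<lbrakk>Tri C X Y Z' f i i'; Tri C Y Z X' g j j'; Tri C X Z Y' (g \<cdot> f) k k'\<rbrakk>
          \<Longrightarrow> \<exists>u\<in>Hom C Z' Y'. \<exists>v\<in>Hom C Y' X'.
                Tri C Z' Y' X' u v (ShM C i \<cdot> j') \<and>
                u \<cdot> i = k \<cdot> g \<and> k' \<cdot> u = i' \<and> v \<cdot> k = j \<and> j' \<cdot> v = ShM C f \<cdot> k'"

definition shift :: "('o, 'm) tricat \<Rightarrow> int \<Rightarrow> 'o \<Rightarrow> 'o" where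
  "shift C i A = (if 0 \<le> i then (Sh C ^^ nat i) A
                  else (inv_into (Obj C) (Sh C) ^^ nat (- i)) A)"

definition Hom_le_vanishes :: "('o, 'm) tricat \<Rightarrow> int \<Rightarrow> 'o set \<Rightarrow> 'o set \<Rightarrow> bool" where
  "Hom_le_vanishes C m \<A> \<B> \<longleftrightarrow>
     (\<forall>A\<in>\<A>. \<forall>B\<in>\<B>. \<forall>i\<le>m. Hom C A (shift C i B) = {Nul C A (shift C i B)})"

definition full_sub :: "('o, 'm) tricat \<Rightarrow> 'o set \<Rightarrow> ('o, 'm) tricat" where
  "full_sub C S = C\<lparr>Obj := S,
     Tri := (\<lambda>X Y Z f g h. X \<in> S \<and> Y \<in> S \<and> Z \<in> S \<and> Tri C X Y Z f g h)\<rparr>"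

text \<open>
  Full triangulated subcategories are given by their set of objects. It need not be closed under
  isomorphism, so cones are required to lie in it only up to isomorphism.
\<close>

definition triangulated_subcategory :: "('o, 'm) tricat \<Rightarrow> 'o set \<Rightarrow> bool" where
  "triangulated_subcategory C S \<longleftrightarrow> S \<subseteq> Obj C \<and> S \<noteq> {} \<and> Sh C ` S = S \<and>
     (\<forall>X Y Z f g h. Tri C X Y Z f g h \<longrightarrow> X \<in> S \<longrightarrow> Y \<in> S \<longrightarrow> (\<exists>Z'\<in>S. isomorphic C Z Z'))"

definition semiorthogonal_decomposition ::
    "('o, 'm) tricat \<Rightarrow> 'o set \<Rightarrow> 'o set \<Rightarrow> bool" where
  "semiorthogonal_decomposition C D1 D2 \<longleftrightarrow>
     triangulated_subcategory C D1 \<and> triangulated_subcategory C D2 \<and>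
     (\<forall>E2\<in>D2. \<forall>E1\<in>D1. Hom C E2 E1 = {Nul C E2 E1}) \<and>
     (\<forall>E\<in>Obj C. \<exists>E2\<in>D2. \<exists>E1\<in>D1. \<exists>f g h. Tri C E2 E E1 f g h)"

text \<open>
  The objects \<open>\<lambda>\<^sub>1(E)\<close> and \<open>\<rho>\<^sub>2(E)\<close> of the decomposition triangle
  \<open>\<rho>\<^sub>2(E) \<rightarrow> E \<rightarrow> \<lambda>\<^sub>1(E) \<rightarrow> \<rho>\<^sub>2(E)[1]\<close>. They are unique up to isomorphism and are only used in
  isomorphism-invariant ways.
\<close>

definition lambda1 :: "('o, 'm) tricat \<Rightarrow> 'o set \<Rightarrow> 'o set \<Rightarrow> 'o \<Rightarrow> 'o" where
  "lambda1 C D1 D2 E = (SOME E1. E1 \<in> D1 \<and> (\<exists>E2\<in>D2. \<exists>f g h. Tri C E2 E E1 f g h))"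

definition rho2 :: "('o, 'm) tricat \<Rightarrow> 'o set \<Rightarrow> 'o set \<Rightarrow> 'o \<Rightarrow> 'o" where
  "rho2 C D1 D2 E = (SOME E2. E2 \<in> D2 \<and> (\<exists>E1\<in>D1. \<exists>f g h. Tri C E2 E E1 f g h))"


section \<open>The Grothendieck group\<close>

definition K0_rel :: "('o, 'm) tricat \<Rightarrow> ('o, int) poly_mapping set" where
  "K0_rel C = generate (free_Abelian_group (Obj C))
     {frag_of Y - frag_of X - frag_of Z |X Y Z. \<exists>f g h. Tri C X Y Z f g h}"

definition K0 :: "('o, 'm) tricat \<Rightarrow> ('o, int) poly_mapping set monoid" where
  "K0 C = free_Abelian_group (Obj C) Mod K0_rel C"

definition K0_class :: "('o, 'm) tricat \<Rightarrow> 'o \<Rightarrow> ('o, int) poly_mapping set" where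
  "K0_class C E = K0_rel C #>\<^bsub>free_Abelian_group (Obj C)\<^esub> frag_of E"

definition complex_add :: "complex monoid" where
  "complex_add = \<lparr>carrier = UNIV, mult = (+), one = 0\<rparr>"


section \<open>Stability conditions\<close>

text \<open>A pair \<open>(Z, P)\<close> of a central charge and a slicing.\<close>

type_synonym 'o stab = "(('o, int) poly_mapping set \<Rightarrow> complex) \<times> (real \<Rightarrow> 'o set)"

text \<open>
  Subcategories \<open>P(\<phi>)\<close> are taken closed under isomorphism; otherwise a slicing would not be
  determined by a heart and a central charge.
\<close>

definition additive_subcategory :: "('o, 'm) tricat \<Rightarrow> 'o set \<Rightarrow> bool" where
  "additive_subcategory C S \<longleftrightarrow> S \<subseteq> Obj C \<and>
     (\<forall>A B. A \<in> S \<longrightarrow> isomorphic C A B \<longrightarrow> B \<in> S) \<and>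
     (\<exists>O'\<in>S. is_zero C O') \<and>
     (\<forall>A\<in>S. \<forall>B\<in>S. \<exists>T\<in>S. is_biproduct C A B T)"

text \<open>
  A chain \<open>0 = F 0 \<rightarrow> F 1 \<rightarrow> \<dots> \<rightarrow> F n = E\<close> whose cones \<open>A i\<close> are nonzero objects of \<open>P(\<phi> i)\<close>,
  with \<open>\<phi> 0 > \<phi> 1 > \<dots>\<close>.
\<close>

definition HN_filtration :: "('o, 'm) tricat \<Rightarrow> (real \<Rightarrow> 'o set) \<Rightarrow> 'o \<Rightarrow> nat \<Rightarrow>
    (nat \<Rightarrow> 'o) \<Rightarrow> (nat \<Rightarrow> 'o) \<Rightarrow> (nat \<Rightarrow> real) \<Rightarrow> bool" where
  "HN_filtration C P E n F A \<phi> \<longleftrightarrow> is_zero C (F 0) \<and> F n = E \<and>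
     (\<forall>i<n. A i \<in> P (\<phi> i) \<and> \<not> is_zero C (A i) \<and>
            (\<exists>f g h. Tri C (F i) (F (Suc i)) (A i) f g h)) \<and>
     (\<forall>i j. i < j \<longrightarrow> j < n \<longrightarrow> \<phi> j < \<phi> i)"

definition slicing :: "('o, 'm) tricat \<Rightarrow> (real \<Rightarrow> 'o set) \<Rightarrow> bool" where
  "slicing C P \<longleftrightarrow>
     (\<forall>\<phi>. additive_subcategory C (P \<phi>)) \<and>
     (\<forall>\<phi>. Sh C ` P \<phi> = P (\<phi> + 1)) \<and>
     (\<forall>\<phi>\<^sub>1 \<phi>\<^sub>2. \<phi>\<^sub>1 > \<phi>\<^sub>2 \<longrightarrow> (\<forall>A\<in>P \<phi>\<^sub>1. \<forall>B\<in>P \<phi>\<^sub>2. Hom C A B = {Nul C A B})) \<and>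
     (\<forall>E\<in>Obj C. \<not> is_zero C E \<longrightarrow> (\<exists>n F A \<phi>. HN_filtration C P E n F A \<phi>))"

text \<open>The condition \<open>Z \<in> extensional \<dots>\<close> only fixes the junk values of \<open>Z\<close> outside \<open>K\<^sub>0\<close>.\<close>

definition stability_condition :: "('o, 'm) tricat \<Rightarrow> 'o stab \<Rightarrow> bool" where
  "stability_condition C \<sigma> \<longleftrightarrow> (case \<sigma> of (Z, P) \<Rightarrow>
     Z \<in> hom (K0 C) complex_add \<and> Z \<in> extensional (carrier (K0 C)) \<and>
     slicing C P \<and>
     (\<forall>\<phi>. \<forall>E\<in>P \<phi>. \<not> is_zero C E \<longrightarrow>
        (\<exists>m>0. Z (K0_class C E) = of_real m * exp (\<i> * of_real pi * of_real \<phi>))))"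

inductive_set ext_closure :: "('o, 'm) tricat \<Rightarrow> 'o set \<Rightarrow> 'o set"
  for C :: "('o, 'm) tricat" and S :: "'o set" where
  base: "X \<in> S \<Longrightarrow> X \<in> ext_closure C S"
| ext: "\<lbrakk>X \<in> ext_closure C S; Z \<in> ext_closure C S; Tri C X Y Z f g h\<rbrakk> \<Longrightarrow> Y \<in> ext_closure C S"

definition slices :: "('o, 'm) tricat \<Rightarrow> (real \<Rightarrow> 'o set) \<Rightarrow> real set \<Rightarrow> 'o set" where
  "slices C P I = ext_closure C (\<Union>\<phi>\<in>I. P \<phi>)"

definition semistables :: "('o, 'm) tricat \<Rightarrow> 'o stab \<Rightarrow> 'o set" where
  "semistables C \<sigma> = {E. \<not> is_zero C E \<and> (\<exists>\<phi>. E \<in> snd \<sigma> \<phi>)}"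

text \<open>The infimum is taken in \<open>[0, \<infinity>]\<close>, so it is \<open>\<infinity>\<close> if there are no nonzero objects.\<close>

definition reasonable :: "('o, 'm) tricat \<Rightarrow> 'o stab \<Rightarrow> bool" where
  "reasonable C \<sigma> \<longleftrightarrow> (INF E\<in>semistables C \<sigma>. ennreal (norm (fst \<sigma> (K0_class C E)))) > 0"

text \<open>Kernels, cokernels and strict subobjects in the full subcategory with objects \<open>S\<close>.\<close>

definition is_kernel :: "('o, 'm) tricat \<Rightarrow> 'o set \<Rightarrow> 'o \<Rightarrow> 'o \<Rightarrow> 'o \<Rightarrow> 'm \<Rightarrow> 'm \<Rightarrow> bool" where
  "is_kernel C S K E F k g \<longleftrightarrow> K \<in> S \<and> E \<in> S \<and> F \<in> S \<and>
     k \<in> Hom C K E \<and> g \<in> Hom C E F \<and> g \<cdot>\<^bsub>C\<^esub> k = Nul C K F \<and>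
     (\<forall>T\<in>S. \<forall>t\<in>Hom C T E. g \<cdot>\<^bsub>C\<^esub> t = Nul C T F \<longrightarrow> (\<exists>!s. s \<in> Hom C T K \<and> k \<cdot>\<^bsub>C\<^esub> s = t))"

definition is_cokernel :: "('o, 'm) tricat \<Rightarrow> 'o set \<Rightarrow> 'o \<Rightarrow> 'o \<Rightarrow> 'o \<Rightarrow> 'm \<Rightarrow> 'm \<Rightarrow> bool" where
  "is_cokernel C S K E F k g \<longleftrightarrow> K \<in> S \<and> E \<in> S \<and> F \<in> S \<and>
     k \<in> Hom C K E \<and> g \<in> Hom C E F \<and> g \<cdot>\<^bsub>C\<^esub> k = Nul C K F \<and>
     (\<forall>T\<in>S. \<forall>t\<in>Hom C E T. t \<cdot>\<^bsub>C\<^esub> k = Nul C K T \<longrightarrow> (\<exists>!s. s \<in> Hom C F T \<and> s \<cdot>\<^bsub>C\<^esub> g = t))"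

text \<open>
  A morphism is strict if its coimage maps isomorphically to its image; for a monomorphism this
  says that it is a kernel of its cokernel.
\<close>

definition strict_subobject :: "('o, 'm) tricat \<Rightarrow> 'o set \<Rightarrow> 'o \<Rightarrow> 'o \<Rightarrow> 'm \<Rightarrow> bool" where
  "strict_subobject C S E K k \<longleftrightarrow>
     (\<exists>F g. is_cokernel C S K E F k g \<and> is_kernel C S K E F k g)"

definition subobject_le :: "('o, 'm) tricat \<Rightarrow> 'o \<Rightarrow> 'm \<Rightarrow> 'o \<Rightarrow> 'm \<Rightarrow> bool" where
  "subobject_le C K k L l \<longleftrightarrow> (\<exists>u\<in>Hom C K L. l \<cdot>\<^bsub>C\<^esub> u = k)"

definition finite_length :: "('o, 'm) tricat \<Rightarrow> 'o set \<Rightarrow> bool" where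
  "finite_length C S \<longleftrightarrow> (\<forall>E\<in>S. \<forall>K k. (\<forall>n. strict_subobject C S E (K n) (k n)) \<longrightarrow>
     ((\<forall>n::nat. subobject_le C (K n) (k n) (K (Suc n)) (k (Suc n))) \<longrightarrow>
        (\<exists>N. \<forall>n\<ge>N. subobject_le C (K (Suc n)) (k (Suc n)) (K n) (k n))) \<and>
     ((\<forall>n::nat. subobject_le C (K (Suc n)) (k (Suc n)) (K n) (k n)) \<longrightarrow>
        (\<exists>N. \<forall>n\<ge>N. subobject_le C (K n) (k n) (K (Suc n)) (k (Suc n)))))"

text \<open>
  \<open>P(\<phi> - \<eta>, \<phi> + \<eta>)\<close> is quasi-abelian when the interval has length at most 1, whence \<open>\<eta> \<le> 1/2\<close>.
\<close>

definition locally_finite :: "('o, 'm) tricat \<Rightarrow> 'o stab \<Rightarrow> bool" where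
  "locally_finite C \<sigma> \<longleftrightarrow>
     (\<exists>\<eta>>0. \<eta> \<le> 1/2 \<and> (\<forall>\<phi>. finite_length C (slices C (snd \<sigma>) {\<phi> - \<eta><..<\<phi> + \<eta>})))"

definition Stab :: "('o, 'm) tricat \<Rightarrow> 'o stab set" where
  "Stab C = {\<sigma>. stability_condition C \<sigma> \<and> locally_finite C \<sigma>}"


section \<open>The topology on the space of stability conditions\<close>

definition charge_norm ::
    "('o, 'm) tricat \<Rightarrow> 'o stab \<Rightarrow> (('o, int) poly_mapping set \<Rightarrow> complex) \<Rightarrow> ennreal" where
  "charge_norm C \<sigma> U =
     (SUP E\<in>semistables C \<sigma>. ennreal (norm (U (K0_class C E)) / norm (fst \<sigma> (K0_class C E))))"

definition slicing_dist ::
    "('o, 'm) tricat \<Rightarrow> (real \<Rightarrow> 'o set) \<Rightarrow> (real \<Rightarrow> 'o set) \<Rightarrow> ennreal" where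
  "slicing_dist C P Q =
     (INF \<epsilon>\<in>{\<epsilon>. 0 \<le> \<epsilon> \<and> (\<forall>\<phi>. Q \<phi> \<subseteq> slices C P {\<phi> - \<epsilon>..\<phi> + \<epsilon>})}. ennreal \<epsilon>)"

definition stab_ball :: "('o, 'm) tricat \<Rightarrow> real \<Rightarrow> 'o stab \<Rightarrow> 'o stab set" where
  "stab_ball C \<epsilon> \<sigma> = {\<tau> \<in> Stab C.
     charge_norm C \<sigma> (\<lambda>x. fst \<tau> x - fst \<sigma> x) < ennreal (sin (pi * \<epsilon>)) \<and>
     slicing_dist C (snd \<sigma>) (snd \<tau>) < ennreal \<epsilon>}"

text \<open>
  The topology in which the sets \<open>stab_ball C \<epsilon> \<sigma>\<close> form a basis of neighbourhoods of \<open>\<sigma>\<close>. Only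
  small \<open>\<epsilon>\<close> matter, the bound \<open>1/8\<close> being Bridgeland's; on this range the sets shrink with \<open>\<epsilon>\<close>.
\<close>

definition stab_open :: "('o, 'm) tricat \<Rightarrow> 'o stab set \<Rightarrow> bool" where
  "stab_open C U \<longleftrightarrow> U \<subseteq> Stab C \<and> (\<forall>\<sigma>\<in>U. \<exists>\<epsilon>. 0 < \<epsilon> \<and> \<epsilon> < 1/8 \<and> stab_ball C \<epsilon> \<sigma> \<subseteq> U)"

definition stab_topology :: "('o, 'm) tricat \<Rightarrow> 'o stab topology" where
  "stab_topology C = topology (stab_open C)"

lemma stab_ball_mono:
  assumes "0 < \<delta>" "\<delta> \<le> \<epsilon>" "\<epsilon> < 1/8"
  shows "stab_ball C \<delta> \<sigma> \<subseteq> stab_ball C \<epsilon> \<sigma>"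
proof -
  have "pi * \<epsilon> \<le> pi * (1/2)"
    by (intro mult_left_mono) (use assms in auto)
  moreover have "pi * \<delta> \<le> pi * \<epsilon>"
    by (intro mult_left_mono) (use assms in auto)
  moreover have "0 \<le> pi * \<delta>"
    using assms by simp
  ultimately have "sin (pi * \<delta>) \<le> sin (pi * \<epsilon>)"
    using pi_ge_zero by (intro sin_monotone_2pi_le) linarith+
  then show ?thesis
    using assms unfolding stab_ball_def by (auto intro: order.strict_trans2 ennreal_leI)
qed

lemma istopology_stab_open: "istopology (stab_open C)"
  unfolding istopology_def
proof (intro conjI allI impI)
  fix S T assume ST: "stab_open C S" "stab_open C T"
  show "stab_open C (S \<inter> T)"
    unfolding stab_open_def
  proof (intro conjI ballI)
    show "S \<inter> T \<subseteq> Stab C" using ST unfolding stab_open_def by blast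
    fix \<sigma> assume "\<sigma> \<in> S \<inter> T"
    then obtain d e where de: "0 < d" "d < 1/8" "stab_ball C d \<sigma> \<subseteq> S"
        "0 < e" "e < 1/8" "stab_ball C e \<sigma> \<subseteq> T"
      using ST unfolding stab_open_def by blast
    then have "stab_ball C (min d e) \<sigma> \<subseteq> S \<inter> T"
      using stab_ball_mono[of "min d e" d C \<sigma>] stab_ball_mono[of "min d e" e C \<sigma>] by auto
    then show "\<exists>\<epsilon>>0. \<epsilon> < 1/8 \<and> stab_ball C \<epsilon> \<sigma> \<subseteq> S \<inter> T"
      using de by (intro exI[of _ "min d e"]) auto
  qed
next
  fix \<K> assume "\<forall>K\<in>\<K>. stab_open C K"
  then show "stab_open C (\<Union>\<K>)"
    unfolding stab_open_def by (meson Sup_least Union_iff Union_upper subset_trans)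
qed

lemma openin_stab_topology: "openin (stab_topology C) U \<longleftrightarrow> stab_open C U"
  by (simp add: stab_topology_def istopology_stab_open topology_inverse')

lemma topspace_stab_topology: "topspace (stab_topology C) = Stab C"
proof -
  have "stab_open C (Stab C)"
    unfolding stab_open_def by (auto intro!: exI[of _ "1/16"] simp: stab_ball_def)
  then show ?thesis
    unfolding topspace_def openin_stab_topology by (auto simp: stab_open_def)
qed


section \<open>Gluing\<close>

definition heart :: "('o, 'm) tricat \<Rightarrow> 'o stab \<Rightarrow> 'o set" where
  "heart C \<sigma> = slices C (snd \<sigma>) {0<..1}"

definition glued :: "('o, 'm) tricat \<Rightarrow> 'o set \<Rightarrow> 'o set \<Rightarrow>
    'o stab \<Rightarrow> 'o stab \<Rightarrow> 'o stab \<Rightarrow> bool" where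
  "glued C D1 D2 \<sigma> \<sigma>\<^sub>1 \<sigma>\<^sub>2 \<longleftrightarrow> stability_condition C \<sigma> \<and>
     Hom_le_vanishes C 0 (heart (full_sub C D1) \<sigma>\<^sub>1) (heart (full_sub C D2) \<sigma>\<^sub>2) \<and>
     heart C \<sigma> = {E \<in> Obj C. lambda1 C D1 D2 E \<in> heart (full_sub C D1) \<sigma>\<^sub>1 \<and>
                              rho2 C D1 D2 E \<in> heart (full_sub C D2) \<sigma>\<^sub>2} \<and>
     (\<forall>E\<in>Obj C. fst \<sigma> (K0_class C E) =
        fst \<sigma>\<^sub>1 (K0_class (full_sub C D1) (lambda1 C D1 D2 E)) +
        fst \<sigma>\<^sub>2 (K0_class (full_sub C D2) (rho2 C D1 D2 E)))"

definition glue_domain ::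
    "('o, 'm) tricat \<Rightarrow> 'o set \<Rightarrow> 'o set \<Rightarrow> real \<Rightarrow> ('o stab \<times> 'o stab) set" where
  "glue_domain C D1 D2 a =
     {(\<sigma>\<^sub>1, \<sigma>\<^sub>2). \<sigma>\<^sub>1 \<in> Stab (full_sub C D1) \<and> \<sigma>\<^sub>2 \<in> Stab (full_sub C D2) \<and>
        reasonable (full_sub C D1) \<sigma>\<^sub>1 \<and> reasonable (full_sub C D2) \<sigma>\<^sub>2 \<and>
        Hom_le_vanishes C 0 (slices (full_sub C D1) (snd \<sigma>\<^sub>1) {0<..1})
                            (slices (full_sub C D2) (snd \<sigma>\<^sub>2) {0<..1}) \<and>
        Hom_le_vanishes C 0 (slices (full_sub C D1) (snd \<sigma>\<^sub>1) {a<..a + 1})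
                            (slices (full_sub C D2) (snd \<sigma>\<^sub>2) {a<..a + 1})}"

definition gl :: "('o, 'm) tricat \<Rightarrow> 'o set \<Rightarrow> 'o set \<Rightarrow> 'o stab \<times> 'o stab \<Rightarrow> 'o stab" where
  "gl C D1 D2 = (\<lambda>(\<sigma>\<^sub>1, \<sigma>\<^sub>2). THE \<sigma>. glued C D1 D2 \<sigma> \<sigma>\<^sub>1 \<sigma>\<^sub>2)"

end

theory Submission
  imports Defs
begin

text \<open>
  Both vanishing hypotheses are invariant under the shift, so they hold at all the cut points
  \<open>\<dots> < 0 < a < 1 < a + 1 < 2 < \<dots>\<close>. At each of them the truncations of the two components of an object
  can be assembled to a truncation of the object (\<open>glued_cut\<close>). So \<open>C\<close> carries a chain of glued
  t-structures, which chops it into cells: the objects whose two components have phases in one of the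
  intervals of length \<open>a\<close> or \<open>1 - a\<close> between consecutive cut points.

  What the second hypothesis buys is that these intervals are shorter than \<open>1\<close>. In the heart the charges of the
  two components may almost cancel; in a cell all charges lie in a sector of angle
  less than \<open>\<pi>\<close>, and the projection to its middle direction controls the modulus.

  \<^item> Existence. For reasonable \<open>\<sigma>\<^sub>1\<close> and \<open>\<sigma>\<^sub>2\<close> this projection is bounded away from \<open>0\<close> on the
    nonzero objects of a cell, so that induction on its size yields Harder-Narasimhan filtrations inside
    each cell (\<open>hn_exists_in_cell\<close>). Maps from larger to smaller phases vanish: between
    different cells by the t-structures, inside a cell by image factorisation (\<open>semistable_orth_same_cell\<close>).
    The filtrations of the cells concatenate to a stability condition whose charges keep the
    lower bound. So it is reasonable, hence locally finite (\<open>finite_length_of_lower_bound\<close>). Its heart and charge are the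
    glued ones, and a heart and a charge determine a slicing (\<open>slicing_determined_by_heart\<close>), so it is \<open>gl (\<sigma>\<^sub>1, \<sigma>\<^sub>2)\<close>.

  \<^item> The charges are close. A semistable object of the glued stability condition lies in a cell, where the
    charges of its two components do not cancel. Hence a small relative change of the
    charges of the components is a small relative change of their sum (\<open>charge_close\<close>).

  \<^item> The slicings are close. Semistable objects of \<open>\<sigma>\<^sub>1\<close> and \<open>\<sigma>\<^sub>2\<close> remain semistable of the same phase in \<open>C\<close>
    (\<open>P1_semistable\<close>, \<open>P2_semistable\<close>), so if \<open>\<sigma>\<^sub>i\<close> and \<open>\<tau>\<^sub>i\<close> have slicings at distance less than \<open>\<delta>\<close>,
    then an object of a cell for one pair has phases at distance at most \<open>\<delta>\<close> from that cell for the
    other pair. Let \<open>F\<close> be semistable of phase \<open>\<phi>\<close> for \<open>gl (\<tau>\<^sub>1, \<tau>\<^sub>2)\<close>, and let \<open>X\<close> be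
    its part of phases above \<open>\<phi> + e\<close> for \<open>gl (\<sigma>\<^sub>1, \<sigma>\<^sub>2)\<close>. As a part of \<open>F\<close> it has phases
    at most \<open>\<phi>\<close> for \<open>gl (\<tau>\<^sub>1, \<tau>\<^sub>2)\<close>. If \<open>X\<close> were nonzero, its two charges would lie on opposite sides of the line of
    phase \<open>\<phi>\<close>, the first at an angle of at least \<open>\<pi> e\<close> from it, against the closeness of charges. The part of
    phases at most \<open>\<phi> - e\<close> is treated dually (\<open>semistable_close\<close>).

  Continuity follows by comparing basic neighbourhoods, which are open sets (\<open>stab_ball_open\<close>).
\<close>

section \<open>Calculus of triangles\<close>

text \<open>
  Most arguments concern objects only: that some distinguished triangle links them is all that is used.
\<close>

definition tri :: "('o, 'm) tricat \<Rightarrow> 'o \<Rightarrow> 'o \<Rightarrow> 'o \<Rightarrow> bool" where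
  "tri C X Y Z \<longleftrightarrow> (\<exists>f g h. Tri C X Y Z f g h)"

definition orth :: "('o, 'm) tricat \<Rightarrow> 'o \<Rightarrow> 'o \<Rightarrow> bool" where
  "orth C A B \<longleftrightarrow> Hom C A B = {Nul C A B}"

definition unshift :: "('o, 'm) tricat \<Rightarrow> 'o \<Rightarrow> 'o" where
  "unshift C = inv_into (Obj C) (Sh C)"

definition neg :: "('o, 'm) tricat \<Rightarrow> 'o \<Rightarrow> 'o \<Rightarrow> 'm \<Rightarrow> 'm" where
  "neg C X Y f = inv\<^bsub>HomG C X Y\<^esub> f"

lemma HomG_sel [simp]:
  "carrier (HomG C A B) = Hom C A B" "mult (HomG C A B) = Add C" "one (HomG C A B) = Nul C A B"
  by (simp_all add: HomG_def)

context additive_category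
begin

lemma Nul_in [simp]: "\<lbrakk>X \<in> Obj C; Y \<in> Obj C\<rbrakk> \<Longrightarrow> Nul C X Y \<in> Hom C X Y"
  using comm_groupE(2)[OF HomG_group] by simp

lemma Nul_Add: "\<lbrakk>X \<in> Obj C; Y \<in> Obj C; f \<in> Hom C X Y\<rbrakk> \<Longrightarrow> Add C (Nul C X Y) f = f"
  using comm_groupE(5)[OF HomG_group] by simp

lemma Add_Nul: "\<lbrakk>X \<in> Obj C; Y \<in> Obj C; f \<in> Hom C X Y\<rbrakk> \<Longrightarrow> Add C f (Nul C X Y) = f"
  using comm_groupE(4,5)[OF HomG_group] by simp

lemma Add_commute: "\<lbrakk>X \<in> Obj C; Y \<in> Obj C; f \<in> Hom C X Y; g \<in> Hom C X Y\<rbrakk> \<Longrightarrow> Add C f g = Add C g f"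
  using comm_groupE(4)[OF HomG_group] by simp

lemma group_HomG: "\<lbrakk>X \<in> Obj C; Y \<in> Obj C\<rbrakk> \<Longrightarrow> group (HomG C X Y)"
  using HomG_group by (simp add: comm_group_def)

lemma neg_in: "\<lbrakk>X \<in> Obj C; Y \<in> Obj C; f \<in> Hom C X Y\<rbrakk> \<Longrightarrow> neg C X Y f \<in> Hom C X Y"
  using group.inv_closed[OF group_HomG] by (simp add: neg_def)

lemma neg_Add: "\<lbrakk>X \<in> Obj C; Y \<in> Obj C; f \<in> Hom C X Y\<rbrakk> \<Longrightarrow> Add C (neg C X Y f) f = Nul C X Y"
  using group.l_inv[OF group_HomG] by (simp add: neg_def)

lemma neg_neg: "\<lbrakk>X \<in> Obj C; Y \<in> Obj C; f \<in> Hom C X Y\<rbrakk> \<Longrightarrow> neg C X Y (neg C X Y f) = f"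
  using group.inv_inv[OF group_HomG] by (simp add: neg_def)

lemma neg_Nul: "\<lbrakk>X \<in> Obj C; Y \<in> Obj C\<rbrakk> \<Longrightarrow> neg C X Y (Nul C X Y) = Nul C X Y"
  using monoid.inv_one[OF group.is_monoid[OF group_HomG]] by (simp add: neg_def)

lemma neg_unique:
  "\<lbrakk>X \<in> Obj C; Y \<in> Obj C; f \<in> Hom C X Y; g \<in> Hom C X Y; Add C g f = Nul C X Y\<rbrakk> \<Longrightarrow> neg C X Y f = g"
  using group.inv_equality[OF group_HomG] by (simp add: neg_def)

lemma Add_self_cancel:
  "\<lbrakk>X \<in> Obj C; Y \<in> Obj C; f \<in> Hom C X Y; Add C f f = f\<rbrakk> \<Longrightarrow> f = Nul C X Y"
  using group.l_cancel_one[OF group_HomG, of X Y f f] by simp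

lemma Add_left_cancel_Nul:
  "\<lbrakk>X \<in> Obj C; Y \<in> Obj C; f \<in> Hom C X Y; g \<in> Hom C X Y; Add C f g = g\<rbrakk> \<Longrightarrow> f = Nul C X Y"
  using group.r_cancel_one[OF group_HomG, of X Y g f] by simp

lemma Comp_Nul:
  assumes "X \<in> Obj C" "Y \<in> Obj C" "Z \<in> Obj C" "g \<in> Hom C Y Z"
  shows "g \<cdot> Nul C X Y = Nul C X Z"
proof -
  have "Add C (g \<cdot> Nul C X Y) (g \<cdot> Nul C X Y) = g \<cdot> Nul C X Y"
    using Comp_Add[of X Y Z "Nul C X Y" "Nul C X Y" g] assms by (simp add: Nul_Add)
  then show ?thesis using Add_self_cancel Comp_in assms Nul_in by metis
qed

lemma Nul_Comp:
  assumes "X \<in> Obj C" "Y \<in> Obj C" "Z \<in> Obj C" "f \<in> Hom C X Y"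
  shows "Nul C Y Z \<cdot> f = Nul C X Z"
proof -
  have "Add C (Nul C Y Z \<cdot> f) (Nul C Y Z \<cdot> f) = Nul C Y Z \<cdot> f"
    using Add_Comp[of X Y Z f "Nul C Y Z" "Nul C Y Z"] assms by (simp add: Nul_Add)
  then show ?thesis using Add_self_cancel Comp_in assms Nul_in by metis
qed

lemma neg_Comp:
  assumes "X \<in> Obj C" "Y \<in> Obj C" "Z \<in> Obj C" "f \<in> Hom C X Y" "g \<in> Hom C Y Z"
  shows "neg C Y Z g \<cdot> f = neg C X Z (g \<cdot> f)"
  using Add_Comp[of X Y Z f "neg C Y Z g" g] assms
  by (intro neg_unique[symmetric]) (auto simp: neg_in neg_Add Nul_Comp intro: Comp_in)

lemma Comp_neg:
  assumes "X \<in> Obj C" "Y \<in> Obj C" "Z \<in> Obj C" "f \<in> Hom C X Y" "g \<in> Hom C Y Z"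
  shows "g \<cdot> neg C X Y f = neg C X Z (g \<cdot> f)"
  using Comp_Add[of X Y Z "neg C X Y f" f g] assms
  by (intro neg_unique[symmetric]) (auto simp: neg_in neg_Add Comp_Nul intro: Comp_in)

lemma ex_diff:
  assumes "X \<in> Obj C" "Y \<in> Obj C" "f \<in> Hom C X Y" "g \<in> Hom C X Y"
  obtains d where "d \<in> Hom C X Y" "Add C d g = f"
proof -
  interpret G: group "HomG C X Y" using group_HomG assms by simp
  have "f \<otimes>\<^bsub>HomG C X Y\<^esub> inv\<^bsub>HomG C X Y\<^esub> g \<otimes>\<^bsub>HomG C X Y\<^esub> g = f"
    using assms G.inv_solve_right' by (metis G.inv_closed G.m_closed HomG_sel(1))
  then show thesis using that[of "f \<otimes>\<^bsub>HomG C X Y\<^esub> inv\<^bsub>HomG C X Y\<^esub> g"] assms G.m_closed G.inv_closed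
    by (metis HomG_sel(1,2))
qed

lemma Comp_Ide_Hom: "f \<in> Hom C X Y \<Longrightarrow> X \<in> Obj C \<Longrightarrow> Y \<in> Obj C \<Longrightarrow> f \<cdot> Ide C X = f"
  by (rule Comp_Ide)

lemma Ide_Comp_Hom: "f \<in> Hom C X Y \<Longrightarrow> X \<in> Obj C \<Longrightarrow> Y \<in> Obj C \<Longrightarrow> Ide C Y \<cdot> f = f"
  by (rule Ide_Comp)

text \<open>
  The difference \<open>d\<close> of the identity and \<open>u\<close> satisfies \<open>f \<cdot> d = 0\<close>. Retractions and the uniqueness of
  truncations are obtained in this way.
\<close>

lemma endo_eq_Ide_left:
  assumes "X \<in> Obj C" "Y \<in> Obj C" "u \<in> Hom C X X" "f \<in> Hom C X Y" "f \<cdot> u = f"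
    and cancel: "\<And>d. d \<in> Hom C X X \<Longrightarrow> f \<cdot> d = Nul C X Y \<Longrightarrow> d = Nul C X X"
  shows "u = Ide C X"
proof -
  obtain d where d: "d \<in> Hom C X X" "Add C d u = Ide C X" using ex_diff[of X X "Ide C X" u] assms Ide_in by metis
  have "Add C (f \<cdot> d) f = f" using Comp_Add[of X X Y d u f] d assms(1-5) by (simp add: Comp_Ide_Hom)
  then have "f \<cdot> d = Nul C X Y" using Add_left_cancel_Nul[of X Y "f \<cdot> d" f] Comp_in[of X X Y d f] d assms by simp
  then show ?thesis using cancel d Nul_Add[of X X u] assms by simp
qed

lemma endo_eq_Ide_right:
  assumes "X \<in> Obj C" "Y \<in> Obj C" "u \<in> Hom C X X" "f \<in> Hom C Y X" "u \<cdot> f = f"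
    and cancel: "\<And>d. d \<in> Hom C X X \<Longrightarrow> d \<cdot> f = Nul C Y X \<Longrightarrow> d = Nul C X X"
  shows "u = Ide C X"
proof -
  obtain d where d: "d \<in> Hom C X X" "Add C d u = Ide C X" using ex_diff[of X X "Ide C X" u] assms Ide_in by metis
  have "Add C (d \<cdot> f) f = f" using Add_Comp[of Y X X f d u] d assms(1-5) by (simp add: Ide_Comp_Hom)
  then have "d \<cdot> f = Nul C Y X" using Add_left_cancel_Nul[of Y X "d \<cdot> f" f] Comp_in[of Y X X f d] d assms by simp
  then show ?thesis using cancel d Nul_Add[of X X u] assms by simp
qed

subsection \<open>Zero objects and isomorphic objects\<close>

lemma is_zero_iff: "is_zero C E \<longleftrightarrow> E \<in> Obj C \<and> orth C E E"
proof
  assume "is_zero C E" then show "E \<in> Obj C \<and> orth C E E" by (auto simp: is_zero_def orth_def)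
next
  assume E: "E \<in> Obj C \<and> orth C E E"
  then have *: "Ide C E = Nul C E E" using Ide_in by (auto simp: orth_def)
  have "f = Nul C E B" if "B \<in> Obj C" "f \<in> Hom C E B" for B f
    using Comp_Ide[of E B f] Comp_Nul[of E E B f] * E that by simp
  moreover have "f = Nul C B E" if "B \<in> Obj C" "f \<in> Hom C B E" for B f
    using Ide_Comp[of B E f] Nul_Comp[of B E E f] * E that by simp
  ultimately show "is_zero C E"
    unfolding is_zero_def using E Nul_in by blast
qed

lemma is_zero_Obj: "is_zero C E \<Longrightarrow> E \<in> Obj C" by (simp add: is_zero_def)

lemma orth_zero: "is_zero C Z \<Longrightarrow> W \<in> Obj C \<Longrightarrow> orth C Z W"
  "is_zero C Z \<Longrightarrow> W \<in> Obj C \<Longrightarrow> orth C W Z"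
  by (auto simp: is_zero_def orth_def)

lemma orthI: "\<lbrakk>X \<in> Obj C; Y \<in> Obj C; \<And>f. f \<in> Hom C X Y \<Longrightarrow> f = Nul C X Y\<rbrakk> \<Longrightarrow> orth C X Y"
  unfolding orth_def using Nul_in by blast

lemma orthD: "orth C X Y \<Longrightarrow> f \<in> Hom C X Y \<Longrightarrow> f = Nul C X Y"
  unfolding orth_def by blast

lemma is_iso_Ide: "X \<in> Obj C \<Longrightarrow> is_iso C X X (Ide C X)"
  unfolding is_iso_def using Ide_in Comp_Ide by blast

lemma isomorphic_refl: "X \<in> Obj C \<Longrightarrow> isomorphic C X X"
  unfolding isomorphic_def using is_iso_Ide by blast

lemma isomorphic_sym: "isomorphic C X Y \<Longrightarrow> isomorphic C Y X"
  unfolding isomorphic_def is_iso_def by blast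

lemma isomorphic_Obj: "isomorphic C X Y \<Longrightarrow> X \<in> Obj C" "isomorphic C X Y \<Longrightarrow> Y \<in> Obj C"
  unfolding isomorphic_def by auto

lemma Comp_assoc4:
  assumes "V \<in> Obj C" "W \<in> Obj C" "X \<in> Obj C" "Y \<in> Obj C" "Z \<in> Obj C"
    "f \<in> Hom C V W" "g \<in> Hom C W X" "h \<in> Hom C X Y" "k \<in> Hom C Y Z"
  shows "k \<cdot> h \<cdot> (g \<cdot> f) = k \<cdot> (h \<cdot> g \<cdot> f)"
proof -
  have "g \<cdot> f \<in> Hom C V X" using assms(1-3,6,7) by (rule Comp_in)
  then have "k \<cdot> h \<cdot> (g \<cdot> f) = k \<cdot> (h \<cdot> (g \<cdot> f))"
    using assms(1,3-5,8,9) by (intro Comp_assoc[of V X Y Z]) auto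
  also have "h \<cdot> (g \<cdot> f) = h \<cdot> g \<cdot> f"
    using assms by (intro Comp_assoc[symmetric, of V W X Y]) auto
  finally show ?thesis .
qed

lemma isomorphic_trans:
  assumes "isomorphic C X Y" "isomorphic C Y Z" shows "isomorphic C X Z"
proof -
  have o: "X \<in> Obj C" "Y \<in> Obj C" "Z \<in> Obj C" using assms isomorphic_Obj by blast+
  obtain f f' where f: "f \<in> Hom C X Y" "f' \<in> Hom C Y X" "f' \<cdot> f = Ide C X" "f \<cdot> f' = Ide C Y"
    using assms(1) unfolding isomorphic_def is_iso_def by auto
  obtain g g' where g: "g \<in> Hom C Y Z" "g' \<in> Hom C Z Y" "g' \<cdot> g = Ide C Y" "g \<cdot> g' = Ide C Z"
    using assms(2) unfolding isomorphic_def is_iso_def by auto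
  have "f' \<cdot> g' \<cdot> (g \<cdot> f) = f' \<cdot> (g' \<cdot> g \<cdot> f)"
    using o f g by (intro Comp_assoc4[of X Y Z Y X]) auto
  also have "\<dots> = Ide C X" using o f g by (simp add: Ide_Comp_Hom)
  finally have 1: "f' \<cdot> g' \<cdot> (g \<cdot> f) = Ide C X" .
  have "g \<cdot> f \<cdot> (f' \<cdot> g') = g \<cdot> (f \<cdot> f' \<cdot> g')"
    using o f g by (intro Comp_assoc4[of Z Y X Y Z]) auto
  also have "\<dots> = Ide C Z" using o f g by (simp add: Ide_Comp_Hom)
  finally have 2: "g \<cdot> f \<cdot> (f' \<cdot> g') = Ide C Z" .
  show ?thesis unfolding isomorphic_def is_iso_def using 1 2 o f g Comp_in by blast
qed

lemma orth_iso_left: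
  assumes "isomorphic C X X'" "orth C X Y" "Y \<in> Obj C" shows "orth C X' Y"
proof -
  obtain f f' where f: "f \<in> Hom C X X'" "f' \<in> Hom C X' X" "f' \<cdot> f = Ide C X" "f \<cdot> f' = Ide C X'"
    and o: "X \<in> Obj C" "X' \<in> Obj C"
    using assms(1) unfolding isomorphic_def is_iso_def by auto
  show ?thesis
  proof (rule orthI)
    fix t assume t: "t \<in> Hom C X' Y"
    have "t \<cdot> f = Nul C X Y" using orthD[OF assms(2)] Comp_in t f o assms(3) by blast
    then have "t \<cdot> f \<cdot> f' = Nul C X' Y" using Nul_Comp f o assms(3) by simp
    then show "t = Nul C X' Y" using Comp_assoc[of X' X X' Y f' f t] f o t assms(3) Comp_Ide_Hom by simp
  qed (use o assms in auto)
qed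

lemma orth_iso_right:
  assumes "isomorphic C X X'" "orth C Y X" "Y \<in> Obj C" shows "orth C Y X'"
proof -
  obtain f f' where f: "f \<in> Hom C X X'" "f' \<in> Hom C X' X" "f' \<cdot> f = Ide C X" "f \<cdot> f' = Ide C X'"
    and o: "X \<in> Obj C" "X' \<in> Obj C"
    using assms(1) unfolding isomorphic_def is_iso_def by auto
  show ?thesis
  proof (rule orthI)
    fix t assume t: "t \<in> Hom C Y X'"
    have "f' \<cdot> t = Nul C Y X" using orthD[OF assms(2)] Comp_in t f o assms(3) by blast
    then have "f \<cdot> (f' \<cdot> t) = Nul C Y X'" using Comp_Nul f o assms(3) by simp
    then show "t = Nul C Y X'" using Comp_assoc[of Y X' X X' t f' f] f o t assms(3) Ide_Comp_Hom by simp
  qed (use o assms in auto)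
qed

lemma is_zero_iso: "isomorphic C X Y \<Longrightarrow> is_zero C X \<Longrightarrow> is_zero C Y"
  unfolding is_zero_iff using isomorphic_Obj orth_iso_left orth_iso_right by blast

lemma zero_isomorphic: 
  assumes "is_zero C X" "is_zero C Y" shows "isomorphic C X Y"
proof -
  have o: "X \<in> Obj C" "Y \<in> Obj C" using assms is_zero_Obj by auto
  have "Hom C X X = {Nul C X X}" "Hom C Y Y = {Nul C Y Y}"
    using assms o unfolding is_zero_def by blast+
  then have "f = g" if "f \<in> Hom C X X \<and> g \<in> Hom C X X \<or> f \<in> Hom C Y Y \<and> g \<in> Hom C Y Y" for f g
    using that by auto
  then have "Nul C Y X \<cdot> Nul C X Y = Ide C X" "Nul C X Y \<cdot> Nul C Y X = Ide C Y"
    using o Comp_in[OF _ _ _ Nul_in Nul_in] Ide_in by blast+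
  then show ?thesis unfolding isomorphic_def is_iso_def using o Nul_in by blast
qed

lemma is_biproduct_sym: "is_biproduct C A B S \<Longrightarrow> is_biproduct C B A S"
proof -
  assume "is_biproduct C A B S"
  then obtain i j p q where b: "i \<in> Hom C A S" "j \<in> Hom C B S" "p \<in> Hom C S A" "q \<in> Hom C S B"
    "p \<cdot> i = Ide C A" "q \<cdot> j = Ide C B" "q \<cdot> i = Nul C A B" "p \<cdot> j = Nul C B A"
    "Add C (i \<cdot> p) (j \<cdot> q) = Ide C S" and o: "A \<in> Obj C" "B \<in> Obj C" "S \<in> Obj C"
    unfolding is_biproduct_def by auto
  have "i \<cdot> p \<in> Hom C S S" "j \<cdot> q \<in> Hom C S S" using b o Comp_in by blast+
  then have "Add C (j \<cdot> q) (i \<cdot> p) = Ide C S" using Add_commute o b(9) by metis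
  then show ?thesis unfolding is_biproduct_def using b o by blast
qed

lemma is_biproduct_iso:
  assumes "is_biproduct C A B S" "isomorphic C S S'" shows "is_biproduct C A B S'"
proof -
  obtain i j p q where b: "i \<in> Hom C A S" "j \<in> Hom C B S" "p \<in> Hom C S A" "q \<in> Hom C S B"
    "p \<cdot> i = Ide C A" "q \<cdot> j = Ide C B" "q \<cdot> i = Nul C A B" "p \<cdot> j = Nul C B A"
    "Add C (i \<cdot> p) (j \<cdot> q) = Ide C S" and o: "A \<in> Obj C" "B \<in> Obj C" "S \<in> Obj C"
    using assms(1) unfolding is_biproduct_def by auto
  obtain u v where u: "u \<in> Hom C S S'" "v \<in> Hom C S' S" "v \<cdot> u = Ide C S" "u \<cdot> v = Ide C S'"
    and o': "S' \<in> Obj C"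
    using assms(2) unfolding isomorphic_def is_iso_def by auto
  have can: "r \<cdot> v \<cdot> (u \<cdot> l) = r \<cdot> l" if "l \<in> Hom C X S" "r \<in> Hom C S Y" "X \<in> Obj C" "Y \<in> Obj C" for r l X Y
    using that u o o' Comp_assoc4[of X S S' S Y l u v r] Ide_Comp_Hom by simp
  have cn2: "u \<cdot> l \<cdot> (r \<cdot> v) = u \<cdot> (l \<cdot> r) \<cdot> v" if "l \<in> Hom C X S" "r \<in> Hom C S X" "X \<in> Obj C" for r l X
    using that u o o' Comp_assoc4[of S' S X S S' v r l u] Comp_assoc[of S' S S S' v "l \<cdot> r" u]
      Comp_in[of S X S r l] by simp
  have ip: "i \<cdot> p \<in> Hom C S S" "j \<cdot> q \<in> Hom C S S" using b o Comp_in by blast+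
  have uip: "u \<cdot> (i \<cdot> p) \<in> Hom C S S'" "u \<cdot> (j \<cdot> q) \<in> Hom C S S'" using ip u o o' Comp_in by blast+
  have "Add C (u \<cdot> i \<cdot> (p \<cdot> v)) (u \<cdot> j \<cdot> (q \<cdot> v)) = Add C (u \<cdot> (i \<cdot> p) \<cdot> v) (u \<cdot> (j \<cdot> q) \<cdot> v)"
    using cn2 b o by simp
  also have "\<dots> = Add C (u \<cdot> (i \<cdot> p)) (u \<cdot> (j \<cdot> q)) \<cdot> v"
    using Add_Comp[of S' S S' v] uip u o o' by simp
  also have "\<dots> = u \<cdot> Ide C S \<cdot> v" using Comp_Add[of S S S'] ip u o o' b(9) by metis
  also have "\<dots> = Ide C S'" using u o o' Comp_Ide_Hom by simp
  finally have e: "Add C (u \<cdot> i \<cdot> (p \<cdot> v)) (u \<cdot> j \<cdot> (q \<cdot> v)) = Ide C S'" .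
  have "u \<cdot> i \<in> Hom C A S'" "u \<cdot> j \<in> Hom C B S'" "p \<cdot> v \<in> Hom C S' A" "q \<cdot> v \<in> Hom C S' B"
    using b o o' u Comp_in by blast+
  moreover have "p \<cdot> v \<cdot> (u \<cdot> i) = Ide C A" "q \<cdot> v \<cdot> (u \<cdot> j) = Ide C B"
    "q \<cdot> v \<cdot> (u \<cdot> i) = Nul C A B" "p \<cdot> v \<cdot> (u \<cdot> j) = Nul C B A"
    using b can o by simp_all
  ultimately show ?thesis
    unfolding is_biproduct_def using o o' e by blast
qed

end

context triangulated_category
begin

lemma Sh_Obj [simp]: "X \<in> Obj C \<Longrightarrow> Sh C X \<in> Obj C"
  by (rule bij_betw_apply[OF Sh_bij])

lemma unshift_Obj [simp]: "X \<in> Obj C \<Longrightarrow> unshift C X \<in> Obj C"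
  unfolding unshift_def using inv_into_into[of X "Sh C" "Obj C"] bij_betw_imp_surj_on[OF Sh_bij] by blast

lemma Sh_unshift [simp]: "X \<in> Obj C \<Longrightarrow> Sh C (unshift C X) = X"
  unfolding unshift_def by (rule bij_betw_inv_into_right[OF Sh_bij])

lemma unshift_Sh [simp]: "X \<in> Obj C \<Longrightarrow> unshift C (Sh C X) = X"
  unfolding unshift_def by (rule bij_betw_inv_into_left[OF Sh_bij])

lemma ShM_in: "\<lbrakk>X \<in> Obj C; Y \<in> Obj C; f \<in> Hom C X Y\<rbrakk> \<Longrightarrow> ShM C f \<in> Hom C (Sh C X) (Sh C Y)"
  by (rule bij_betw_apply[OF ShM_bij])

lemma ShM_surj:
  assumes "X \<in> Obj C" "Y \<in> Obj C" "g \<in> Hom C (Sh C X) (Sh C Y)"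
  obtains f where "f \<in> Hom C X Y" "ShM C f = g"
proof -
  have "g \<in> ShM C ` Hom C X Y" using bij_betw_imp_surj_on[OF ShM_bij[OF assms(1,2)]] assms(3) by simp
  then show thesis using that by (elim imageE) simp
qed

lemma ShM_inj: "\<lbrakk>X \<in> Obj C; Y \<in> Obj C; f \<in> Hom C X Y; g \<in> Hom C X Y; ShM C f = ShM C g\<rbrakk> \<Longrightarrow> f = g"
  by (rule inj_onD[OF bij_betw_imp_inj_on[OF ShM_bij]])

lemma ShM_Nul: "\<lbrakk>X \<in> Obj C; Y \<in> Obj C\<rbrakk> \<Longrightarrow> ShM C (Nul C X Y) = Nul C (Sh C X) (Sh C Y)"
  using ShM_Add[of X Y "Nul C X Y" "Nul C X Y"] ShM_in[of X Y "Nul C X Y"]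
  by (intro Add_self_cancel) (auto simp: Nul_Add)

lemma ShM_neg:
  assumes "X \<in> Obj C" "Y \<in> Obj C" "f \<in> Hom C X Y"
  shows "ShM C (neg C X Y f) = neg C (Sh C X) (Sh C Y) (ShM C f)"
  using ShM_Add[of X Y "neg C X Y f" f] assms
  by (intro neg_unique[symmetric]) (auto simp: neg_in neg_Add ShM_Nul intro: ShM_in)

lemma orth_Sh:
  assumes "X \<in> Obj C" "Y \<in> Obj C" shows "orth C (Sh C X) (Sh C Y) \<longleftrightarrow> orth C X Y"
proof
  assume "orth C (Sh C X) (Sh C Y)"
  then show "orth C X Y"
    using assms orthD[of "Sh C X" "Sh C Y"] ShM_in ShM_inj[OF assms _ Nul_in] ShM_Nul
    by (intro orthI) (simp, simp, metis)
next
  assume "orth C X Y"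
  then show "orth C (Sh C X) (Sh C Y)"
    using assms by (intro orthI) (simp, simp, metis ShM_surj ShM_Nul orthD)
qed

lemma is_zero_Sh: "is_zero C X \<Longrightarrow> is_zero C (Sh C X)"
  unfolding is_zero_iff by (simp add: orth_Sh)

lemma Tri_D:
  assumes "Tri C X Y Z f g h"
  shows "X \<in> Obj C" "Y \<in> Obj C" "Z \<in> Obj C" "f \<in> Hom C X Y" "g \<in> Hom C Y Z" "h \<in> Hom C Z (Sh C X)"
  using Tri_type[OF assms] by auto

subsection \<open>Rotation and exactness\<close>

lemma rot: "Tri C X Y Z f g h \<Longrightarrow> Tri C Y Z (Sh C X) g h (neg C (Sh C X) (Sh C Y) (ShM C f))"
  using TR2[of X Y Z f g h] Tri_type[of X Y Z f g h] by (simp add: neg_def)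

lemma unrot:
  assumes "Tri C X Y (Sh C W) f g h" "W \<in> Obj C"
  obtains h' where "Tri C W X Y h' f g" "h' \<in> Hom C W X"
proof -
  note ty = Tri_D[OF assms(1)]
  obtain k where k: "k \<in> Hom C W X" "ShM C k = h"
    using ShM_surj[of W X h] ty assms(2) by auto
  have n: "neg C W X k \<in> Hom C W X" using k ty assms(2) neg_in by auto
  have e: "neg C (Sh C W) (Sh C X) (ShM C (neg C W X k)) = h"
    using k ty assms(2) ShM_neg[of W X k] neg_neg[of "Sh C W" "Sh C X" h] by auto
  have "Tri C W X Y (neg C W X k) f g"
    using TR2[of W X Y "neg C W X k" f g] assms n ty e by (simp add: neg_def)
  with n show thesis using that by blast
qed

lemma Tri_comp_zero:
  assumes "Tri C X Y Z f g h" shows "g \<cdot> f = Nul C X Z"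
proof -
  note ty = Tri_D[OF assms(1)]
  obtain O' where O': "is_zero C O'" using ex_zero by blast
  have "\<exists>w\<in>Hom C O' Z. w \<cdot> Nul C X O' = g \<cdot> f \<and> ShM C (Ide C X) \<cdot> Nul C O' (Sh C X) = h \<cdot> w"
    by (rule TR3[OF TR1_Ide[OF _ O'] assms]) (use ty Ide_in in auto)
  then show ?thesis using Comp_Nul[of X O' Z] ty is_zero_Obj[OF O'] by auto
qed

lemma exact_left:
  assumes T: "Tri C X Y Z f g h" and o: "W \<in> Obj C" and t: "t \<in> Hom C W Y" "g \<cdot> t = Nul C W Z"
  obtains s where "s \<in> Hom C W X" "f \<cdot> s = t"
proof -
  note ty = Tri_D[OF T]
  obtain O' where O': "is_zero C O'" using ex_zero by blast
  have oO: "O' \<in> Obj C" using O' is_zero_Obj by simp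
  have "\<exists>w\<in>Hom C (Sh C W) (Sh C X).
      w \<cdot> Nul C O' (Sh C W) = h \<cdot> Nul C O' Z \<and>
      ShM C t \<cdot> neg C (Sh C W) (Sh C W) (ShM C (Ide C W)) = neg C (Sh C X) (Sh C Y) (ShM C f) \<cdot> w"
    by (rule TR3[OF rot[OF TR1_Ide[OF o O']] rot[OF T]]) (use t ty o oO Nul_Comp in auto)
  then obtain w where w: "w \<in> Hom C (Sh C W) (Sh C X)"
    "ShM C t \<cdot> neg C (Sh C W) (Sh C W) (ShM C (Ide C W)) = neg C (Sh C X) (Sh C Y) (ShM C f) \<cdot> w" by blast
  obtain s where s: "s \<in> Hom C W X" "ShM C s = w" using ShM_surj[of W X w] w ty o by auto
  have St: "ShM C t \<in> Hom C (Sh C W) (Sh C Y)" using t ty o ShM_in by simp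
  have Sf: "ShM C f \<in> Hom C (Sh C X) (Sh C Y)" using ty ShM_in by simp
  have fs: "f \<cdot> s \<in> Hom C W Y" using s ty o Comp_in by blast
  have "neg C (Sh C W) (Sh C Y) (ShM C t) = neg C (Sh C W) (Sh C Y) (ShM C f \<cdot> w)"
    using w(2) Comp_neg[of "Sh C W" "Sh C W" "Sh C Y" "Ide C (Sh C W)" "ShM C t"]
      neg_Comp[of "Sh C W" "Sh C X" "Sh C Y" w "ShM C f"] St Sf w(1) ty o
    by (simp add: ShM_Ide Ide_in Comp_Ide_Hom)
  also have "ShM C f \<cdot> w = ShM C (f \<cdot> s)" using s ty o ShM_Comp[of W X Y s f] by simp
  finally have "ShM C t = ShM C (f \<cdot> s)"
    using neg_neg[of "Sh C W" "Sh C Y"] St ShM_in[OF o _ fs] ty o by (metis Sh_Obj)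
  then have "t = f \<cdot> s" using ShM_inj[of W Y t "f \<cdot> s"] t fs ty o by simp
  with s that show thesis by blast
qed

lemma exact_right:
  assumes T: "Tri C X Y Z f g h" and o: "W \<in> Obj C" and t: "t \<in> Hom C Y W" "t \<cdot> f = Nul C X W"
  obtains s where "s \<in> Hom C Z W" "s \<cdot> g = t"
proof -
  note ty = Tri_D[OF T]
  obtain O' where O': "is_zero C O'" using ex_zero by blast
  have oO: "O' \<in> Obj C" using O' is_zero_Obj by simp
  have z: "orth C W (Sh C O')" "orth C (Sh C O') (Sh C W)" using is_zero_Sh[OF O'] orth_zero o by auto
  have "Tri C O' W W (Nul C O' W) (Ide C W) (Nul C W (Sh C O'))"
    using TR2[of O' W W "Nul C O' W" "Ide C W" "Nul C W (Sh C O')"] TR1_Ide[OF o is_zero_Sh[OF O']]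
      oO o Ide_in ShM_Nul[OF oO o] neg_Nul[of "Sh C O'" "Sh C W"] by (simp add: neg_def)
  from TR3[OF T this, of "Nul C X O'" t] obtain s where
    "s \<in> Hom C Z W" "s \<cdot> g = Ide C W \<cdot> t"
    using t ty o oO Comp_Nul[of X O' W "Nul C O' W"] by auto
  then show thesis using that[of s] Ide_Comp[of Y W t] t ty o by simp
qed

lemma exact_left3:
  assumes T: "Tri C X Y Z f g h" and o: "W \<in> Obj C" and t: "t \<in> Hom C W Z" "h \<cdot> t = Nul C W (Sh C X)"
  obtains s where "s \<in> Hom C W Y" "g \<cdot> s = t"
  using exact_left[OF rot[OF T] o t] that by blast

lemma exact_right1:
  assumes T: "Tri C X Y Z f g h" and o: "W \<in> Obj C" and t: "t \<in> Hom C Z W" "t \<cdot> g = Nul C Y W"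
  obtains s where "s \<in> Hom C (Sh C X) W" "s \<cdot> h = t"
  using exact_right[OF rot[OF T] o t] that by blast

subsection \<open>Triangles as relations between objects\<close>

lemma triI: "Tri C X Y Z f g h \<Longrightarrow> tri C X Y Z" by (auto simp: tri_def)

lemma tri_Obj: assumes "tri C X Y Z" shows "X \<in> Obj C" "Y \<in> Obj C" "Z \<in> Obj C"
  using assms Tri_type by (auto simp: tri_def)

lemma tri_rot: "tri C X Y Z \<Longrightarrow> tri C Y Z (Sh C X)"
  unfolding tri_def using rot by blast

lemma tri_unrot: "tri C X Y (Sh C W) \<Longrightarrow> W \<in> Obj C \<Longrightarrow> tri C W X Y"
  unfolding tri_def using unrot by metis

lemma tri_unshift: "tri C X Y Z \<Longrightarrow> tri C (unshift C Z) X Y"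
  using tri_Obj tri_unrot[of X Y "unshift C Z"] by simp

lemma tri_Sh: "tri C X Y Z \<Longrightarrow> tri C (Sh C X) (Sh C Y) (Sh C Z)"
  using tri_rot by blast

lemma tri_Sh_iff: "\<lbrakk>X \<in> Obj C; Y \<in> Obj C; Z \<in> Obj C\<rbrakk> \<Longrightarrow> tri C (Sh C X) (Sh C Y) (Sh C Z) \<longleftrightarrow> tri C X Y Z"
  using tri_Sh tri_unrot by blast

lemma tri_octahedral:
  assumes "tri C X Y Z'" "tri C Y Z X'"
  obtains Y' where "tri C X Z Y'" "tri C Z' Y' X'"
proof -
  obtain f i i' where 1: "Tri C X Y Z' f i i'" using assms by (auto simp: tri_def)
  obtain g j j' where 2: "Tri C Y Z X' g j j'" using assms by (auto simp: tri_def)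
  note t1 = Tri_D[OF 1] and t2 = Tri_D[OF 2]
  obtain Y' k k' where 3: "Tri C X Z Y' (g \<cdot> f) k k'"
    using TR1_cone[of X Z "g \<cdot> f"] t1 t2 Comp_in[of X Y Z f g] by blast
  from TR4[OF 1 2 3] that show thesis using 3 unfolding tri_def by blast
qed

text \<open>
  The octahedron in the opposite direction: an extension of the cone of \<open>X \<rightarrow> Z\<close> is pulled back to a
  factorisation of \<open>X \<rightarrow> Z\<close>. Rotating both triangles reduces it to the octahedral axiom.
\<close>

lemma tri_octahedral':
  assumes "tri C X Z Y'" "tri C Z' Y' X'"
  obtains Y where "tri C X Y Z'" "tri C Y Z X'"
proof -
  note o = tri_Obj[OF assms(1)] tri_Obj[OF assms(2)]
  obtain W where W: "tri C Z X' W" "tri C (Sh C X) W (Sh C Z')"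
    using tri_octahedral[OF tri_rot[OF assms(1)] tri_rot[OF assms(2)]] by blast
  have "W \<in> Obj C" using W tri_Obj by blast
  then have "tri C (unshift C W) Z X'" "tri C X (unshift C W) Z'"
    using tri_unrot[of Z X' "unshift C W"] W tri_Sh_iff[of X "unshift C W" Z'] o by auto
  then show thesis using that by blast
qed

lemma tri_orth_left:
  assumes "tri C X Y Z" "W \<in> Obj C" "orth C W X" "orth C W Z" shows "orth C W Y"
proof -
  obtain f g h where T: "Tri C X Y Z f g h" using assms by (auto simp: tri_def)
  note ty = Tri_D[OF T]
  show ?thesis
  proof (rule orthI)
    fix t assume t: "t \<in> Hom C W Y"
    then have "g \<cdot> t = Nul C W Z" using orthD[OF assms(4)] Comp_in ty assms(2) by blast
    then obtain s where s: "s \<in> Hom C W X" "f \<cdot> s = t" using exact_left[OF T assms(2) t] by blast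
    then show "t = Nul C W Y" using orthD[OF assms(3)] Comp_Nul ty assms(2) by metis
  qed (use ty assms in auto)
qed

lemma tri_orth_right:
  assumes "tri C X Y Z" "W \<in> Obj C" "orth C X W" "orth C Z W" shows "orth C Y W"
proof -
  obtain f g h where T: "Tri C X Y Z f g h" using assms by (auto simp: tri_def)
  note ty = Tri_D[OF T]
  show ?thesis
  proof (rule orthI)
    fix t assume t: "t \<in> Hom C Y W"
    then have "t \<cdot> f = Nul C X W" using orthD[OF assms(3)] Comp_in ty assms(2) by blast
    then obtain s where s: "s \<in> Hom C Z W" "s \<cdot> g = t" using exact_right[OF T assms(2) t] by blast
    then show "t = Nul C Y W" using orthD[OF assms(4)] Nul_Comp ty assms(2) by metis
  qed (use ty assms in auto)
qed

lemma tri_orth_right3: "\<lbrakk>tri C X Y Z; W \<in> Obj C; orth C Y W; orth C (Sh C X) W\<rbrakk> \<Longrightarrow> orth C Z W"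
  using tri_orth_right[OF tri_rot] by blast

lemma orth_unshift: "\<lbrakk>X \<in> Obj C; Y \<in> Obj C\<rbrakk> \<Longrightarrow> orth C X (unshift C Y) \<longleftrightarrow> orth C (Sh C X) Y"
  using orth_Sh[of X "unshift C Y"] by simp

lemma tri_orth_left1: "\<lbrakk>tri C X Y Z; W \<in> Obj C; orth C W Y; orth C (Sh C W) Z\<rbrakk> \<Longrightarrow> orth C W X"
  using tri_orth_left[OF tri_unshift, of X Y Z W] orth_unshift tri_Obj by blast

text \<open>
  If \<open>X \<rightarrow> Y\<close> vanishes, then \<open>X\<close> is a direct summand of \<open>Z[-1]\<close>. Applied to a truncation triangle, where
  \<open>Hom (X[1], Z) = 0\<close>, this and its dual show that a part of an object is zero.
\<close>

lemma tri_zero1: "\<lbrakk>tri C X Y Z; orth C X Y; orth C (Sh C X) Z\<rbrakk> \<Longrightarrow> is_zero C X"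
  unfolding is_zero_iff using tri_orth_left1 tri_Obj by blast

lemma tri_zero3: "\<lbrakk>tri C X Y Z; orth C Y Z; orth C (Sh C X) Z\<rbrakk> \<Longrightarrow> is_zero C Z"
  unfolding is_zero_iff using tri_orth_right3 tri_Obj by blast

lemma tri_zero2: "\<lbrakk>tri C X Y Z; is_zero C X; is_zero C Z\<rbrakk> \<Longrightarrow> is_zero C Y"
  using tri_orth_left[of X Y Z Y] orth_zero tri_Obj unfolding is_zero_iff by blast

lemma tri_iso_middle:
  assumes "tri C X Y Z" "isomorphic C Y Y'" shows "tri C X Y' Z"
proof -
  obtain f g h where T: "Tri C X Y Z f g h" using assms by (auto simp: tri_def)
  note ty = Tri_D[OF T]
  obtain u v where o: "Y' \<in> Obj C" and u: "u \<in> Hom C Y Y'" "v \<in> Hom C Y' Y" "v \<cdot> u = Ide C Y" "u \<cdot> v = Ide C Y'"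
    using assms(2) unfolding isomorphic_def is_iso_def by auto
  have "Tri C X Y' Z (u \<cdot> f) (g \<cdot> v) h"
  proof (rule TR1_iso[OF T])
    show "is_iso C X X (Ide C X)" "is_iso C Z Z (Ide C Z)" using is_iso_Ide ty by auto
    show "is_iso C Y Y' u" using u unfolding is_iso_def by blast
    show "u \<cdot> f \<in> Hom C X Y'" "g \<cdot> v \<in> Hom C Y' Z" using u ty o Comp_in by blast+
    show "u \<cdot> f = u \<cdot> f \<cdot> Ide C X" using Comp_Ide[of X Y' "u \<cdot> f"] \<open>u \<cdot> f \<in> _\<close> ty o by simp
    show "Ide C Z \<cdot> g = g \<cdot> v \<cdot> u" using Comp_assoc[of Y Y' Y Z u v g] u ty o by (simp add: Ide_Comp_Hom Comp_Ide_Hom)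
    show "ShM C (Ide C X) \<cdot> h = h \<cdot> Ide C Z" using ty by (simp add: ShM_Ide Ide_Comp_Hom Comp_Ide_Hom)
  qed (use ty o in auto)
  then show ?thesis by (auto simp: tri_def)
qed

lemma tri_iso:
  assumes "tri C X Y Z" "isomorphic C X X'" "isomorphic C Y Y'" "isomorphic C Z Z'"
  shows "tri C X' Y' Z'"
proof -
  have X: "X \<in> Obj C" "X' \<in> Obj C" using isomorphic_Obj assms by auto
  have "tri C X Y' Z" using tri_iso_middle assms by blast
  then have "tri C X Y' Z'" using tri_rot tri_iso_middle tri_unrot assms(4) X by blast
  moreover have "Z' \<in> Obj C" using isomorphic_Obj assms by auto
  ultimately show ?thesis
    using tri_iso_middle[OF tri_unshift assms(2), of Y' Z'] tri_rot[of "unshift C Z'" X' Y'] by simp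
qed

lemma tri_zero_right: "X \<in> Obj C \<Longrightarrow> is_zero C Z \<Longrightarrow> tri C X X Z"
  unfolding tri_def using TR1_Ide by blast

lemma tri_zero_left: "X \<in> Obj C \<Longrightarrow> is_zero C Z \<Longrightarrow> tri C Z X X"
  using tri_unrot[of X X Z] tri_zero_right[OF _ is_zero_Sh] is_zero_Obj by blast

lemma tri_iso_right: "isomorphic C X Y \<Longrightarrow> is_zero C Z \<Longrightarrow> tri C X Y Z"
  using tri_iso_middle[OF tri_zero_right] isomorphic_Obj by blast

lemma Tri_zero_is_iso:
  assumes T: "Tri C X Y Z f g h" and "is_zero C Z" shows "is_iso C X Y f"
proof -
  note ty = Tri_D[OF T]
  have "g \<cdot> Ide C Y = Nul C Y Z" using ty assms(2) Ide_in Comp_in unfolding is_zero_def by blast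
  then obtain s where s: "s \<in> Hom C Y X" "f \<cdot> s = Ide C Y"
    using exact_left[OF T _ Ide_in] ty by blast
  obtain k where k: "Tri C (unshift C Z) X Y k f g" "k \<in> Hom C (unshift C Z) X"
    using unrot[of X Y "unshift C Z" f g h] T ty by auto
  have zu: "is_zero C (unshift C Z)"
    using assms(2) orth_Sh[of "unshift C Z" "unshift C Z"] unfolding is_zero_iff by simp
  have sf: "s \<cdot> f \<in> Hom C X X" using s ty Comp_in by blast
  have "s \<cdot> f = Ide C X"
  proof (rule endo_eq_Ide_left[OF ty(1,2) sf ty(4)])
    show "f \<cdot> (s \<cdot> f) = f" using Comp_assoc[of X Y X Y f s f] ty s Ide_Comp_Hom by simp
    fix d assume d: "d \<in> Hom C X X" "f \<cdot> d = Nul C X Y"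
    then obtain e where "e \<in> Hom C X (unshift C Z)" "k \<cdot> e = d" using exact_left[OF k(1)] ty by blast
    then show "d = Nul C X X" using zu ty Comp_Nul[of X "unshift C Z" X k] k(2) unfolding is_zero_def by auto
  qed
  then show ?thesis unfolding is_iso_def using s ty by blast
qed

lemma tri_zero_imp_iso: "tri C X Y Z \<Longrightarrow> is_zero C Z \<Longrightarrow> isomorphic C X Y"
  unfolding isomorphic_def using Tri_zero_is_iso tri_Obj by (fastforce simp: tri_def)

lemma tri_zero_imp_iso': "tri C X Y Z \<Longrightarrow> is_zero C X \<Longrightarrow> isomorphic C Y Z"
  using tri_zero_imp_iso[OF tri_rot is_zero_Sh] by blast

text \<open>
  Each of the maps \<open>X \<rightarrow> E\<close> and \<open>X' \<rightarrow> E\<close> factors through the other since \<open>X\<close> and \<open>X'\<close> are orthogonal to the third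
  terms; the factorisations are mutually inverse since they are unique, the shifts being orthogonal too.
\<close>

lemma tri_unique_left:
  assumes "tri C X E Y" "tri C X' E Y'" "orth C X Y'" "orth C X' Y" "orth C (Sh C X) Y" "orth C (Sh C X') Y'"
  shows "isomorphic C X X'"
proof -
  obtain f g h where T: "Tri C X E Y f g h" using assms by (auto simp: tri_def)
  obtain f' g' h' where T': "Tri C X' E Y' f' g' h'" using assms by (auto simp: tri_def)
  note ty = Tri_D[OF T] and ty' = Tri_D[OF T']
  have inv: "s' \<cdot> s = Ide C X" if T: "Tri C X E Y f g h" and T': "Tri C X' E Y' f' g' h'"
     and orth: "orth C (Sh C X) Y" and s: "s \<in> Hom C X X'" "s' \<in> Hom C X' X" "f' \<cdot> s = f" "f \<cdot> s' = f'"
   for X X' Y Y' f g h f' g' h' s s'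
  proof -
    note ty = Tri_D[OF T] and ty' = Tri_D[OF T']
    obtain k where k: "Tri C (unshift C Y) X E k f g" "k \<in> Hom C (unshift C Y) X"
      using unrot[of X E "unshift C Y" f g h] T ty by auto
    have ss: "s' \<cdot> s \<in> Hom C X X" using s ty ty' Comp_in by blast
    show "s' \<cdot> s = Ide C X"
    proof (rule endo_eq_Ide_left[OF ty(1,2) ss ty(4)])
      show "f \<cdot> (s' \<cdot> s) = f" using Comp_assoc[of X X' X E s s' f] ty ty' s by simp
      fix d assume d: "d \<in> Hom C X X" "f \<cdot> d = Nul C X E"
      then obtain e where e: "e \<in> Hom C X (unshift C Y)" "k \<cdot> e = d" using exact_left[OF k(1)] ty by blast
      have "orth C X (unshift C Y)" using orth ty orth_unshift by simp
      then have "e = Nul C X (unshift C Y)" using e(1) orthD by blast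
      then show "d = Nul C X X" using e ty Comp_Nul[of X "unshift C Y" X k] k(2) by simp
    qed
  qed
  have "g' \<cdot> f = Nul C X Y'" using assms(3) orthD Comp_in ty ty' by blast
  then obtain s where s: "s \<in> Hom C X X'" "f' \<cdot> s = f" using exact_left[OF T', of X f] ty by blast
  have "g \<cdot> f' = Nul C X' Y" using assms(4) orthD Comp_in ty ty' by blast
  then obtain s' where s': "s' \<in> Hom C X' X" "f \<cdot> s' = f'" using exact_left[OF T, of X' f'] ty' by blast
  show ?thesis unfolding isomorphic_def is_iso_def
    using inv[OF T T' assms(5) s(1) s'(1) s(2) s'(2)] inv[OF T' T assms(6) s'(1) s(1) s'(2) s(2)] ty ty' s s' by blast
qed

lemma tri_unique_right:
  assumes "tri C X E Y" "tri C X' E Y'" "orth C X Y'" "orth C X' Y" "orth C (Sh C X) Y" "orth C (Sh C X') Y'"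
  shows "isomorphic C Y Y'"
proof -
  obtain f g h where T: "Tri C X E Y f g h" using assms by (auto simp: tri_def)
  obtain f' g' h' where T': "Tri C X' E Y' f' g' h'" using assms by (auto simp: tri_def)
  note ty = Tri_D[OF T] and ty' = Tri_D[OF T']
  have inv: "s' \<cdot> s = Ide C Y" if T: "Tri C X E Y f g h" and T': "Tri C X' E Y' f' g' h'"
     and orth: "orth C (Sh C X) Y" and s: "s \<in> Hom C Y Y'" "s' \<in> Hom C Y' Y" "s \<cdot> g = g'" "s' \<cdot> g' = g"
   for X X' Y Y' f g h f' g' h' s s'
  proof -
    note ty = Tri_D[OF T] and ty' = Tri_D[OF T']
    have ss: "s' \<cdot> s \<in> Hom C Y Y" using s ty ty' Comp_in by blast
    show "s' \<cdot> s = Ide C Y"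
    proof (rule endo_eq_Ide_right[OF ty(3,2) ss ty(5)])
      show "s' \<cdot> s \<cdot> g = g" using Comp_assoc[of E Y Y' Y g s s'] ty ty' s by simp
      fix d assume d: "d \<in> Hom C Y Y" "d \<cdot> g = Nul C E Y"
      then obtain e where e: "e \<in> Hom C (Sh C X) Y" "e \<cdot> h = d" using exact_right1[OF T] ty by blast
      then have "e = Nul C (Sh C X) Y" using orth orthD by blast
      then show "d = Nul C Y Y" using e ty Nul_Comp[of Y "Sh C X" Y h] by simp
    qed
  qed
  have "g' \<cdot> f = Nul C X Y'" using assms(3) orthD Comp_in ty ty' by blast
  then obtain s where s: "s \<in> Hom C Y Y'" "s \<cdot> g = g'" using exact_right[OF T, of Y' g'] ty' ty by blast
  have "g \<cdot> f' = Nul C X' Y" using assms(4) orthD Comp_in ty ty' by blast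
  then obtain s' where s': "s' \<in> Hom C Y' Y" "s' \<cdot> g' = g" using exact_right[OF T', of Y g] ty' ty by blast
  show ?thesis unfolding isomorphic_def is_iso_def
    using inv[OF T T' assms(5) s(1) s'(1) s(2) s'(2)] inv[OF T' T assms(6) s'(1) s(1) s'(2) s(2)] ty ty' s s' by blast
qed

subsection \<open>Split triangles\<close>

text \<open>
  The cone of the inclusion of \<open>A\<close> is identified with \<open>B\<close>: the projection to \<open>B\<close> factors through the cone, and the
  factorisation is inverse to the composition of the inclusion of \<open>B\<close> with the map to the cone.
\<close>

lemma biproduct_tri:
  assumes "is_biproduct C A B S" shows "tri C A S B"
proof -
  obtain i j p q where b: "i \<in> Hom C A S" "j \<in> Hom C B S" "p \<in> Hom C S A" "q \<in> Hom C S B"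
    "p \<cdot> i = Ide C A" "q \<cdot> j = Ide C B" "q \<cdot> i = Nul C A B" "p \<cdot> j = Nul C B A"
    "Add C (i \<cdot> p) (j \<cdot> q) = Ide C S" and o: "A \<in> Obj C" "B \<in> Obj C" "S \<in> Obj C"
    using assms(1) unfolding is_biproduct_def by auto
  obtain W k w where T: "Tri C A S W i k w" using TR1_cone[OF o(1,3) b(1)] by blast
  note ty = Tri_D[OF T]
  have ki: "k \<cdot> i = Nul C A W" using Tri_comp_zero[OF T] .
  have wi: "ShM C i \<cdot> w = Nul C W (Sh C S)"
  proof -
    have "neg C (Sh C A) (Sh C S) (ShM C i) \<cdot> w = Nul C W (Sh C S)"
      using Tri_comp_zero[OF rot[OF rot[OF T]]] .
    moreover have "ShM C i \<in> Hom C (Sh C A) (Sh C S)" using ShM_in b o by blast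
    ultimately have n: "neg C W (Sh C S) (ShM C i \<cdot> w) = Nul C W (Sh C S)"
      using neg_Comp[of W "Sh C A" "Sh C S" w "ShM C i"] ty o by simp
    have "ShM C i \<cdot> w \<in> Hom C W (Sh C S)" using Comp_in \<open>ShM C i \<in> _\<close> ty o Sh_Obj by blast
    then show ?thesis using n neg_neg[of W "Sh C S" "ShM C i \<cdot> w"] neg_Nul[of W "Sh C S"] ty o by simp
  qed
  have w0: "w = Nul C W (Sh C A)"
  proof -
    have "ShM C p \<cdot> (ShM C i \<cdot> w) = ShM C p \<cdot> ShM C i \<cdot> w"
      using Comp_assoc[of W "Sh C A" "Sh C S" "Sh C A" w "ShM C i" "ShM C p"] ty o b ShM_in by simp
    also have "ShM C p \<cdot> ShM C i = Ide C (Sh C A)"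
      using ShM_Comp[of A S A i p] b o ShM_Ide by simp
    finally show ?thesis using wi Comp_Nul[of W "Sh C S" "Sh C A" "ShM C p"] ShM_in b o ty Ide_Comp[of W "Sh C A" w] by simp
  qed
  obtain q' where q': "q' \<in> Hom C W B" "q' \<cdot> k = q" using exact_right[OF T o(2) b(4,7)] by blast
  have kj: "k \<cdot> j \<in> Hom C B W" using Comp_in b o ty by blast
  have 1: "q' \<cdot> (k \<cdot> j) = Ide C B"
    using Comp_assoc[of B S W B j k q'] q' b o ty by simp
  have kjq: "k \<cdot> j \<cdot> q' \<in> Hom C W W" using Comp_in kj q' ty o by blast
  have "k \<cdot> j \<cdot> q' \<cdot> k = k \<cdot> (j \<cdot> q)"
    using Comp_assoc[of S W B W k q' "k \<cdot> j"] Comp_assoc[of S B S W q j k] q' kj b o ty by simp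
  also have "\<dots> = k"
  proof -
    have ip: "i \<cdot> p \<in> Hom C S S" and jq: "j \<cdot> q \<in> Hom C S S" using b o Comp_in by blast+
    have "k \<cdot> (i \<cdot> p) = Nul C S W"
      using Comp_assoc[of S A S W p i k] ki Nul_Comp[of S A W p] b o ty by simp
    moreover have "Add C (k \<cdot> (i \<cdot> p)) (k \<cdot> (j \<cdot> q)) = k"
      using Comp_Add[of S S W "i \<cdot> p" "j \<cdot> q" k] ip jq b o ty by (simp add: Comp_Ide_Hom)
    ultimately show ?thesis using Nul_Add[of S W "k \<cdot> (j \<cdot> q)"] Comp_in[of S S W "j \<cdot> q" k] jq ty by simp
  qed
  finally have e: "k \<cdot> j \<cdot> q' \<cdot> k = k" .
  have 2: "k \<cdot> j \<cdot> q' = Ide C W"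
  proof (rule endo_eq_Ide_right[OF ty(3,2) kjq ty(5) e])
    fix d assume "d \<in> Hom C W W" "d \<cdot> k = Nul C S W"
    then obtain e' where e': "e' \<in> Hom C (Sh C A) W" "e' \<cdot> w = d" using exact_right1[OF T] ty by blast
    then show "d = Nul C W W" using w0 Comp_Nul[of W "Sh C A" W e'] ty o by simp
  qed
  have "isomorphic C W B"
    unfolding isomorphic_def is_iso_def using 1 2 kj q' ty o by blast
  then show ?thesis using tri_iso[OF triI[OF T]] isomorphic_refl o by blast
qed

text \<open>
  The boundary map vanishes, so \<open>g\<close> has a section \<open>s\<close>, and \<open>1 - s \<cdot> g\<close> factors through \<open>f\<close> as a retraction.
\<close>

lemma split_biproduct:
  assumes "tri C X E Y" "orth C Y (Sh C X)" shows "is_biproduct C X Y E"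
proof -
  obtain f g h where T: "Tri C X E Y f g h" using assms by (auto simp: tri_def)
  note ty = Tri_D[OF T]
  have h0: "h = Nul C Y (Sh C X)" using ty orthD[OF assms(2)] by blast
  obtain s where s: "s \<in> Hom C Y E" "g \<cdot> s = Ide C Y"
    using exact_left3[OF T _ Ide_in] h0 Nul_Comp[of Y Y "Sh C X" "Ide C Y"] ty Ide_in by auto
  obtain k where k: "Tri C (unshift C Y) X E k f g" "k \<in> Hom C (unshift C Y) X"
      using unrot[of X E "unshift C Y" f g h] T ty by auto
  have "orth C (unshift C Y) X" using assms(2) orth_Sh[of "unshift C Y" X] ty by simp
  then have k0: "k = Nul C (unshift C Y) X" using k orthD by blast
  have mono: "u = Nul C V X" if V: "V \<in> Obj C" "u \<in> Hom C V X" "f \<cdot> u = Nul C V E" for u V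
  proof -
    obtain v where v: "v \<in> Hom C V (unshift C Y)" "k \<cdot> v = u" using exact_left[OF k(1) V] by blast
    then show ?thesis using Nul_Comp[of V "unshift C Y" X v] k0 ty V by simp
  qed
  have sg: "s \<cdot> g \<in> Hom C E E" using s ty Comp_in by blast
  obtain d where d: "d \<in> Hom C E E" "Add C d (s \<cdot> g) = Ide C E"
    using ex_diff[of E E "Ide C E" "s \<cdot> g"] ty sg Ide_in by metis
  have "Add C (g \<cdot> d) (g \<cdot> (s \<cdot> g)) = g"
    using Comp_Add[of E E Y d "s \<cdot> g" g] d sg ty by (simp add: Comp_Ide_Hom)
  moreover have "g \<cdot> (s \<cdot> g) = g" using Comp_assoc[of E Y E Y g s g] s ty by (simp add: Ide_Comp_Hom)
  ultimately have "g \<cdot> d = Nul C E Y"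
    using Add_left_cancel_Nul[of E Y "g \<cdot> d" g] ty Comp_in[of E E Y d g] d by simp
  then obtain r where r: "r \<in> Hom C E X" "f \<cdot> r = d" using exact_left[OF T _ d(1)] ty by blast
  have gf: "g \<cdot> f = Nul C X Y" using Tri_comp_zero[OF T] .
  have rf: "r \<cdot> f \<in> Hom C X X" using r ty Comp_in by blast
  have rs: "r \<cdot> s \<in> Hom C Y X" using r s ty Comp_in by blast
  have frf: "f \<cdot> (r \<cdot> f) = f"
  proof -
    have "Add C (d \<cdot> f) (s \<cdot> g \<cdot> f) = f" using Add_Comp[of X E E f d "s \<cdot> g"] d sg ty by (simp add: Ide_Comp_Hom)
    moreover have "s \<cdot> g \<cdot> f = Nul C X E" using Comp_assoc[of X E Y E f g s] gf Comp_Nul[of X Y E s] s ty by simp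
    moreover have "d \<cdot> f \<in> Hom C X E" using d ty Comp_in by blast
    ultimately have "d \<cdot> f = f" using Add_Nul[of X E "d \<cdot> f"] ty by simp
    then show ?thesis using Comp_assoc[of X E X E f r f] r ty by simp
  qed
  have frs: "f \<cdot> (r \<cdot> s) = Nul C Y E"
  proof -
    have "Add C (d \<cdot> s) (s \<cdot> g \<cdot> s) = s" using Add_Comp[of Y E E s d "s \<cdot> g"] d sg s ty by (simp add: Ide_Comp_Hom)
    moreover have "s \<cdot> g \<cdot> s = s" using Comp_assoc[of Y E Y E s g s] s ty by (simp add: Comp_Ide_Hom)
    moreover have "d \<cdot> s \<in> Hom C Y E" using d s ty Comp_in by blast
    ultimately have "d \<cdot> s = Nul C Y E" using Add_left_cancel_Nul[of Y E "d \<cdot> s" s] s ty by simp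
    then show ?thesis using Comp_assoc[of Y E X E s r f] r s ty by simp
  qed
  have rs0: "r \<cdot> s = Nul C Y X" using mono[OF _ rs frs] ty by blast
  have rf1: "r \<cdot> f = Ide C X" by (rule endo_eq_Ide_left[OF ty(1,2) rf ty(4) frf mono[OF ty(1)]])
  show ?thesis
    unfolding is_biproduct_def using ty r s d gf rs0 rf1 by blast
qed

lemma tri_swap: "tri C X E Y \<Longrightarrow> orth C Y (Sh C X) \<Longrightarrow> tri C Y E X"
  using split_biproduct is_biproduct_sym biproduct_tri by blast

text \<open>
  The octahedral axiom in the form needed for images: the cone \<open>N\<close> of \<open>f : E \<rightarrow> E'\<close> being an
  extension of \<open>Q\<close> by \<open>N'\<close>, the object \<open>I\<close> is the image if \<open>N'\<close> is the shifted kernel and \<open>Q\<close> the cokernel.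
\<close>

lemma tri_image:
  assumes T: "Tri C E E' N f g h" and T2: "Tri C N' N Q u v w"
  obtains I m s k where "Tri C I E' Q m (v \<cdot> g) k" "s \<in> Hom C E I" "m \<cdot> s = f" "tri C E I N'"
proof -
  note ty = Tri_D[OF T] and ty2 = Tri_D[OF T2]
  note R1 = rot[OF T] and R2 = rot[OF T2]
  have vg: "v \<cdot> g \<in> Hom C E' Q" using Comp_in ty ty2 by blast
  obtain J k k' where T3: "Tri C E' Q J (v \<cdot> g) k k'" using TR1_cone[of E' Q "v \<cdot> g"] vg ty ty2 by blast
  have oJ: "J \<in> Obj C" using Tri_D[OF T3] by simp
  have "tri C (Sh C E) J (Sh C N')" using TR4[OF R1 R2 T3] unfolding tri_def by blast
  then have t1: "tri C E (unshift C J) N'" using tri_Sh_iff[of E "unshift C J" N'] ty ty2 oJ by simp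
  obtain m where m: "Tri C (unshift C J) E' Q m (v \<cdot> g) k"
    using unrot[of E' Q "unshift C J" "v \<cdot> g" k k'] T3 oJ by auto
  have "v \<cdot> g \<cdot> f = Nul C E Q"
    using Comp_assoc[of E E' N Q f g v] Tri_comp_zero[OF T] Comp_Nul[of E N Q v] ty ty2 by simp
  then obtain s where s: "s \<in> Hom C E (unshift C J)" "m \<cdot> s = f" using exact_left[OF m, of E f] ty by blast
  show thesis by (rule that[OF m s t1])
qed

end

section \<open>Full triangulated subcategories\<close>

lemma full_sub_sel [simp]:
  "Obj (full_sub C S) = S" "Hom (full_sub C S) = Hom C" "Ide (full_sub C S) = Ide C"
  "Comp (full_sub C S) = Comp C" "Add (full_sub C S) = Add C" "Nul (full_sub C S) = Nul C"
  "Sh (full_sub C S) = Sh C" "ShM (full_sub C S) = ShM C"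
  "Tri (full_sub C S) X Y Z f g h \<longleftrightarrow> X \<in> S \<and> Y \<in> S \<and> Z \<in> S \<and> Tri C X Y Z f g h"
  by (simp_all add: full_sub_def)

lemma full_sub_rel [simp]:
  "HomG (full_sub C S) = HomG C" "is_iso (full_sub C S) = is_iso C" "orth (full_sub C S) = orth C"
  "tri (full_sub C S) X Y Z \<longleftrightarrow> X \<in> S \<and> Y \<in> S \<and> Z \<in> S \<and> tri C X Y Z"
  by (auto simp: HomG_def is_iso_def orth_def tri_def fun_eq_iff)

locale triangulated_sub = triangulated_category +
  fixes S :: "'a set"
  assumes sub: "triangulated_subcategory C S"
begin

lemma S_Obj: "X \<in> S \<Longrightarrow> X \<in> Obj C"
  using sub by (auto simp: triangulated_subcategory_def)

lemma S_Sh: "X \<in> S \<Longrightarrow> Sh C X \<in> S"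
  using sub by (auto simp: triangulated_subcategory_def)

lemma S_unshift: "X \<in> S \<Longrightarrow> unshift C X \<in> S"
proof -
  assume "X \<in> S"
  then obtain Y where "Y \<in> S" "X = Sh C Y" using sub unfolding triangulated_subcategory_def by blast
  then show ?thesis using S_Obj by simp
qed

lemma S_cone: "\<lbrakk>tri C X Y Z; X \<in> S; Y \<in> S\<rbrakk> \<Longrightarrow> \<exists>Z'\<in>S. isomorphic C Z Z'"
  using sub unfolding triangulated_subcategory_def tri_def by blast

lemma S_ext:
  assumes "tri C X Y Z" "X \<in> S" "Z \<in> S" shows "\<exists>Y'\<in>S. isomorphic C Y Y'"
  using S_cone[OF tri_unshift[OF assms(1)] S_unshift[OF assms(3)] assms(2)] .

lemma S_zero: "\<exists>O'\<in>S. is_zero C O'"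
proof -
  obtain X where X: "X \<in> S" using sub unfolding triangulated_subcategory_def by blast
  obtain O' where O': "is_zero C O'" using ex_zero by blast
  obtain Z where "Z \<in> S" "isomorphic C O' Z" using S_cone[OF tri_zero_right[OF S_Obj[OF X] O'] X X] by blast
  then show ?thesis using is_zero_iso O' by blast
qed

lemma is_zero_full_sub: "is_zero (full_sub C S) E \<longleftrightarrow> E \<in> S \<and> is_zero C E"
proof
  assume "is_zero (full_sub C S) E"
  then have "E \<in> S" "Hom C E E = {Nul C E E}" unfolding is_zero_def by auto
  then show "E \<in> S \<and> is_zero C E" using is_zero_iff S_Obj orth_def by metis
next
  assume "E \<in> S \<and> is_zero C E" then show "is_zero (full_sub C S) E"
    using S_Obj unfolding is_zero_def by simp
qed

lemma isomorphic_full_sub: "isomorphic (full_sub C S) A B \<longleftrightarrow> A \<in> S \<and> B \<in> S \<and> isomorphic C A B"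
  using S_Obj unfolding isomorphic_def by auto

lemma biproduct_full_sub: "A \<in> S \<Longrightarrow> B \<in> S \<Longrightarrow> \<exists>T. is_biproduct (full_sub C S) A B T"
proof -
  assume AB: "A \<in> S" "B \<in> S"
  obtain T where T: "is_biproduct C A B T" using ex_biproduct AB S_Obj by blast
  obtain T' where T': "T' \<in> S" "isomorphic C T T'" using S_ext[OF biproduct_tri[OF T] AB] by blast
  then have "is_biproduct C A B T'" using is_biproduct_iso T by blast
  then have "is_biproduct (full_sub C S) A B T'" unfolding is_biproduct_def using AB T' by simp
  then show ?thesis by blast
qed

text \<open>
  Strictness under shift and closure of cones up to isomorphism are enough: a cone in \<open>C\<close> is replaced by an
  isomorphic object of \<open>S\<close>, and all other axioms restrict to a full subcategory.
\<close>

lemma triangulated_full_sub: "triangulated_category (full_sub C S)"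
proof (intro triangulated_category.intro additive_category.intro triangulated_category_axioms.intro,
    unfold full_sub_sel full_sub_rel is_zero_full_sub)
  note o = S_Obj
  show "\<And>X Y Z f g. \<lbrakk>X \<in> S; Y \<in> S; Z \<in> S; f \<in> Hom C X Y; g \<in> Hom C Y Z\<rbrakk> \<Longrightarrow> ShM C (g \<cdot> f) = ShM C g \<cdot> ShM C f"
    by (rule ShM_Comp[OF o o o])
  show "\<And>X Y Z f g h. \<lbrakk>X \<in> S; Y \<in> S; Z \<in> S; f \<in> Hom C X Y; g \<in> Hom C Y Z; h \<in> Hom C Z (Sh C X)\<rbrakk>
    \<Longrightarrow> (X \<in> S \<and> Y \<in> S \<and> Z \<in> S \<and> Tri C X Y Z f g h) =
      (Y \<in> S \<and> Z \<in> S \<and> Sh C X \<in> S \<and> Tri C Y Z (Sh C X) g h (inv\<^bsub>HomG C (Sh C X) (Sh C Y)\<^esub> (ShM C f)))"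
    using TR2[OF o o o] S_Sh by blast
  show "\<exists>O'. O' \<in> S \<and> is_zero C O'" using S_zero by blast
  show "\<And>A B. \<lbrakk>A \<in> S; B \<in> S\<rbrakk> \<Longrightarrow> \<exists>T. is_biproduct (full_sub C S) A B T" by (rule biproduct_full_sub)
  show "bij_betw (Sh C) S S"
    using Sh_bij sub unfolding triangulated_subcategory_def bij_betw_def by (meson inj_on_subset)
  show "\<exists>Z g h. X \<in> S \<and> Y \<in> S \<and> Z \<in> S \<and> Tri C X Y Z f g h"
    if "X \<in> S" "Y \<in> S" "f \<in> Hom C X Y" for X Y f
  proof -
    obtain Z g h where T: "Tri C X Y Z f g h" using TR1_cone o \<open>X \<in> S\<close> \<open>Y \<in> S\<close> \<open>f \<in> Hom C X Y\<close> by blast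
    obtain Z' where Z': "Z' \<in> S" "isomorphic C Z Z'" using S_cone triI[OF T] \<open>X \<in> S\<close> \<open>Y \<in> S\<close> by blast
    obtain u v where u: "u \<in> Hom C Z Z'" "v \<in> Hom C Z' Z" "v \<cdot> u = Ide C Z" "u \<cdot> v = Ide C Z'"
      using Z'(2) unfolding isomorphic_def is_iso_def by auto
    note ty = Tri_D[OF T]
    have "Tri C X Y Z' f (u \<cdot> g) (h \<cdot> v)"
    proof (rule TR1_iso[OF T])
      show "is_iso C X X (Ide C X)" "is_iso C Y Y (Ide C Y)" using is_iso_Ide ty by auto
      show "is_iso C Z Z' u" using u unfolding is_iso_def by blast
      show Z'o: "Z' \<in> Obj C" using o Z' by blast
      show "u \<cdot> g \<in> Hom C Y Z'" using Comp_in[of Y Z Z'] u ty Z'o by blast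
      show "h \<cdot> v \<in> Hom C Z' (Sh C X)" using Comp_in[of Z' Z "Sh C X"] u ty Z'o by simp
      show "Ide C Y \<cdot> f = f \<cdot> Ide C X" using ty by (simp add: Comp_Ide_Hom Ide_Comp_Hom)
      show "u \<cdot> g = u \<cdot> g \<cdot> Ide C Y" using \<open>u \<cdot> g \<in> _\<close> ty Z'o by (simp add: Comp_Ide_Hom)
      show "ShM C (Ide C X) \<cdot> h = h \<cdot> v \<cdot> u"
        using Comp_assoc[of Z Z' Z "Sh C X" u v h] u ty Z'o by (simp add: Comp_Ide_Hom Ide_Comp_Hom ShM_Ide)
    qed (use ty in auto)
    then show ?thesis using that Z' by blast
  qed
next
  fix X Y Z f g h X' Y' Z' f' g' h' u v w
  assume "X \<in> S \<and> Y \<in> S \<and> Z \<in> S \<and> Tri C X Y Z f g h" "X' \<in> S" "Y' \<in> S" "Z' \<in> S"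
    "f' \<in> Hom C X' Y'" "g' \<in> Hom C Y' Z'" "h' \<in> Hom C Z' (Sh C X')"
    "is_iso C X X' u" "is_iso C Y Y' v" "is_iso C Z Z' w"
    "v \<cdot> f = f' \<cdot> u" "w \<cdot> g = g' \<cdot> v" "ShM C u \<cdot> h = h' \<cdot> w"
  then show "X' \<in> S \<and> Y' \<in> S \<and> Z' \<in> S \<and> Tri C X' Y' Z' f' g' h'"
    using TR1_iso[of X Y Z f g h X' Y' Z' f' g' h' u v w] S_Obj by blast
next
  fix X Y Z f g h X' Y' Z' f' g' h' u v
  assume "X \<in> S \<and> Y \<in> S \<and> Z \<in> S \<and> Tri C X Y Z f g h" "X' \<in> S \<and> Y' \<in> S \<and> Z' \<in> S \<and> Tri C X' Y' Z' f' g' h'"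
    "u \<in> Hom C X X'" "v \<in> Hom C Y Y'" "v \<cdot> f = f' \<cdot> u"
  then show "\<exists>w\<in>Hom C Z Z'. w \<cdot> g = g' \<cdot> v \<and> ShM C u \<cdot> h = h' \<cdot> w"
    using TR3[of X Y Z f g h X' Y' Z' f' g' h' u v] by blast
next
  fix X Y Z' f i i' Z X' g j j' Y' k k'
  assume "X \<in> S \<and> Y \<in> S \<and> Z' \<in> S \<and> Tri C X Y Z' f i i'" "Y \<in> S \<and> Z \<in> S \<and> X' \<in> S \<and> Tri C Y Z X' g j j'"
    "X \<in> S \<and> Z \<in> S \<and> Y' \<in> S \<and> Tri C X Z Y' (g \<cdot> f) k k'"
  then show "\<exists>u\<in>Hom C Z' Y'. \<exists>v\<in>Hom C Y' X'.
      (Z' \<in> S \<and> Y' \<in> S \<and> X' \<in> S \<and> Tri C Z' Y' X' u v (ShM C i \<cdot> j')) \<and>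
      u \<cdot> i = k \<cdot> g \<and> k' \<cdot> u = i' \<and> v \<cdot> k = j \<and> j' \<cdot> v = ShM C f \<cdot> k'"
    using TR4[of X Y Z' f i i' Z X' g j j' Y' k k'] by blast
qed (use S_Sh Tri_type in \<open>auto intro: Ide_in[OF S_Obj] Comp_in[OF S_Obj S_Obj S_Obj] Comp_assoc[OF S_Obj S_Obj S_Obj S_Obj] Comp_Ide[OF S_Obj S_Obj]
    Ide_Comp[OF S_Obj S_Obj] HomG_group[OF S_Obj S_Obj] Comp_Add[OF S_Obj S_Obj S_Obj] Add_Comp[OF S_Obj S_Obj S_Obj]
    ShM_bij[OF S_Obj S_Obj] ShM_Ide[OF S_Obj] ShM_Add[OF S_Obj S_Obj] TR1_Ide[OF S_Obj]\<close>)

end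

section \<open>Slicings and Harder-Narasimhan filtrations\<close>

text \<open>
  \<open>hn C P J E\<close>: the object \<open>E\<close> has a Harder-Narasimhan filtration with all phases in \<open>J\<close>.
  The inductive form makes it easy to append the factor of smallest phase.
\<close>

inductive hn :: "('o, 'm) tricat \<Rightarrow> (real \<Rightarrow> 'o set) \<Rightarrow> real set \<Rightarrow> 'o \<Rightarrow> bool"
  for C :: "('o, 'm) tricat" and P :: "real \<Rightarrow> 'o set" where
  zero: "is_zero C E \<Longrightarrow> hn C P J E"
| step: "\<lbrakk>hn C P (J \<inter> {\<psi><..}) K; \<psi> \<in> J; B \<in> P \<psi>; \<not> is_zero C B; tri C K E B\<rbrakk> \<Longrightarrow> hn C P J E"

lemma hn_mono: "hn C P J E \<Longrightarrow> J \<subseteq> J' \<Longrightarrow> hn C P J' E"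
proof (induction arbitrary: J' rule: hn.induct)
  case (step J \<psi> K B E)
  have "hn C P (J' \<inter> {\<psi><..}) K" using step by (intro step.IH) auto
  then show ?case using step by (intro hn.step[of C P J' \<psi> K B]) auto
qed (rule hn.zero)

lemma HN_filtration_imp_hn:
  "HN_filtration C P E n F A \<phi> \<Longrightarrow> hn C P (\<phi> ` {..<n}) E"
proof (induction n arbitrary: E)
  case 0 then show ?case by (auto simp: HN_filtration_def intro: hn.zero)
next
  case (Suc n)
  then have H: "HN_filtration C P (F n) n F A \<phi>" and E: "F (Suc n) = E" and
    A: "A n \<in> P (\<phi> n)" "\<not> is_zero C (A n)" "tri C (F n) (F (Suc n)) (A n)" and
    less: "\<And>i. i < n \<Longrightarrow> \<phi> n < \<phi> i"
    unfolding HN_filtration_def tri_def by auto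
  have "\<phi> ` {..<Suc n} \<inter> {\<phi> n<..} = \<phi> ` {..<n}"
    using less by (auto simp: less_Suc_eq)
  then show ?case using hn.step[of C P "\<phi> ` {..<Suc n}" "\<phi> n" "F n" "A n" E] Suc.IH[OF H] A E by simp
qed

lemma hn_imp_HN_filtration:
  "hn C P J E \<Longrightarrow> \<exists>n F A \<phi>. HN_filtration C P E n F A \<phi> \<and> (\<forall>i<n. \<phi> i \<in> J)"
proof (induction rule: hn.induct)
  case (zero E J)
  then have "HN_filtration C P E 0 (\<lambda>_. E) (\<lambda>_. E) (\<lambda>_. 0)" by (simp add: HN_filtration_def)
  then show ?case by blast
next
  case (step J \<psi> K B E)
  then obtain n F A \<phi> where H: "HN_filtration C P K n F A \<phi>" "\<And>i. i < n \<Longrightarrow> \<phi> i \<in> J \<inter> {\<psi><..}" by blast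
  have "HN_filtration C P E (Suc n) (F(Suc n := E)) (A(n := B)) (\<phi>(n := \<psi>))"
    using H step(3-5) unfolding HN_filtration_def tri_def by (auto simp: less_Suc_eq)
  moreover have "\<forall>i<Suc n. (\<phi>(n := \<psi>)) i \<in> J" using H(2) step(2) by (auto simp: less_Suc_eq)
  ultimately show ?case by blast
qed

lemma ext_closure_mono: "S \<subseteq> T \<Longrightarrow> ext_closure C S \<subseteq> ext_closure C T"
proof
  fix E assume ST: "S \<subseteq> T" and "E \<in> ext_closure C S"
  from this(2) show "E \<in> ext_closure C T"
    by induction (use ST in \<open>auto intro: ext_closure.intros\<close>)
qed

lemma slices_mono: "I \<subseteq> J \<Longrightarrow> slices C P I \<subseteq> slices C P J"
  unfolding slices_def by (intro ext_closure_mono) auto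

lemma slices_monoD: "E \<in> slices C P I \<Longrightarrow> I \<subseteq> J \<Longrightarrow> E \<in> slices C P J"
  using slices_mono by (rule subsetD)

lemma slices_base: "A \<in> P \<phi> \<Longrightarrow> \<phi> \<in> I \<Longrightarrow> A \<in> slices C P I"
  unfolding slices_def by (auto intro: ext_closure.base)

lemma slices_ext: "\<lbrakk>tri C X Y Z; X \<in> slices C P I; Z \<in> slices C P I\<rbrakk> \<Longrightarrow> Y \<in> slices C P I"
  unfolding slices_def tri_def by (auto intro: ext_closure.ext)

lemma slices_induct [consumes 1, case_names base ext]:
  assumes "E \<in> slices C P I" "\<And>\<phi> A. \<phi> \<in> I \<Longrightarrow> A \<in> P \<phi> \<Longrightarrow> Q A"
    "\<And>X Y Z. \<lbrakk>tri C X Y Z; Q X; Q Z\<rbrakk> \<Longrightarrow> Q Y"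
  shows "Q E"
  using assms(1) unfolding slices_def
proof induction
  case (ext X Z Y f g h)
  then have "tri C X Y Z" unfolding tri_def by blast
  then show ?case using assms(3) ext by blast
qed (use assms(2) in blast)

text \<open>
  A slicing without the existence of filtrations. It is what has to be known of a candidate in order to
  manipulate filtrations while their existence is still to be shown.
\<close>

locale preslicing = triangulated_category +
  fixes P :: "real \<Rightarrow> 'a set"
  assumes P_Obj: "A \<in> P \<phi> \<Longrightarrow> A \<in> Obj C"
    and P_iso: "\<lbrakk>A \<in> P \<phi>; isomorphic C A B\<rbrakk> \<Longrightarrow> B \<in> P \<phi>"
    and P_zero: "is_zero C Z \<Longrightarrow> Z \<in> P \<phi>"
    and P_orth: "\<lbrakk>\<phi>\<^sub>2 < \<phi>\<^sub>1; A \<in> P \<phi>\<^sub>1; B \<in> P \<phi>\<^sub>2\<rbrakk> \<Longrightarrow> orth C A B"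
    and P_Sh: "A \<in> Obj C \<Longrightarrow> Sh C A \<in> P (\<phi> + 1) \<longleftrightarrow> A \<in> P \<phi>"
begin

lemma hn_zero: "is_zero C E \<Longrightarrow> hn C P J E"
  by (rule hn.zero)

lemma hn_step: "\<lbrakk>hn C P (J \<inter> {\<psi><..}) K; \<psi> \<in> J; B \<in> P \<psi>; \<not> is_zero C B; tri C K E B\<rbrakk> \<Longrightarrow> hn C P J E"
  by (rule hn.step)

lemma hn_Obj: "hn C P J E \<Longrightarrow> E \<in> Obj C"
  by (induction rule: hn.induct) (blast intro: is_zero_Obj tri_Obj(2))+

lemma hn_iso: "hn C P J E \<Longrightarrow> isomorphic C E E' \<Longrightarrow> hn C P J E'"
proof (induction rule: hn.induct)
  case (zero E J) then show ?case by (intro hn_zero is_zero_iso[of E E'])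
next
  case (step J \<psi> K B E)
  show ?case
    by (rule hn_step[of J \<psi> K B]) (use step tri_iso_middle in blast)+
qed

lemma hn_single: "B \<in> P \<psi> \<Longrightarrow> \<psi> \<in> J \<Longrightarrow> hn C P J B"
proof -
  assume B: "B \<in> P \<psi>" "\<psi> \<in> J"
  obtain O' where O': "is_zero C O'" using ex_zero by blast
  show ?thesis
  proof (cases "is_zero C B")
    case False
    then show ?thesis using hn_step[of J \<psi> O' B B] hn_zero[OF O'] B tri_zero_left[OF _ O'] P_Obj by blast
  qed (rule hn_zero)
qed

lemma hn_induct_ext:
  assumes "hn C P J E" "\<And>Z. is_zero C Z \<Longrightarrow> Q Z" "\<And>\<phi> A. \<phi> \<in> J \<Longrightarrow> A \<in> P \<phi> \<Longrightarrow> Q A"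
    "\<And>X Y Z. \<lbrakk>tri C X Y Z; Q X; Q Z\<rbrakk> \<Longrightarrow> Q Y"
  shows "Q E"
  using assms(1,3)
proof (induction rule: hn.induct)
  case (step J \<psi> K B E)
  have "Q K" using step.prems by (intro step.IH) blast+
  moreover have "Q B" using step.prems step.hyps by blast
  ultimately show ?case by (rule assms(4)[OF step.hyps(5)])
qed (use assms(2) in blast)

lemma hn_orth_left: "\<lbrakk>hn C P J E; W \<in> Obj C; \<And>\<phi> A. \<phi> \<in> J \<Longrightarrow> A \<in> P \<phi> \<Longrightarrow> orth C W A\<rbrakk> \<Longrightarrow> orth C W E"
  by (erule hn_induct_ext) (blast intro: orth_zero tri_orth_left)+

lemma hn_orth_right: "\<lbrakk>hn C P J E; W \<in> Obj C; \<And>\<phi> A. \<phi> \<in> J \<Longrightarrow> A \<in> P \<phi> \<Longrightarrow> orth C A W\<rbrakk> \<Longrightarrow> orth C E W"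
  by (erule hn_induct_ext) (blast intro: orth_zero tri_orth_right)+

lemma hn_orth:
  assumes "hn C P I X" "hn C P J Y" "\<And>x y. x \<in> I \<Longrightarrow> y \<in> J \<Longrightarrow> y < x" shows "orth C X Y"
proof (rule hn_orth_left[OF assms(2) hn_Obj[OF assms(1)]])
  fix \<phi> A assume A: "\<phi> \<in> J" "A \<in> P \<phi>"
  show "orth C X A"
    by (rule hn_orth_right[OF assms(1) P_Obj[OF A(2)]]) (rule P_orth[OF assms(3)[OF _ A(1)] _ A(2)])
qed

lemma hn_Sh: "hn C P J E \<Longrightarrow> hn C P ((\<lambda>x. x + 1) ` J) (Sh C E)"
proof (induction rule: hn.induct)
  case (zero E J) then show ?case by (intro hn_zero is_zero_Sh)
next
  case (step J \<psi> K B E)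
  have "(\<lambda>x. x + 1) ` J \<inter> {\<psi> + 1<..} = (\<lambda>x. x + 1) ` (J \<inter> {\<psi><..})" by force
  moreover have "\<not> is_zero C (Sh C B)"
    using step.hyps orth_Sh[of B B] P_Obj unfolding is_zero_iff by blast
  ultimately show ?case
    using step hn_step[of "(\<lambda>x. x + 1) ` J" "\<psi> + 1" "Sh C K" "Sh C B" "Sh C E"]
      tri_Sh[OF step.hyps(5)] P_Sh[OF P_Obj[OF step.hyps(3)], of \<psi>] by simp
qed

lemma hn_orth_Sh:
  assumes "hn C P I X" "hn C P J Y" "\<And>x y. x \<in> I \<Longrightarrow> y \<in> J \<Longrightarrow> y < x" shows "orth C (Sh C X) Y"
proof (rule hn_orth[OF hn_Sh[OF assms(1)] assms(2)])
  fix x y assume "x \<in> (\<lambda>x. x + 1) ` I" "y \<in> J"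
  then show "y < x" using assms(3) by fastforce
qed

text \<open>
  The filtration is split at the first phase outside the upward closed set \<open>U\<close>.
\<close>

lemma hn_cut:
  assumes "hn C P J E" "\<And>x y. x \<in> U \<Longrightarrow> x \<le> y \<Longrightarrow> y \<in> U"
  obtains X Y where "tri C X E Y" "hn C P (J \<inter> U) X" "hn C P (J - U) Y"
proof -
  have "\<exists>X Y. tri C X E Y \<and> hn C P (J \<inter> U) X \<and> hn C P (J - U) Y"
    using assms(1)
  proof (induction rule: hn.induct)
    case (zero E J)
    then show ?case using tri_zero_left[OF is_zero_Obj, of E E] hn_zero by blast
  next
    case (step J \<psi> K B E)
    show ?case
    proof (cases "\<psi> \<in> U")
      case True
      then have "J \<inter> {\<psi><..} = J \<inter> U \<inter> {\<psi><..}" using assms(2)[OF True] by auto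
      then have "hn C P (J \<inter> U) E" using hn_step[of "J \<inter> U" \<psi> K B E] step True by simp
      moreover obtain O' where O': "is_zero C O'" using ex_zero by blast
      ultimately show ?thesis using hn_zero[OF O'] tri_zero_right[OF hn_Obj O'] by blast
    next
      case False
      obtain X Y where XY: "tri C X K Y" "hn C P (J \<inter> {\<psi><..} \<inter> U) X" "hn C P (J \<inter> {\<psi><..} - U) Y"
        using step.IH by blast
      obtain Y' where Y': "tri C X E Y'" "tri C Y Y' B" using tri_octahedral[OF XY(1) step(5)] by blast
      have "hn C P ((J - U) \<inter> {\<psi><..}) Y" using XY(3) by (rule hn_mono) auto
      then have "hn C P (J - U) Y'" using hn_step[of "J - U" \<psi> Y B Y'] step Y' False by simp
      moreover have "hn C P (J \<inter> U) X" using XY(2) by (rule hn_mono) auto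
      ultimately show ?thesis using Y' by blast
    qed
  qed
  then show thesis using that by blast
qed

lemma hn_concat:
  assumes "hn C P J Y" "hn C P I X" "tri C X E Y" "\<And>x y. x \<in> I \<Longrightarrow> y \<in> J \<Longrightarrow> y < x"
  shows "hn C P (I \<union> J) E"
  using assms(1,3,4)
proof (induction arbitrary: E rule: hn.induct)
  case (zero Y J)
  then have "isomorphic C X E" using tri_zero_imp_iso by blast
  then have "hn C P I E" by (rule hn_iso[OF assms(2)])
  then show ?case by (rule hn_mono) simp
next
  case (step J \<psi> K B Y)
  obtain E' where E': "tri C X E' K" "tri C E' E B" using tri_octahedral'[OF step.prems(1) step.hyps(5)] by blast
  have "hn C P (I \<union> J \<inter> {\<psi><..}) E'" using step.prems by (intro step.IH E') auto
  moreover have "I \<union> J \<inter> {\<psi><..} = (I \<union> J) \<inter> {\<psi><..}" using step.prems(2) step.hyps(2) by auto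
  ultimately show ?case using hn_step[of "I \<union> J" \<psi> E' B E] step E' by simp
qed

text \<open>
  Orthogonality detects phases: if no factor outside \<open>U\<close> receives a map from \<open>E\<close>, the quotient of \<open>E\<close> made of
  these factors vanishes.
\<close>

lemma hn_refine_lower:
  assumes "hn C P J E" "\<And>x y. x \<in> U \<Longrightarrow> x \<le> y \<Longrightarrow> y \<in> U"
    "\<And>\<xi> B. \<xi> \<in> J - U \<Longrightarrow> B \<in> P \<xi> \<Longrightarrow> orth C E B"
  shows "hn C P (J \<inter> U) E"
proof -
  obtain X Y where XY: "tri C X E Y" "hn C P (J \<inter> U) X" "hn C P (J - U) Y" using hn_cut[OF assms(1), of U] assms(2) by blast
  have "orth C E Y" using hn_orth_left[OF XY(3)] hn_Obj[OF assms(1)] assms(3) by simp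
  moreover have "orth C (Sh C X) Y"
  proof (rule hn_orth_Sh[OF XY(2,3)])
    show "y < x" if "x \<in> J \<inter> U" "y \<in> J - U" for x y
      using that assms(2)[of x y] by (auto simp: not_le[symmetric])
  qed
  ultimately have "is_zero C Y" using tri_zero3 XY(1) by blast
  then show ?thesis by (rule hn_iso[OF XY(2) tri_zero_imp_iso[OF XY(1)]])
qed

lemma hn_refine_upper:
  assumes "hn C P J E" "\<And>x y. x \<in> U \<Longrightarrow> x \<le> y \<Longrightarrow> y \<in> U"
    "\<And>\<xi> B. \<xi> \<in> J \<inter> U \<Longrightarrow> B \<in> P \<xi> \<Longrightarrow> orth C B E"
  shows "hn C P (J - U) E"
proof -
  obtain X Y where XY: "tri C X E Y" "hn C P (J \<inter> U) X" "hn C P (J - U) Y" using hn_cut[OF assms(1), of U] assms(2) by blast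
  have "orth C X E" using hn_orth_right[OF XY(2)] hn_Obj[OF assms(1)] assms(3) by simp
  moreover have "orth C (Sh C X) Y"
  proof (rule hn_orth_Sh[OF XY(2,3)])
    show "y < x" if "x \<in> J \<inter> U" "y \<in> J - U" for x y
      using that assms(2)[of x y] by (auto simp: not_le[symmetric])
  qed
  ultimately have "is_zero C X" using tri_zero1 XY(1) by blast
  then show ?thesis by (intro hn_iso[OF XY(3)] isomorphic_sym[OF tri_zero_imp_iso'[OF XY(1)]])
qed

lemma slices_P: "A \<in> P \<phi> \<Longrightarrow> \<phi> \<in> I \<Longrightarrow> A \<in> slices C P I"
  by (rule slices_base)

lemma hn_imp_slices: "hn C P J E \<Longrightarrow> J \<noteq> {} \<Longrightarrow> E \<in> slices C P J"
  by (erule hn_induct_ext) (auto intro: slices_P P_zero slices_ext)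

lemma slices_Obj: "E \<in> slices C P J \<Longrightarrow> E \<in> Obj C"
  by (induction rule: slices_induct) (auto dest: P_Obj tri_Obj)

lemma slices_orth_left: "\<lbrakk>E \<in> slices C P J; W \<in> Obj C; \<And>\<phi> A. \<phi> \<in> J \<Longrightarrow> A \<in> P \<phi> \<Longrightarrow> orth C W A\<rbrakk> \<Longrightarrow> orth C W E"
  by (erule slices_induct) (blast intro: tri_orth_left)+

lemma slices_orth_right: "\<lbrakk>E \<in> slices C P J; W \<in> Obj C; \<And>\<phi> A. \<phi> \<in> J \<Longrightarrow> A \<in> P \<phi> \<Longrightarrow> orth C A W\<rbrakk> \<Longrightarrow> orth C E W"
  by (erule slices_induct) (blast intro: tri_orth_right)+

lemma slices_orth:
  assumes "X \<in> slices C P I" "Y \<in> slices C P J" "\<And>x y. x \<in> I \<Longrightarrow> y \<in> J \<Longrightarrow> y < x" shows "orth C X Y"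
proof (rule slices_orth_left[OF assms(2) slices_Obj[OF assms(1)]])
  fix \<phi> A assume A: "\<phi> \<in> J" "A \<in> P \<phi>"
  show "orth C X A"
    by (rule slices_orth_right[OF assms(1) P_Obj[OF A(2)]]) (rule P_orth[OF assms(3)[OF _ A(1)] _ A(2)])
qed

lemma slices_zero: "is_zero C Z \<Longrightarrow> J \<noteq> {} \<Longrightarrow> Z \<in> slices C P J"
  using slices_P[OF P_zero] by blast

lemma slices_iso: "\<lbrakk>E \<in> slices C P J; isomorphic C E E'; J \<noteq> {}\<rbrakk> \<Longrightarrow> E' \<in> slices C P J"
proof -
  assume E: "E \<in> slices C P J" "isomorphic C E E'" "J \<noteq> {}"
  obtain O' where O': "is_zero C O'" using ex_zero by blast
  show ?thesis by (rule slices_ext[OF tri_iso_right[OF E(2) O'] E(1) slices_zero[OF O' E(3)]])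
qed

lemma slices_Sh: "E \<in> slices C P J \<Longrightarrow> Sh C E \<in> slices C P ((\<lambda>x. x + 1) ` J)"
proof (induction rule: slices_induct)
  case (base \<phi> A)
  then have "Sh C A \<in> P (\<phi> + 1)" using P_Sh P_Obj by blast
  then show ?case by (rule slices_P) (use base in simp)
next
  case (ext X Y Z)
  then show ?case using slices_ext[OF tri_Sh[OF ext(1)]] by simp
qed

lemma P_unshift: "A \<in> Obj C \<Longrightarrow> unshift C A \<in> P (\<phi> - 1) \<longleftrightarrow> A \<in> P \<phi>"
  using P_Sh[of "unshift C A" "\<phi> - 1"] by simp

lemma slices_unshift: "E \<in> slices C P J \<Longrightarrow> unshift C E \<in> slices C P ((\<lambda>x. x - 1) ` J)"
proof (induction rule: slices_induct)
  case (base \<phi> A)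
  then have "unshift C A \<in> P (\<phi> - 1)" using P_unshift P_Obj by blast
  then show ?case by (rule slices_P) (use base in simp)
next
  case (ext X Y Z)
  have "tri C (unshift C X) (unshift C Y) (unshift C Z)"
    using tri_Obj[OF ext(1)] tri_Sh_iff[of "unshift C X" "unshift C Y" "unshift C Z"] ext(1) by simp
  then show ?case by (rule slices_ext) (use ext in auto)
qed

end

locale slicing_category = preslicing +
  assumes HN: "E \<in> Obj C \<Longrightarrow> hn C P UNIV E"
begin

lemma hn_intervalI:
  assumes J: "is_interval J" and "E \<in> Obj C"
    and above: "\<And>\<psi> A. (\<And>x. x \<in> J \<Longrightarrow> x < \<psi>) \<Longrightarrow> A \<in> P \<psi> \<Longrightarrow> orth C A E"
    and below: "\<And>\<psi> B. (\<And>x. x \<in> J \<Longrightarrow> \<psi> < x) \<Longrightarrow> B \<in> P \<psi> \<Longrightarrow> orth C E B"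
  shows "hn C P J E"
proof -
  let ?U = "{\<psi>. \<forall>x\<in>J. x < \<psi>}" and ?V = "{\<psi>. \<exists>x\<in>J. x \<le> \<psi>}"
  have "hn C P (UNIV - ?U) E"
  proof (rule hn_refine_upper[OF HN[OF assms(2)]])
    fix \<xi> B assume "\<xi> \<in> UNIV \<inter> ?U" "B \<in> P \<xi>"
    then show "orth C B E" by (intro above) auto
  next
    fix x y :: real assume "x \<in> ?U" "x \<le> y"
    then show "y \<in> ?U" by force
  qed
  then have "hn C P ((UNIV - ?U) \<inter> ?V) E"
  proof (rule hn_refine_lower)
    fix \<xi> B assume "\<xi> \<in> UNIV - ?U - ?V" "B \<in> P \<xi>"
    then show "orth C E B" by (intro below) (auto simp: not_le)
  next
    fix x y :: real assume "x \<in> ?V" "x \<le> y"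
    then show "y \<in> ?V" using order.trans by blast
  qed
  moreover have "(UNIV - ?U) \<inter> ?V = J"
  proof (intro equalityI subsetI)
    fix z assume "z \<in> (UNIV - ?U) \<inter> ?V"
    then obtain x y where "x \<in> J" "x \<le> z" "y \<in> J" "z \<le> y" by (auto simp: not_less)
    then show "z \<in> J" using J unfolding is_interval_1 by blast
  qed auto
  ultimately show ?thesis by simp
qed

text \<open>
  For an interval \<open>J\<close> the subcategory \<open>P J\<close> is cut out by the vanishing of maps from semistables
  of larger and to semistables of smaller phase.
\<close>

lemma slices_interval_iff:
  assumes "is_interval J" "J \<noteq> {}"
  shows "E \<in> slices C P J \<longleftrightarrow> E \<in> Obj C \<and>
    (\<forall>\<psi>. (\<forall>x\<in>J. x < \<psi>) \<longrightarrow> (\<forall>A\<in>P \<psi>. orth C A E)) \<and>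
    (\<forall>\<psi>. (\<forall>x\<in>J. \<psi> < x) \<longrightarrow> (\<forall>B\<in>P \<psi>. orth C E B))"
proof (intro iffI conjI allI impI ballI)
  assume E: "E \<in> slices C P J"
  show o: "E \<in> Obj C" using slices_Obj[OF E] .
  fix \<psi> A assume A: "A \<in> P \<psi>"
  show "orth C A E" if "\<forall>x\<in>J. x < \<psi>"
    by (rule slices_orth_left[OF E P_Obj[OF A]], rule P_orth[OF _ A]) (use that in auto)
  show "orth C E A" if "\<forall>x\<in>J. \<psi> < x"
    by (rule slices_orth_right[OF E P_Obj[OF A]], rule P_orth[OF _ _ A]) (use that in auto)
next
  assume "E \<in> Obj C \<and> (\<forall>\<psi>. (\<forall>x\<in>J. x < \<psi>) \<longrightarrow> (\<forall>A\<in>P \<psi>. orth C A E)) \<and>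
    (\<forall>\<psi>. (\<forall>x\<in>J. \<psi> < x) \<longrightarrow> (\<forall>B\<in>P \<psi>. orth C E B))"
  then have o: "E \<in> Obj C" and
    1: "\<And>\<psi> A. \<forall>x\<in>J. x < \<psi> \<Longrightarrow> A \<in> P \<psi> \<Longrightarrow> orth C A E" and
    2: "\<And>\<psi> B. \<forall>x\<in>J. \<psi> < x \<Longrightarrow> B \<in> P \<psi> \<Longrightarrow> orth C E B" by simp_all
  have "hn C P J E"
  proof (rule hn_intervalI[OF assms(1) o])
    show "orth C A E" if "\<And>x. x \<in> J \<Longrightarrow> x < \<psi>" "A \<in> P \<psi>" for \<psi> A
      by (rule 1[of \<psi>]) (use that in auto)
    show "orth C E B" if "\<And>x. x \<in> J \<Longrightarrow> \<psi> < x" "B \<in> P \<psi>" for \<psi> B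
      by (rule 2[of \<psi>]) (use that in auto)
  qed
  then show "E \<in> slices C P J" by (rule hn_imp_slices[OF _ assms(2)])
qed

lemma slices_imp_hn:
  assumes "is_interval J" "E \<in> slices C P J" shows "hn C P J E"
proof (cases "J = {}")
  case True
  have False using assms(2) by (induction rule: slices_induct) (use True in auto)
  then show ?thesis ..
next
  case False
  have 1: "\<forall>\<psi>. (\<forall>x\<in>J. x < \<psi>) \<longrightarrow> (\<forall>A\<in>P \<psi>. orth C A E)"
    and 2: "\<forall>\<psi>. (\<forall>x\<in>J. \<psi> < x) \<longrightarrow> (\<forall>B\<in>P \<psi>. orth C E B)"
    using slices_interval_iff[OF assms(1) False, of E] assms(2) by simp_all
  show ?thesis
  proof (rule hn_intervalI[OF assms(1) slices_Obj[OF assms(2)]])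
    show "orth C A E" if "\<And>x. x \<in> J \<Longrightarrow> x < \<psi>" "A \<in> P \<psi>" for \<psi> A
      by (rule 1[rule_format, OF _ that(2)]) (rule that(1))
    show "orth C E B" if "\<And>x. x \<in> J \<Longrightarrow> \<psi> < x" "B \<in> P \<psi>" for \<psi> B
      by (rule 2[rule_format, OF _ that(2)]) (rule that(1))
  qed
qed

lemma slices_greaterThan: "E \<in> slices C P {c<..} \<longleftrightarrow> E \<in> Obj C \<and> (\<forall>\<psi>\<le>c. \<forall>B\<in>P \<psi>. orth C E B)"
proof -
  have a: "(\<forall>x\<in>{c<..}. x < \<psi>) = False" for \<psi> by (auto intro!: bexI[of _ "max c \<psi> + 1"])
  have b: "(\<forall>x\<in>{c<..}. \<psi> < x) = (\<psi> \<le> c)" for \<psi> by (cases "\<psi> \<le> c") auto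
  show ?thesis by (subst slices_interval_iff) (simp_all add: a b)
qed

lemma slices_atMost: "E \<in> slices C P {..c} \<longleftrightarrow> E \<in> Obj C \<and> (\<forall>\<psi>>c. \<forall>A\<in>P \<psi>. orth C A E)"
proof -
  have a: "(\<forall>x\<in>{..c}. \<psi> < x) = False" for \<psi> by (auto intro!: bexI[of _ "min c \<psi>"])
  have b: "(\<forall>x\<in>{..c}. x < \<psi>) = (c < \<psi>)" for \<psi> by auto
  show ?thesis by (subst slices_interval_iff) (simp_all add: a b)
qed

lemma slices_atLeast: "E \<in> slices C P {c..} \<longleftrightarrow> E \<in> Obj C \<and> (\<forall>\<psi><c. \<forall>B\<in>P \<psi>. orth C E B)"
proof -
  have a: "(\<forall>x\<in>{c..}. x < \<psi>) = False" for \<psi> by (auto intro!: bexI[of _ "max c \<psi>"])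
  have b: "(\<forall>x\<in>{c..}. \<psi> < x) = (\<psi> < c)" for \<psi> by auto
  show ?thesis by (subst slices_interval_iff) (simp_all add: a b)
qed

lemma slices_lessThan: "E \<in> slices C P {..<c} \<longleftrightarrow> E \<in> Obj C \<and> (\<forall>\<psi>\<ge>c. \<forall>A\<in>P \<psi>. orth C A E)"
proof -
  have a: "(\<forall>x\<in>{..<c}. \<psi> < x) = False" for \<psi> by (auto intro!: bexI[of _ "min c \<psi> - 1"])
  have b: "(\<forall>x\<in>{..<c}. x < \<psi>) = (c \<le> \<psi>)" for \<psi> by (cases "c \<le> \<psi>") auto
  show ?thesis by (subst slices_interval_iff) (simp_all add: a b)
qed

lemma slices_greaterThanAtMost:
  assumes "c < d" shows "slices C P {c<..d} = slices C P {c<..} \<inter> slices C P {..d}"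
proof -
  have a: "(\<forall>x\<in>{c<..d}. x < \<psi>) = (d < \<psi>)" for \<psi> using assms by auto
  have b: "(\<forall>x\<in>{c<..d}. \<psi> < x) = (\<psi> \<le> c)" for \<psi>
    using assms by (cases "\<psi> \<le> c") (auto intro!: bexI[of _ "min d \<psi>"])
  show ?thesis
    using assms by (auto simp: slices_interval_iff a b slices_greaterThan slices_atMost)
qed

lemma slices_atLeastAtMost:
  assumes "c \<le> d" shows "slices C P {c..d} = slices C P {c..} \<inter> slices C P {..d}"
proof -
  have a: "(\<forall>x\<in>{c..d}. x < \<psi>) = (d < \<psi>)" "(\<forall>x\<in>{c..d}. \<psi> < x) = (\<psi> < c)" for \<psi> using assms by auto
  show ?thesis
    using assms by (auto simp: slices_interval_iff a slices_atLeast slices_atMost)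
qed

lemma slices_greaterThanLessThan:
  assumes "c < d" shows "slices C P {c<..<d} = slices C P {c<..} \<inter> slices C P {..<d}"
proof -
  have a: "(\<forall>x\<in>{c<..<d}. x < \<psi>) = (d \<le> \<psi>)" for \<psi>
  proof (cases "d \<le> \<psi>")
    case False
    then obtain x where "max c \<psi> < x" "x < d" using dense[of "max c \<psi>" d] assms by auto
    then show ?thesis using False by (auto intro!: bexI[of _ x])
  qed auto
  have b: "(\<forall>x\<in>{c<..<d}. \<psi> < x) = (\<psi> \<le> c)" for \<psi>
  proof (cases "\<psi> \<le> c")
    case False
    then obtain x where "c < x" "x < min d \<psi>" using dense[of c "min d \<psi>"] assms by auto
    then show ?thesis using False by (auto intro!: bexI[of _ x])
  qed auto
  show ?thesis
    using assms by (auto simp: slices_interval_iff a b slices_greaterThan slices_lessThan)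
qed

lemma slices_cut:
  assumes "E \<in> Obj C"
  obtains X Y where "tri C X E Y" "X \<in> slices C P {c<..}" "Y \<in> slices C P {..c}"
proof -
  obtain X Y where XY: "tri C X E Y" "hn C P (UNIV \<inter> {c<..}) X" "hn C P (UNIV - {c<..}) Y"
    using hn_cut[OF HN[OF assms], of "{c<..}"] by auto
  moreover have "UNIV - {c<..} = {..c}" by auto
  ultimately show thesis using that hn_imp_slices gt_ex by fastforce
qed

lemma slices_singleton: "slices C P {\<phi>} = P \<phi>"
proof
  show "P \<phi> \<subseteq> slices C P {\<phi>}" using slices_P by blast
  show "slices C P {\<phi>} \<subseteq> P \<phi>"
  proof
    fix E assume "E \<in> slices C P {\<phi>}"
    then have "hn C P {\<phi>} E" using slices_imp_hn[of "{\<phi>}"] by (simp add: is_interval_1)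
    then show "E \<in> P \<phi>"
    proof cases
      case (step \<psi> K B)
      then have "hn C P {} K" by simp
      then have "is_zero C K" by cases auto
      then have "isomorphic C E B" using step tri_zero_imp_iso' by blast
      then show ?thesis using step P_iso isomorphic_sym by blast
    qed (rule P_zero)
  qed
qed

end

lemma slicing_imp_category:
  assumes "triangulated_category C" "slicing C P" shows "slicing_category C P"
proof -
  interpret triangulated_category C by fact
  have add: "additive_subcategory C (P \<phi>)" and sh: "Sh C ` P \<phi> = P (\<phi> + 1)" for \<phi>
    using assms(2) by (simp_all add: slicing_def)
  have Po: "P \<phi> \<subseteq> Obj C" and iso: "\<forall>A B. A \<in> P \<phi> \<longrightarrow> isomorphic C A B \<longrightarrow> B \<in> P \<phi>"
    and zero: "\<exists>O'\<in>P \<phi>. is_zero C O'" for \<phi>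
    using add[of \<phi>] by (simp_all add: additive_subcategory_def)
  have orth: "\<forall>\<phi>\<^sub>1 \<phi>\<^sub>2. \<phi>\<^sub>1 > \<phi>\<^sub>2 \<longrightarrow> (\<forall>A\<in>P \<phi>\<^sub>1. \<forall>B\<in>P \<phi>\<^sub>2. orth C A B)"
    and HN: "\<forall>E\<in>Obj C. \<not> is_zero C E \<longrightarrow> (\<exists>n F A \<phi>. HN_filtration C P E n F A \<phi>)"
    using assms(2) by (simp_all add: slicing_def orth_def)
  show ?thesis
  proof unfold_locales
    show "A \<in> Obj C" if "A \<in> P \<phi>" for A \<phi> using Po[of \<phi>] that by blast
    show "B \<in> P \<phi>" if "A \<in> P \<phi>" "isomorphic C A B" for A B \<phi> using iso[of \<phi>] that by simp
    show "Z \<in> P \<phi>" if "is_zero C Z" for Z \<phi>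
    proof -
      obtain O' where "O' \<in> P \<phi>" "is_zero C O'" using zero[of \<phi>] by blast
      then show ?thesis using iso[of \<phi>] zero_isomorphic[of O' Z] that by simp
    qed
    show "orth C A B" if "\<phi>\<^sub>2 < \<phi>\<^sub>1" "A \<in> P \<phi>\<^sub>1" "B \<in> P \<phi>\<^sub>2" for \<phi>\<^sub>1 \<phi>\<^sub>2 A B
      using orth that by simp
    show "Sh C A \<in> P (\<phi> + 1) \<longleftrightarrow> A \<in> P \<phi>" if A: "A \<in> Obj C" for A \<phi>
    proof
      assume "Sh C A \<in> P (\<phi> + 1)"
      then obtain B where "B \<in> P \<phi>" "Sh C A = Sh C B" using sh[of \<phi>] by (metis imageE)
      moreover have "B \<in> Obj C" using Po[of \<phi>] calculation by blast
      ultimately show "A \<in> P \<phi>" using A unshift_Sh by metis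
    next
      assume "A \<in> P \<phi>" then show "Sh C A \<in> P (\<phi> + 1)" unfolding sh[symmetric] by (rule imageI)
    qed
  next
    fix E assume E: "E \<in> Obj C"
    show "hn C P UNIV E"
    proof (cases "is_zero C E")
      case False
      then obtain n F A \<phi> where "HN_filtration C P E n F A \<phi>" using HN E by blast
      then have "hn C P (\<phi> ` {..<n}) E" by (rule HN_filtration_imp_hn)
      then show ?thesis by (rule hn_mono) simp
    qed (rule hn.zero)
  qed
qed

lemma (in slicing_category) slicing: "slicing C P"
  unfolding slicing_def
proof (intro conjI allI ballI impI)
  fix \<phi>
  show "additive_subcategory C (P \<phi>)"
    unfolding additive_subcategory_def
  proof (intro conjI allI ballI impI)
    show "P \<phi> \<subseteq> Obj C" using P_Obj by (intro subsetI)
    show "\<And>A B. A \<in> P \<phi> \<Longrightarrow> isomorphic C A B \<Longrightarrow> B \<in> P \<phi>" by (rule P_iso)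
    obtain O' where "is_zero C O'" using ex_zero by blast
    then show "\<exists>O'\<in>P \<phi>. is_zero C O'" using P_zero[of O' \<phi>] by (intro bexI[of _ O'])
    fix A B assume AB: "A \<in> P \<phi>" "B \<in> P \<phi>"
    then obtain T where T: "is_biproduct C A B T" using ex_biproduct[OF P_Obj P_Obj] by blast
    have "T \<in> slices C P {\<phi>}"
      by (rule slices_ext[OF biproduct_tri[OF T]]) (use AB in \<open>simp_all add: slices_singleton\<close>)
    then show "\<exists>T\<in>P \<phi>. is_biproduct C A B T" using T by (auto simp: slices_singleton)
  qed
  show "Sh C ` P \<phi> = P (\<phi> + 1)"
  proof (intro equalityI subsetI)
    fix B assume "B \<in> Sh C ` P \<phi>"
    then show "B \<in> P (\<phi> + 1)" using P_Sh P_Obj by (elim imageE) simp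
  next
    fix A assume A: "A \<in> P (\<phi> + 1)"
    then have "unshift C A \<in> P \<phi>" using P_unshift[OF P_Obj[OF A], of "\<phi> + 1"] by simp
    then show "A \<in> Sh C ` P \<phi>" using Sh_unshift[OF P_Obj[OF A]] by (intro image_eqI[of _ _ "unshift C A"]) simp_all
  qed
next
  fix \<phi>\<^sub>1 \<phi>\<^sub>2 :: real and A B assume "\<phi>\<^sub>2 < \<phi>\<^sub>1" "A \<in> P \<phi>\<^sub>1" "B \<in> P \<phi>\<^sub>2"
  then show "Hom C A B = {Nul C A B}" using P_orth unfolding orth_def by simp
next
  fix E assume "E \<in> Obj C"
  then show "\<exists>n F A \<phi>. HN_filtration C P E n F A \<phi>" using hn_imp_HN_filtration[OF HN, of E] by simp
qed

section \<open>Central charges\<close>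

lemma comm_group_complex_add: "comm_group complex_add"
  unfolding complex_add_def
  by (rule comm_groupI) (auto intro: exI[of _ "- x" for x] simp: add.commute[of _ "- x" for x] ac_simps add_eq_0_iff2)

lemma complex_add_sel [simp]: "carrier complex_add = UNIV" "mult complex_add = (+)" "one complex_add = 0"
  by (simp_all add: complex_add_def)

context triangulated_category
begin

lemma K0_gens_carrier:
  "{frag_of Y - frag_of X - frag_of Z |X Y Z. \<exists>f g h. Tri C X Y Z f g h} \<subseteq> carrier (free_Abelian_group (Obj C))"
proof
  fix c assume "c \<in> {frag_of Y - frag_of X - frag_of Z |X Y Z. \<exists>f g h. Tri C X Y Z f g h}"
  then obtain X Y Z where c: "c = frag_of Y - frag_of X - frag_of Z" "X \<in> Obj C" "Y \<in> Obj C" "Z \<in> Obj C"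
    using Tri_type by blast
  have "Poly_Mapping.keys c \<subseteq> {X, Y, Z}"
    unfolding c by (intro order.trans[OF keys_diff] Un_least order.trans[OF keys_diff]) auto
  then show "c \<in> carrier (free_Abelian_group (Obj C))" using c by auto
qed

lemma K0_rel_normal: "K0_rel C \<lhd> free_Abelian_group (Obj C)"
proof -
  interpret G: comm_group "free_Abelian_group (Obj C)" by (rule abelian_free_Abelian_group)
  show ?thesis
    unfolding K0_rel_def
    by (intro G.subgroup_imp_normal G.generate_is_subgroup K0_gens_carrier)
qed

lemma K0_class_carrier: "E \<in> Obj C \<Longrightarrow> K0_class C E \<in> carrier (K0 C)"
  unfolding K0_class_def K0_def carrier_FactGroup by (auto intro!: imageI)

lemma K0_class_tri:
  assumes "tri C X Y Z" shows "K0_class C Y = K0_class C X \<otimes>\<^bsub>K0 C\<^esub> K0_class C Z"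
proof -
  interpret N: normal "K0_rel C" "free_Abelian_group (Obj C)" by (rule K0_rel_normal)
  note o = tri_Obj[OF assms]
  let ?G = "free_Abelian_group (Obj C)"
  let ?c = "frag_of Y - frag_of X - frag_of Z"
  have c: "?c \<in> K0_rel C"
    unfolding K0_rel_def by (rule generate.incl) (use assms in \<open>unfold tri_def, blast\<close>)
  have "K0_class C X \<otimes>\<^bsub>K0 C\<^esub> K0_class C Z = K0_rel C #>\<^bsub>?G\<^esub> (frag_of X \<otimes>\<^bsub>?G\<^esub> frag_of Z)"
    unfolding K0_class_def K0_def FactGroup_def using o by (simp add: N.rcos_sum del: mult_free_Abelian_group)
  also have "\<dots> = (K0_rel C #>\<^bsub>?G\<^esub> ?c) #>\<^bsub>?G\<^esub> (frag_of X \<otimes>\<^bsub>?G\<^esub> frag_of Z)"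
    using N.rcos_const[OF N.is_group c] by simp
  also have "\<dots> = K0_rel C #>\<^bsub>?G\<^esub> (?c \<otimes>\<^bsub>?G\<^esub> (frag_of X \<otimes>\<^bsub>?G\<^esub> frag_of Z))"
  proof (rule N.coset_mult_assoc)
    show "K0_rel C \<subseteq> carrier ?G" by (rule N.subset)
    show "?c \<in> carrier ?G" using c N.subset by blast
    show "frag_of X \<otimes>\<^bsub>?G\<^esub> frag_of Z \<in> carrier ?G" using o N.m_closed[of "frag_of X" "frag_of Z"] by simp
  qed
  also have "?c \<otimes>\<^bsub>?G\<^esub> (frag_of X \<otimes>\<^bsub>?G\<^esub> frag_of Z) = frag_of Y" by simp
  finally show ?thesis unfolding K0_class_def by simp
qed

lemma charge_tri:
  assumes "Z \<in> hom (K0 C) complex_add" "tri C X Y W"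
  shows "Z (K0_class C Y) = Z (K0_class C X) + Z (K0_class C W)"
  using hom_mult[OF assms(1)] K0_class_tri[OF assms(2)] K0_class_carrier tri_Obj[OF assms(2)] by simp

text \<open>
  An additive function on objects extends to the free abelian group and kills the relations of \<open>K\<^sub>0\<close>.
\<close>

lemma charge_exists:
  assumes "\<And>X Y W. tri C X Y W \<Longrightarrow> z Y = z X + z W"
  obtains Z where "Z \<in> hom (K0 C) complex_add" "Z \<in> extensional (carrier (K0 C))"
    "\<And>E. E \<in> Obj C \<Longrightarrow> Z (K0_class C E) = z E"
proof -
  let ?G = "free_Abelian_group (Obj C)"
  obtain h where h: "h \<in> hom ?G complex_add" "\<And>E. E \<in> Obj C \<Longrightarrow> h (frag_of E) = z E"
    using comm_group.free_Abelian_group_universal[OF comm_group_complex_add, of z "Obj C"] by auto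
  interpret h: group_hom ?G complex_add h
    using h(1) comm_group_complex_add by (simp add: group_hom_def group_hom_axioms_def comm_group_def)
  have hadd: "h (a + b) = h a + h b" if "a \<in> carrier ?G" "b \<in> carrier ?G" for a b
    using hom_mult[OF h(1) that] by simp
  have "K0_rel C \<subseteq> kernel ?G complex_add h"
    unfolding K0_rel_def
  proof (rule h.G.generate_subgroup_incl[OF _ h.subgroup_kernel], rule subsetI)
    fix c assume c: "c \<in> {frag_of Y - frag_of X - frag_of Z |X Y Z. \<exists>f g h. Tri C X Y Z f g h}"
    then obtain X Y Z where XYZ: "c = frag_of Y - frag_of X - frag_of Z" "tri C X Y Z" unfolding tri_def by blast
    note o = tri_Obj[OF XYZ(2)]
    have cc: "c \<in> carrier ?G" using c K0_gens_carrier by blast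
    have fXZ: "frag_of X + frag_of Z \<in> carrier ?G" using h.G.m_closed[of "frag_of X" "frag_of Z"] o by simp
    have "c + (frag_of X + frag_of Z) = frag_of Y" using XYZ(1) by simp
    then have "z Y = h c + (z X + z Z)"
      using hadd[OF cc fXZ] hadd[of "frag_of X" "frag_of Z"] h(2) o by simp
    then have "h c = 0" using assms[OF XYZ(2)] by simp
    then show "c \<in> kernel ?G complex_add h" using cc by (simp add: kernel_def)
  qed
  then obtain g where g: "g \<in> hom (K0 C) complex_add" "\<And>x. x \<in> carrier ?G \<Longrightarrow> g (K0_rel C #>\<^bsub>?G\<^esub> x) = h x"
    using h.FactGroup_universal_kernel[OF K0_rel_normal] unfolding K0_def by blast
  interpret K: group "K0 C" unfolding K0_def by (rule normal.factorgroup_is_group[OF K0_rel_normal])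
  show thesis
  proof (rule that[of "restrict g (carrier (K0 C))"])
    show "restrict g (carrier (K0 C)) \<in> hom (K0 C) complex_add"
      using g(1) by (auto simp: hom_def)
    show "restrict g (carrier (K0 C)) (K0_class C E) = z E" if "E \<in> Obj C" for E
      using K0_class_carrier[OF that] g(2)[of "frag_of E"] h(2)[OF that] that by (simp add: K0_class_def)
  qed simp
qed

text \<open>
  The classes of objects generate \<open>K\<^sub>0\<close>; extensionality fixes the values outside the carrier.
\<close>

lemma charge_unique:
  assumes Z: "Z \<in> hom (K0 C) complex_add" "Z \<in> extensional (carrier (K0 C))"
    and Z': "Z' \<in> hom (K0 C) complex_add" "Z' \<in> extensional (carrier (K0 C))"
    and eq: "\<And>E. E \<in> Obj C \<Longrightarrow> Z (K0_class C E) = Z' (K0_class C E)"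
  shows "Z = Z'"
proof (rule extensionalityI[OF Z(2) Z'(2)])
  let ?G = "free_Abelian_group (Obj C)"
  interpret N: normal "K0_rel C" ?G by (rule K0_rel_normal)
  interpret K: group "K0 C" unfolding K0_def by (rule N.factorgroup_is_group)
  define d where "d c = Z (K0_rel C #>\<^bsub>?G\<^esub> c) - Z' (K0_rel C #>\<^bsub>?G\<^esub> c)" for c
  have cl: "K0_rel C #>\<^bsub>?G\<^esub> c \<in> carrier (K0 C)" if "c \<in> carrier ?G" for c
    using that unfolding K0_def carrier_FactGroup by blast
  have d_add: "d (a + b) = d a + d b" if ab: "a \<in> carrier ?G" "b \<in> carrier ?G" for a b
  proof -
    have "K0_rel C #>\<^bsub>?G\<^esub> (a + b) = (K0_rel C #>\<^bsub>?G\<^esub> a) \<otimes>\<^bsub>K0 C\<^esub> (K0_rel C #>\<^bsub>?G\<^esub> b)"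
      using N.rcos_sum[OF ab] by (simp add: K0_def FactGroup_def)
    then show ?thesis
      using hom_mult[OF Z(1) cl[OF ab(1)] cl[OF ab(2)]] hom_mult[OF Z'(1) cl[OF ab(1)] cl[OF ab(2)]]
      by (simp add: d_def)
  qed
  have d0: "d c = 0" if c: "c \<in> carrier ?G" for c
  proof -
    have "c \<in> carrier ?G \<and> d c = 0"
      using c unfolding carrier_free_Abelian_group_iff
    proof (induction rule: frag_induction)
      case zero
      show ?case using d_add[of 0 0] N.one_closed by simp
    next
      case (one x) then show ?case using eq[of x] by (simp add: d_def K0_class_def)
    next
      case (diff a b)
      then have ab: "a \<in> carrier ?G" "b \<in> carrier ?G" "a - b \<in> carrier ?G"
        using keys_diff[of a b] by auto
      then show ?case using d_add[of "a - b" b] diff by simp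
    qed
    then show ?thesis by simp
  qed
  show "Z x = Z' x" if "x \<in> carrier (K0 C)" for x
    using that d0 unfolding K0_def carrier_FactGroup d_def by auto
qed

end

lemma inner_cis: "inner (cis a) (cis b) = cos (b - a)"
  by (simp add: inner_complex_def cos_diff)

lemma inner_cis_orthogonal: "inner (cis (pi * (\<phi> + 1/2))) (cis (pi * \<psi>)) = sin (pi * (\<psi> - \<phi>))"
proof -
  have "pi * \<psi> - pi * (\<phi> + 1/2) = - (pi / 2 - pi * (\<psi> - \<phi>))" by (simp add: algebra_simps)
  then show ?thesis unfolding inner_cis by (simp only: cos_minus sin_cos_eq of_real_eq_id id_apply)
qed

text \<open>
  A slicing with a compatible additive function \<open>z\<close> on objects: a stability condition up to the
  encoding of \<open>z\<close> as a homomorphism on \<open>K\<^sub>0\<close>.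
\<close>

locale stable_category = slicing_category +
  fixes z :: "'a \<Rightarrow> complex"
  assumes z_tri: "tri C X Y W \<Longrightarrow> z Y = z X + z W"
    and z_phase: "\<lbrakk>E \<in> P \<phi>; \<not> is_zero C E\<rbrakk> \<Longrightarrow> \<exists>m>0. z E = of_real m * cis (pi * \<phi>)"
begin

lemma z_zero: "is_zero C E \<Longrightarrow> z E = 0"
  using z_tri[OF tri_zero_right[of E E]] is_zero_Obj by simp

lemma z_phase': "E \<in> P \<phi> \<Longrightarrow> z E = of_real (norm (z E)) * cis (pi * \<phi>)"
  using z_phase[of E \<phi>] z_zero[of E] by (cases "is_zero C E") (auto simp: norm_mult)

text \<open>
  If \<open>u\<close> has inner product at least \<open>\<kappa>\<close> with all directions of phases in \<open>J\<close>, then bounds relative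
  to \<open>|z|\<close> on semistables add up along filtrations to bounds relative to \<open>\<langle>u, z\<rangle>\<close> on \<open>P J\<close>.
\<close>

lemma slices_inner_bound:
  fixes v :: "'a \<Rightarrow> 'c::real_normed_vector"
  assumes E: "E \<in> slices C P J" and u: "\<And>\<phi>. \<phi> \<in> J \<Longrightarrow> \<kappa> \<le> inner u (cis (pi * \<phi>))"
    and v_tri: "\<And>X Y W. tri C X Y W \<Longrightarrow> v Y = v X + v W"
    and v: "\<And>\<phi> A. \<phi> \<in> J \<Longrightarrow> A \<in> P \<phi> \<Longrightarrow> norm (v A) \<le> \<eta> * norm (z A)" and "0 \<le> \<eta>" "0 \<le> \<kappa>"
  shows "norm (v E) * \<kappa> \<le> \<eta> * inner u (z E)"
  using E
proof (induction rule: slices_induct)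
  case (base \<phi> A)
  have "inner u (z A) = inner u (norm (z A) *\<^sub>R cis (pi * \<phi>))"
    using z_phase'[OF base(2)] by (simp add: scaleR_conv_of_real)
  then have "inner u (z A) = norm (z A) * inner u (cis (pi * \<phi>))" by simp
  then have "norm (z A) * \<kappa> \<le> inner u (z A)" using u[OF base(1)] by (simp add: mult_left_mono)
  then have "\<eta> * (norm (z A) * \<kappa>) \<le> \<eta> * inner u (z A)" using \<open>0 \<le> \<eta>\<close> by (rule mult_left_mono)
  moreover have "norm (v A) * \<kappa> \<le> \<eta> * norm (z A) * \<kappa>" using v[OF base] \<open>0 \<le> \<kappa>\<close> by (rule mult_right_mono)
  ultimately show ?case by (simp add: mult.assoc)
next
  case (ext X Y Z)
  have "norm (v Y) * \<kappa> \<le> (norm (v X) + norm (v Z)) * \<kappa>"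
    unfolding v_tri[OF ext(1)] using norm_triangle_ineq \<open>0 \<le> \<kappa>\<close> by (intro mult_right_mono)
  then show ?case using ext z_tri[OF ext(1)] by (simp add: inner_add_right algebra_simps)
qed

lemma slices_inner_nonneg:
  assumes "E \<in> slices C P J" "\<And>\<phi>. \<phi> \<in> J \<Longrightarrow> 0 \<le> inner u (cis (pi * \<phi>))"
  shows "0 \<le> inner u (z E)"
  using slices_inner_bound[OF assms(1), of 0 u "\<lambda>_. 0 :: real" 1] assms(2) by simp

lemma slices_inner_lower:
  assumes E: "E \<in> slices C P J" and u: "\<And>\<phi>. \<phi> \<in> J \<Longrightarrow> \<kappa> \<le> inner u (cis (pi * \<phi>))"
    and k: "\<And>\<phi> A. \<phi> \<in> J \<Longrightarrow> A \<in> P \<phi> \<Longrightarrow> \<not> is_zero C A \<Longrightarrow> k \<le> norm (z A)" and "0 \<le> k" "0 \<le> \<kappa>"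
    and nz: "\<not> is_zero C E"
  shows "k * \<kappa> \<le> inner u (z E)"
proof -
  have "is_zero C E \<or> k * \<kappa> \<le> inner u (z E)"
    using E
  proof (induction rule: slices_induct)
    case (base \<phi> A)
    have "inner u (z A) = inner u (norm (z A) *\<^sub>R cis (pi * \<phi>))"
      using z_phase'[OF base(2)] by (simp add: scaleR_conv_of_real)
    then have *: "inner u (z A) = norm (z A) * inner u (cis (pi * \<phi>))" by simp
    have "k * \<kappa> \<le> norm (z A) * inner u (cis (pi * \<phi>))" if "\<not> is_zero C A"
      using u[OF base(1)] k[OF base that] assms(4,5) by (intro mult_mono) auto
    then show ?case using * by auto
  next
    case (ext X Y Z)
    have "0 \<le> k * \<kappa>" using assms by simp
    then show ?case
      using ext z_tri[OF ext(1)] z_zero[of X] z_zero[of Z] tri_zero2[OF ext(1)] by (auto simp: inner_add_right)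
  qed
  then show ?thesis using nz by blast
qed

lemma slices_inner_pos:
  assumes E: "E \<in> slices C P J" and u: "\<And>\<phi>. \<phi> \<in> J \<Longrightarrow> 0 < inner u (cis (pi * \<phi>))"
    and nz: "\<not> is_zero C E"
  shows "0 < inner u (z E)"
proof -
  have "is_zero C E \<or> 0 < inner u (z E)"
    using E
  proof (induction rule: slices_induct)
    case (base \<phi> A)
    have "inner u (z A) = inner u (norm (z A) *\<^sub>R cis (pi * \<phi>))"
      using z_phase'[OF base(2)] by (simp add: scaleR_conv_of_real)
    then have *: "inner u (z A) = norm (z A) * inner u (cis (pi * \<phi>))" by simp
    have "0 < norm (z A)" if "\<not> is_zero C A"
      using z_phase[OF base(2) that] by (auto simp: norm_mult)
    then show ?case using * u[OF base(1)] by (metis mult_pos_pos)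
  next
    case (ext X Y Z)
    then show ?case
      using z_tri[OF ext(1)] z_zero[of X] z_zero[of Z] tri_zero2[OF ext(1)] by (auto simp: inner_add_right)
  qed
  then show ?thesis using nz by blast
qed

lemma hn_heart_slices: "hn C P J E \<Longrightarrow> J \<subseteq> I \<Longrightarrow> I \<noteq> {} \<Longrightarrow> E \<in> slices C P I"
  using hn_imp_slices hn_mono by metis

end

lemma stability_condition_category:
  assumes "triangulated_category C" "stability_condition C \<sigma>"
  shows "stable_category C (snd \<sigma>) (\<lambda>E. fst \<sigma> (K0_class C E))"
proof -
  obtain Z P where \<sigma>: "\<sigma> = (Z, P)" by (cases \<sigma>)
  have Z: "Z \<in> hom (K0 C) complex_add" and P: "slicing C P" and
    ph: "\<forall>\<phi>. \<forall>E\<in>P \<phi>. \<not> is_zero C E \<longrightarrow> (\<exists>m>0. Z (K0_class C E) = of_real m * exp (\<i> * of_real pi * of_real \<phi>))"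
    using assms(2) unfolding \<sigma> stability_condition_def by simp_all
  interpret slicing_category C P by (rule slicing_imp_category[OF assms(1) P])
  show ?thesis
    unfolding \<sigma> fst_conv snd_conv
  proof unfold_locales
    show "Z (K0_class C Y) = Z (K0_class C X) + Z (K0_class C W)" if "tri C X Y W" for X Y W
      by (rule charge_tri[OF Z that])
    show "\<exists>m>0. Z (K0_class C E) = of_real m * cis (pi * \<phi>)" if "E \<in> P \<phi>" "\<not> is_zero C E" for E \<phi>
      using ph that by (simp add: cis_conv_exp mult.assoc)
  qed
qed

lemma (in stable_category) stability_condition_exists:
  obtains Z where "stability_condition C (Z, P)" "\<And>E. E \<in> Obj C \<Longrightarrow> Z (K0_class C E) = z E"
proof -
  obtain Z where Z: "Z \<in> hom (K0 C) complex_add" "Z \<in> extensional (carrier (K0 C))"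
    "\<And>E. E \<in> Obj C \<Longrightarrow> Z (K0_class C E) = z E"
    using charge_exists[of z] z_tri by blast
  have "\<exists>m>0. Z (K0_class C E) = of_real m * exp (\<i> * of_real pi * of_real \<phi>)" if "E \<in> P \<phi>" "\<not> is_zero C E" for E \<phi>
    using z_phase[OF that] Z(3)[OF P_Obj[OF that(1)]] by (simp add: cis_conv_exp mult.assoc)
  then have "stability_condition C (Z, P)"
    unfolding stability_condition_def using Z slicing by simp
  then show thesis using that Z(3) by blast
qed

subsection \<open>Heart and central charge determine the slicing\<close>

text \<open>
  A semistable object of one slicing is cut at its phase \<open>\<phi>\<close> for the other slicing. The parts lie in the
  common heart, so semistability puts their charges on one side of the line of phase \<open>\<phi>\<close> and the cut puts them on the other.
\<close>

lemma semistable_in_other_slicing: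
  assumes "stable_category C P z" "stable_category C P' z"
    and heart: "slices C P {0<..1} = slices C P' {0<..1}"
    and \<phi>: "0 < \<phi>" "\<phi> \<le> 1" and E: "E \<in> P \<phi>"
  shows "E \<in> P' \<phi>"
proof -
  interpret P: stable_category C P z by fact
  interpret P': stable_category C P' z by fact
  have ne: "{0<..1::real} \<noteq> {}" by simp
  have oE: "E \<in> Obj C" by (rule P.P_Obj[OF E])
  have "E \<in> slices C P' {0<..1}" unfolding heart[symmetric] by (rule P.slices_P[OF E]) (use \<phi> in simp)
  then have h: "hn C P' {0<..1} E" by (intro P'.slices_imp_hn) simp
  have sinpos: "0 < inner (cis (pi * (\<phi> + 1/2))) (cis (pi * \<psi>))" if "\<phi> < \<psi>" "\<psi> < \<phi> + 1" for \<psi>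
    unfolding inner_cis_orthogonal using that by (intro sin_gt_zero) simp_all
  have sinneg: "inner (cis (pi * (\<phi> + 1/2))) (cis (pi * \<psi>)) < 0" if "\<psi> < \<phi>" "\<phi> < \<psi> + 1" for \<psi>
  proof -
    have "0 < sin (pi * (\<phi> - \<psi>))" using that by (intro sin_gt_zero) simp_all
    moreover have "pi * (\<psi> - \<phi>) = - (pi * (\<phi> - \<psi>))" by (simp add: algebra_simps)
    ultimately show ?thesis unfolding inner_cis_orthogonal by (simp only: sin_minus)
  qed
  have sin0: "inner (cis (pi * (\<phi> + 1/2))) (cis (pi * \<phi>)) = 0"
    unfolding inner_cis_orthogonal by simp
  \<comment> \<open>The part of phase above \<open>\<phi>\<close> vanishes: as a subobject of \<open>E\<close> in the heart it has charge of phase at most \<open>\<phi>\<close>.\<close>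
  have h1: "hn C P' ({0<..1} \<inter> {..\<phi>}) E"
  proof -
    obtain A B where AB: "tri C A E B" "hn C P' ({0<..1} \<inter> {\<phi><..}) A" "hn C P' ({0<..1} - {\<phi><..}) B"
      using P'.hn_cut[OF h, of "{\<phi><..}"] by auto
    have hA: "A \<in> slices C P {0<..1}" and hB: "B \<in> slices C P {0<..1}"
      unfolding heart by (rule P'.hn_heart_slices[OF AB(2)] P'.hn_heart_slices[OF AB(3)]; simp)+
    have oA: "A \<in> Obj C" "B \<in> Obj C" using P.tri_Obj[OF AB(1)] by auto
    have "A \<in> slices C P {..\<phi>}"
      unfolding P.slices_atMost
    proof (intro conjI allI impI ballI oA)
      fix \<psi> W assume \<psi>: "\<phi> < \<psi>" and W: "W \<in> P \<psi>"
      have "Sh C W \<in> P (\<psi> + 1)" using P.P_Sh[OF P.P_Obj[OF W]] W by simp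
      then have "Sh C W \<in> slices C P {\<psi> + 1}" by (rule P.slices_P) simp
      then have "orth C (Sh C W) B" using hB by (rule P.slices_orth) (use \<phi> \<psi> in auto)
      moreover have "orth C W E" by (rule P.P_orth[OF \<psi> W E])
      ultimately show "orth C W A" using P.tri_orth_left1[OF AB(1) P.P_Obj[OF W]] by blast
    qed
    then have "A \<in> slices C P {0<..\<phi>}"
      using hA \<phi> by (simp add: P.slices_greaterThanAtMost)
    then have "0 \<le> inner (- cis (pi * (\<phi> + 1/2))) (z A)"
      by (rule P.slices_inner_nonneg) (use sinneg sin0 \<phi> in \<open>force simp: order.order_iff_strict\<close>)
    moreover have "0 < inner (cis (pi * (\<phi> + 1/2))) (z A)" if "\<not> is_zero C A"
    proof (rule P'.slices_inner_pos[OF P'.hn_imp_slices[OF AB(2)] _ that])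
      show "{0<..1} \<inter> {\<phi><..} \<noteq> {}"
      proof
        assume e: "{0<..1} \<inter> {\<phi><..} = {}"
        have "hn C P' {} A" using AB(2) unfolding e .
        then show False using that by cases auto
      qed
      show "0 < inner (cis (pi * (\<phi> + 1/2))) (cis (pi * \<psi>))" if "\<psi> \<in> {0<..1} \<inter> {\<phi><..}" for \<psi>
        using that \<phi> by (intro sinpos) auto
    qed
    ultimately have "is_zero C A" by fastforce
    then have "isomorphic C B E" using P.isomorphic_sym P.tri_zero_imp_iso'[OF AB(1)] by blast
    moreover have "{0<..1} - {\<phi><..} = {0<..1} \<inter> {..\<phi>}" by auto
    ultimately show ?thesis using P'.hn_iso AB(3) by simp
  qed
  have "hn C P' ({0<..1} \<inter> {..\<phi>} \<inter> {\<phi>..}) E"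
  proof -
    let ?J = "{0<..1} \<inter> {..\<phi>}"
    obtain A B where AB: "tri C A E B" "hn C P' (?J \<inter> {\<phi>..}) A" "hn C P' (?J - {\<phi>..}) B"
      using P'.hn_cut[OF h1, of "{\<phi>..}"] by auto
    have hA: "A \<in> slices C P {0<..1}" and hB: "B \<in> slices C P {0<..1}"
      unfolding heart by (rule P'.hn_heart_slices[OF AB(2)] P'.hn_heart_slices[OF AB(3)]; auto)+
    have oA: "A \<in> Obj C" "B \<in> Obj C" using P.tri_Obj[OF AB(1)] by auto
    have "B \<in> slices C P {\<phi>..}"
      unfolding P.slices_atLeast
    proof (intro conjI allI impI ballI oA)
      fix \<psi> W assume \<psi>: "\<psi> < \<phi>" and W: "W \<in> P \<psi>"
      have "W \<in> slices C P {\<psi>}" by (rule P.slices_P[OF W]) simp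
      then have "orth C (Sh C A) W" by (rule P.slices_orth[OF P.slices_Sh[OF hA]]) (use \<phi> \<psi> in auto)
      moreover have "orth C E W" by (rule P.P_orth[OF \<psi> E W])
      ultimately show "orth C B W" using P.tri_orth_right3[OF AB(1) P.P_Obj[OF W]] by blast
    qed
    then have "B \<in> slices C P {\<phi>..1}"
      using hB \<phi> by (simp add: P.slices_atLeastAtMost P.slices_greaterThanAtMost)
    then have "0 \<le> inner (cis (pi * (\<phi> + 1/2))) (z B)"
      by (rule P.slices_inner_nonneg) (use sinpos sin0 \<phi> in \<open>force simp: order.order_iff_strict\<close>)
    moreover have "0 < inner (- cis (pi * (\<phi> + 1/2))) (z B)" if "\<not> is_zero C B"
    proof (rule P'.slices_inner_pos[OF P'.hn_imp_slices[OF AB(3)] _ that])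
      show "?J - {\<phi>..} \<noteq> {}"
      proof
        assume e: "?J - {\<phi>..} = {}"
        have "hn C P' {} B" using AB(3) unfolding e .
        then show False using that by cases auto
      qed
      show "0 < inner (- cis (pi * (\<phi> + 1/2))) (cis (pi * \<psi>))" if "\<psi> \<in> ?J - {\<phi>..}" for \<psi>
        using that \<phi> sinneg[of \<psi>] by auto
    qed
    ultimately have "is_zero C B" by fastforce
    then have "isomorphic C A E" using P.tri_zero_imp_iso[OF AB(1)] by blast
    then show ?thesis using P'.hn_iso AB(2) by simp
  qed
  moreover have "{0<..1} \<inter> {..\<phi>} \<inter> {\<phi>..} = {\<phi>}" using \<phi> by auto
  ultimately have "E \<in> slices C P' {\<phi>}" using P'.hn_imp_slices[of "{\<phi>}" E] by simp
  then show ?thesis by (simp add: P'.slices_singleton)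
qed

lemma int_periodic:
  assumes "\<And>x::real. f (x + 1) \<longleftrightarrow> f x" shows "f (x + of_int k) \<longleftrightarrow> f x"
proof (induction k rule: int_induct[where k = 0])
  case (step1 i)
  then show ?case using assms[of "x + of_int i"] by (simp add: algebra_simps)
next
  case (step2 i)
  then show ?case using assms[of "x + of_int (i - 1)"] by (simp add: algebra_simps)
qed simp

text \<open>
  By the shift only phases in \<open>(0, 1]\<close> matter.
\<close>

lemma slicing_determined_by_heart:
  assumes "stable_category C P z" "stable_category C P' z"
    and heart: "slices C P {0<..1} = slices C P' {0<..1}"
  shows "P = P'"
proof
  interpret P: stable_category C P z by fact
  interpret P': stable_category C P' z by fact
  fix \<phi> :: real
  have per: "P (\<psi> + 1) = P' (\<psi> + 1) \<longleftrightarrow> P \<psi> = P' \<psi>" for \<psi>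
  proof
    assume e: "P (\<psi> + 1) = P' (\<psi> + 1)"
    have "A \<in> P \<psi> \<longleftrightarrow> A \<in> P' \<psi>" for A
      using P.P_Sh[of A \<psi>] P'.P_Sh[of A \<psi>] P.P_Obj[of A \<psi>] P'.P_Obj[of A \<psi>] unfolding e by metis
    then show "P \<psi> = P' \<psi>" by auto
  next
    assume e: "P \<psi> = P' \<psi>"
    have "A \<in> P (\<psi> + 1) \<longleftrightarrow> A \<in> P' (\<psi> + 1)" for A
      using P.P_unshift[of A "\<psi> + 1"] P'.P_unshift[of A "\<psi> + 1"] P.P_Obj[of A "\<psi> + 1"]
        P'.P_Obj[of A "\<psi> + 1"] unfolding add_diff_cancel_right' e by metis
    then show "P (\<psi> + 1) = P' (\<psi> + 1)" by auto
  qed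
  define k where "k = \<lceil>\<phi>\<rceil> - 1"
  have k: "0 < \<phi> - of_int k" "\<phi> - of_int k \<le> 1" using ceiling_correct[of \<phi>] unfolding k_def by auto
  have "P (\<phi> - of_int k) = P' (\<phi> - of_int k)"
    using semistable_in_other_slicing[OF assms k] semistable_in_other_slicing[OF assms(2,1) heart[symmetric] k] by auto
  then show "P \<phi> = P' \<phi>" using int_periodic[of "\<lambda>x. P x = P' x", OF per, of "\<phi> - of_int k" k] by simp
qed

section \<open>Refining a chain of t-structures to a stability condition\<close>

text \<open>
  The coarse data: cut points \<open>c n\<close> with gaps less than \<open>1\<close> and period \<open>2\<close>, and for each \<open>n\<close> a
  t-structure with aisle \<open>U n\<close> (to be \<open>P(> c n)\<close>) and coaisle \<open>V n\<close> (to be \<open>P(\<le> c n)\<close>).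
  On a nonzero object of \<open>U n \<inter> V (n + 1)\<close> the charge lies in the sector of the cell
  \<open>(c n, c (n + 1)]\<close> and is bounded away from \<open>0\<close>.
\<close>

locale t_structure_chain = triangulated_category +
  fixes U V :: "int \<Rightarrow> 'a set" and c :: "int \<Rightarrow> real" and z :: "'a \<Rightarrow> complex" and k :: real
  assumes U_Obj: "E \<in> U n \<Longrightarrow> E \<in> Obj C" and V_Obj: "E \<in> V n \<Longrightarrow> E \<in> Obj C"
    and U_iso: "\<lbrakk>E \<in> U n; isomorphic C E E'\<rbrakk> \<Longrightarrow> E' \<in> U n"
    and V_iso: "\<lbrakk>E \<in> V n; isomorphic C E E'\<rbrakk> \<Longrightarrow> E' \<in> V n"
    and UV_orth: "\<lbrakk>X \<in> U n; Y \<in> V n\<rbrakk> \<Longrightarrow> orth C X Y"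
    and UV_cut: "E \<in> Obj C \<Longrightarrow> \<exists>X\<in>U n. \<exists>Y\<in>V n. tri C X E Y"
    and U_Suc: "U (n + 1) \<subseteq> U n" and V_Suc: "V n \<subseteq> V (n + 1)"
    and U_Sh: "E \<in> U n \<Longrightarrow> Sh C E \<in> U (n + 2)" and V_unshift: "E \<in> V n \<Longrightarrow> unshift C E \<in> V (n - 2)"
    and V_Sh: "E \<in> V n \<Longrightarrow> Sh C E \<in> V (n + 2)" and U_unshift: "E \<in> U n \<Longrightarrow> unshift C E \<in> U (n - 2)"
    and UV_bounded: "E \<in> Obj C \<Longrightarrow> \<exists>n m. E \<in> U n \<and> E \<in> V m"
    and c_less: "c n < c (n + 1)" and c_gap: "c (n + 1) < c n + 1" and c_per: "c (n + 2) = c n + 1"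
    and z_tri: "tri C X Y W \<Longrightarrow> z Y = z X + z W"
    and k_pos: "0 < k"
    and z_sector: "\<lbrakk>E \<in> U n; E \<in> V (n + 1); \<not> is_zero C E\<rbrakk>
      \<Longrightarrow> \<exists>m\<ge>k. \<exists>\<phi>. c n < \<phi> \<and> \<phi> \<le> c (n + 1) \<and> z E = of_real m * cis (pi * \<phi>)"
begin

lemma U_mono: "n \<le> m \<Longrightarrow> U m \<subseteq> U n"
  by (induction m rule: int_ge_induct) (use U_Suc in blast)+

lemma V_mono: "n \<le> m \<Longrightarrow> V n \<subseteq> V m"
  by (induction m rule: int_ge_induct) (use V_Suc in blast)+

lemma U_iff: "X \<in> U n \<longleftrightarrow> X \<in> Obj C \<and> (\<forall>Y\<in>V n. orth C X Y)"
proof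
  assume X: "X \<in> Obj C \<and> (\<forall>Y\<in>V n. orth C X Y)"
  obtain A B where AB: "A \<in> U n" "B \<in> V n" "tri C A X B" using UV_cut[of X n] X by blast
  have "Sh C A \<in> U n" using U_Sh[OF AB(1)] U_mono[of n "n + 2"] by auto
  then have "orth C (Sh C A) B" using UV_orth AB(2) by blast
  then have "is_zero C B" using tri_zero3[OF AB(3)] X AB(2) by blast
  then show "X \<in> U n" using tri_zero_imp_iso[OF AB(3)] U_iso AB(1) by blast
qed (auto intro: U_Obj UV_orth)

lemma V_iff: "Y \<in> V n \<longleftrightarrow> Y \<in> Obj C \<and> (\<forall>X\<in>U n. orth C X Y)"
proof
  assume Y: "Y \<in> Obj C \<and> (\<forall>X\<in>U n. orth C X Y)"
  obtain A B where AB: "A \<in> U n" "B \<in> V n" "tri C A Y B" using UV_cut[of Y n] Y by blast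
  have "Sh C A \<in> U n" using U_Sh[OF AB(1)] U_mono[of n "n + 2"] by auto
  then have "orth C (Sh C A) B" using UV_orth AB(2) by blast
  then have "is_zero C A" using tri_zero1[OF AB(3)] Y AB(1) by blast
  then show "Y \<in> V n" using tri_zero_imp_iso'[OF AB(3)] isomorphic_sym V_iso AB(2) by blast
qed (auto intro: V_Obj UV_orth)

lemma c_mono: "n < m \<Longrightarrow> c n < c m"
  by (induction m rule: int_gr_induct) (use c_less order.strict_trans in blast)+

lemma c_mono_le: "n \<le> m \<Longrightarrow> c n \<le> c m"
  using c_mono[of n m] by (cases "n = m") auto

lemma c_Sh: "c (n + 2 * j) = c n + of_int j"
proof (induction j rule: int_induct[where k = 0])
  case (step1 i) then show ?case using c_per[of "n + 2 * i"] by (simp add: algebra_simps)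
next
  case (step2 i) then show ?case using c_per[of "n + 2 * (i - 1)"] by (simp add: algebra_simps)
qed simp

lemma U_mid:
  assumes T: "tri C X Y Z" "X \<in> U n" "Z \<in> U n" shows "Y \<in> U n"
proof -
  have "orth C Y W" if W: "W \<in> V n" for W
    by (rule tri_orth_right[OF T(1) V_Obj[OF W] UV_orth[OF T(2) W] UV_orth[OF T(3) W]])
  then show ?thesis using tri_Obj(2)[OF T(1)] unfolding U_iff[of Y] by simp
qed

lemma V_mid:
  assumes T: "tri C X Y Z" "X \<in> V n" "Z \<in> V n" shows "Y \<in> V n"
proof -
  have "orth C W Y" if W: "W \<in> U n" for W
    by (rule tri_orth_left[OF T(1) U_Obj[OF W] UV_orth[OF W T(2)] UV_orth[OF W T(3)]])
  then show ?thesis using tri_Obj(2)[OF T(1)] unfolding V_iff[of Y] by simp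
qed

lemma U_cone: "\<lbrakk>tri C X Y Z; Y \<in> U n; X \<in> U (n - 2)\<rbrakk> \<Longrightarrow> Z \<in> U n"
  using U_mid[OF tri_rot] U_Sh[of X "n - 2"] by simp

lemma V_cocone: "\<lbrakk>tri C X Y Z; Y \<in> V n; Z \<in> V (n + 2)\<rbrakk> \<Longrightarrow> X \<in> V n"
  using V_mid[OF tri_unshift] V_unshift[of Z "n + 2"] by simp

lemma U_zero: "is_zero C E \<Longrightarrow> E \<in> U n" and V_zero: "is_zero C E \<Longrightarrow> E \<in> V n"
  using orth_zero is_zero_Obj V_Obj U_Obj by (simp_all add: U_iff[of E] V_iff[of E])

lemma z_zero: "is_zero C E \<Longrightarrow> z E = 0"
  using z_tri[OF tri_zero_right[of E E]] is_zero_Obj by simp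

lemma z_Sh: "E \<in> Obj C \<Longrightarrow> z (Sh C E) = - z E"
proof -
  assume E: "E \<in> Obj C"
  obtain O' where O': "is_zero C O'" using ex_zero by blast
  show ?thesis using z_tri[OF tri_rot[OF tri_zero_right[OF E O']]] z_zero[OF O'] by (simp add: eq_neg_iff_add_eq_0 add.commute)
qed

definition cell :: "int \<Rightarrow> 'a set" where "cell n = U n \<inter> V (n + 1)"

definition cell_index :: "real \<Rightarrow> int" where
  "cell_index \<phi> = (THE n. c n < \<phi> \<and> \<phi> \<le> c (n + 1))"

lemma cell_index_unique:
  assumes "c n < \<phi>" "\<phi> \<le> c (n + 1)" "c m < \<phi>" "\<phi> \<le> c (m + 1)" shows "n = m"
  using assms c_mono_le[of "n + 1" m] c_mono_le[of "m + 1" n] by (cases n m rule: linorder_cases) auto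

lemma cell_index_eq: "c n < \<phi> \<Longrightarrow> \<phi> \<le> c (n + 1) \<Longrightarrow> cell_index \<phi> = n"
  unfolding cell_index_def using cell_index_unique by (intro the_equality) auto

lemma cell_index_exists: "\<exists>n. c n < \<phi> \<and> \<phi> \<le> c (n + 1)"
proof -
  define j where "j = \<lceil>\<phi> - c 0\<rceil> - 1"
  have "real_of_int j = of_int \<lceil>\<phi> - c 0\<rceil> - 1" unfolding j_def by simp
  then have "c 0 + of_int j < \<phi>" "\<phi> \<le> c 0 + of_int j + 1" using ceiling_correct[of "\<phi> - c 0"] by linarith+
  then have j: "c (2 * j) < \<phi>" "\<phi> \<le> c (2 * j + 2)" using c_Sh[of 0 j] c_per[of "2 * j"] by simp_all
  show ?thesis
  proof (cases "\<phi> \<le> c (2 * j + 1)")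
    case False then show ?thesis using j by (intro exI[of _ "2 * j + 1"]) (simp add: add.assoc)
  qed (use j in blast)
qed

lemma cell_index: "c (cell_index \<phi>) < \<phi>" "\<phi> \<le> c (cell_index \<phi> + 1)"
  using cell_index_exists[of \<phi>] cell_index_eq by auto

lemma cell_index_Sh: "cell_index (\<phi> + 1) = cell_index \<phi> + 2"
proof (rule cell_index_eq)
  show "c (cell_index \<phi> + 2) < \<phi> + 1" using cell_index[of \<phi>] by (simp add: c_per)
  have "cell_index \<phi> + 2 + 1 = (cell_index \<phi> + 1) + 2" by simp
  then show "\<phi> + 1 \<le> c (cell_index \<phi> + 2 + 1)" using cell_index[of \<phi>] c_per[of "cell_index \<phi> + 1"] by simp
qed

lemma cell_index_mono: "\<phi> \<le> \<psi> \<Longrightarrow> cell_index \<phi> \<le> cell_index \<psi>"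
  using cell_index[of \<phi>] cell_index[of \<psi>] c_mono_le[of "cell_index \<psi> + 1" "cell_index \<phi>"] by fastforce

lemma cell_Obj: "E \<in> cell n \<Longrightarrow> E \<in> Obj C"
  unfolding cell_def using U_Obj by blast

lemma cell_orth: "\<lbrakk>X \<in> cell n; Y \<in> cell m; m < n\<rbrakk> \<Longrightarrow> orth C X Y"
  unfolding cell_def using UV_orth[of X n Y] V_mono[of "m + 1" n] by auto

lemma cell_mid: "\<lbrakk>tri C X Y Z; X \<in> cell n; Z \<in> cell n\<rbrakk> \<Longrightarrow> Y \<in> cell n"
  unfolding cell_def using U_mid V_mid by blast

lemma cell_zero: "is_zero C E \<Longrightarrow> E \<in> cell n"
  unfolding cell_def using U_zero V_zero by blast

lemma cell_iso: "E \<in> cell n \<Longrightarrow> isomorphic C E E' \<Longrightarrow> E' \<in> cell n"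
  unfolding cell_def using U_iso V_iso by blast

lemma cell_Sh: "E \<in> Obj C \<Longrightarrow> Sh C E \<in> cell (n + 2) \<longleftrightarrow> E \<in> cell n"
proof -
  assume E: "E \<in> Obj C"
  have "Sh C E \<in> V (n + 1 + 2) \<longleftrightarrow> E \<in> V (n + 1)"
    using V_Sh[of E "n + 1"] V_unshift[of "Sh C E" "n + 1 + 2"] E unfolding add_diff_cancel_right' by auto
  moreover have "Sh C E \<in> U (n + 2) \<longleftrightarrow> E \<in> U n"
    using U_Sh[of E n] U_unshift[of "Sh C E" "n + 2"] E unfolding add_diff_cancel_right' by auto
  moreover have "n + 2 + 1 = n + 1 + 2" by simp
  ultimately show ?thesis unfolding cell_def by simp
qed

text \<open>
  \<open>height \<phi> E\<close> is the component of \<open>z E\<close> orthogonal to the direction of phase \<open>\<phi>\<close>. On a cell its sign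
  tells whether the phase of \<open>E\<close> is larger than \<open>\<phi>\<close>.
\<close>

definition height :: "real \<Rightarrow> 'a \<Rightarrow> real" where
  "height \<phi> E = inner (cis (pi * (\<phi> + 1/2))) (z E)"

definition semistable :: "real \<Rightarrow> 'a set" where
  "semistable \<phi> = {E \<in> cell (cell_index \<phi>). height \<phi> E = 0 \<and>
     (\<forall>A B. tri C A E B \<longrightarrow> A \<in> cell (cell_index \<phi>) \<longrightarrow> B \<in> cell (cell_index \<phi>) \<longrightarrow> height \<phi> A \<le> 0)}"

lemma height_tri: "tri C X Y W \<Longrightarrow> height \<phi> Y = height \<phi> X + height \<phi> W"
  unfolding height_def by (simp add: z_tri inner_add_right)

lemma height_zero: "is_zero C E \<Longrightarrow> height \<phi> E = 0"
  unfolding height_def by (simp add: z_zero)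

lemma height_cis: "z E = of_real m * cis (pi * \<psi>) \<Longrightarrow> height \<phi> E = m * sin (pi * (\<psi> - \<phi>))"
proof -
  assume "z E = of_real m * cis (pi * \<psi>)"
  then have "height \<phi> E = inner (cis (pi * (\<phi> + 1/2))) (m *\<^sub>R cis (pi * \<psi>))"
    unfolding height_def by (simp add: scaleR_conv_of_real)
  then show ?thesis unfolding inner_scaleR_right inner_cis_orthogonal .
qed

lemma height_Sh: "E \<in> Obj C \<Longrightarrow> height (\<phi> + 1) (Sh C E) = height \<phi> E"
proof -
  assume "E \<in> Obj C"
  moreover have "pi * (\<phi> + 1 + 1 / 2) = pi * (\<phi> + 1 / 2) + pi" by (simp add: algebra_simps)
  then have "cis (pi * (\<phi> + 1 + 1 / 2)) = - cis (pi * (\<phi> + 1 / 2))" by (simp only: cis_mult[symmetric] cis_pi) simp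
  ultimately show ?thesis unfolding height_def by (simp add: z_Sh)
qed

lemma sin_sign: "0 < x \<Longrightarrow> x < 1 \<Longrightarrow> 0 < sin (pi * x)" "- 1 < x \<Longrightarrow> x < 0 \<Longrightarrow> sin (pi * x) < 0" for x :: real
proof -
  show "0 < x \<Longrightarrow> x < 1 \<Longrightarrow> 0 < sin (pi * x)" by (intro sin_gt_zero) simp_all
  assume "- 1 < x" "x < 0"
  then have "pi * (- x) < pi * 1" by (intro mult_strict_left_mono) auto
  then have "0 < sin (pi * (- x))" using \<open>x < 0\<close> by (intro sin_gt_zero) (simp_all add: mult_less_0_iff)
  then show "sin (pi * x) < 0" by simp
qed

lemma cell_phase:
  assumes "E \<in> cell n" "\<not> is_zero C E"
  obtains m \<phi> where "k \<le> m" "c n < \<phi>" "\<phi> \<le> c (n + 1)" "z E = of_real m * cis (pi * \<phi>)"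
    "height \<phi> E = 0" "\<And>\<psi>. c n < \<psi> \<Longrightarrow> \<psi> \<le> c (n + 1) \<Longrightarrow> 0 < height \<psi> E \<longleftrightarrow> \<psi> < \<phi>"
    "\<And>\<psi>. c n < \<psi> \<Longrightarrow> \<psi> \<le> c (n + 1) \<Longrightarrow> height \<psi> E < 0 \<longleftrightarrow> \<phi> < \<psi>"
proof -
  obtain m \<phi> where m: "k \<le> m" and \<phi>: "c n < \<phi>" "\<phi> \<le> c (n + 1)" and z: "z E = of_real m * cis (pi * \<phi>)"
    using z_sector assms unfolding cell_def by blast
  have "0 < m" using m k_pos by simp
  have *: "height \<psi> E = m * sin (pi * (\<phi> - \<psi>))" for \<psi> by (rule height_cis[OF z])
  show thesis
  proof (rule that[OF m \<phi> z])
    show "height \<phi> E = 0" unfolding * by simp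
    fix \<psi> assume "c n < \<psi>" "\<psi> \<le> c (n + 1)"
    then have "\<phi> - \<psi> < 1" "- 1 < \<phi> - \<psi>" using \<phi> c_gap[of n] by linarith+
    then show "0 < height \<psi> E \<longleftrightarrow> \<psi> < \<phi>" "height \<psi> E < 0 \<longleftrightarrow> \<phi> < \<psi>"
      using sin_sign[of "\<phi> - \<psi>"] \<open>0 < m\<close> unfolding * zero_less_mult_iff mult_less_0_iff
      by (cases \<phi> \<psi> rule: linorder_cases; force)+
  qed
qed

text \<open>
  The projection of the charge to the middle direction of the cell: positive and bounded below,
  it is the measure by which Harder-Narasimhan filtrations are found.
\<close>

definition mass :: "int \<Rightarrow> 'a \<Rightarrow> real" where
  "mass n E = inner (cis (pi * ((c n + c (n + 1)) / 2))) (z E)"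

definition mass_unit :: "int \<Rightarrow> real" where
  "mass_unit n = k * cos (pi * ((c (n + 1) - c n) / 2))"

lemma mass_tri: "tri C X Y W \<Longrightarrow> mass n Y = mass n X + mass n W"
  unfolding mass_def by (simp add: z_tri inner_add_right)

lemma mass_unit_pos: "0 < mass_unit n"
proof -
  have "0 < cos (pi * ((c (n + 1) - c n) / 2))"
  proof (rule cos_gt_zero)
    show "0 < pi * ((c (n + 1) - c n) / 2)" using c_less[of n] by simp
    show "pi * ((c (n + 1) - c n) / 2) < pi / 2" using c_gap[of n] by simp
  qed
  then show ?thesis unfolding mass_unit_def using k_pos by simp
qed

lemma mass_lower: "E \<in> cell n \<Longrightarrow> \<not> is_zero C E \<Longrightarrow> mass_unit n \<le> mass n E"
proof -
  assume E: "E \<in> cell n" "\<not> is_zero C E"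
  obtain m \<phi> where m: "k \<le> m" and \<phi>: "c n < \<phi>" "\<phi> \<le> c (n + 1)" and z: "z E = of_real m * cis (pi * \<phi>)"
    by (rule cell_phase[OF E]) (rule that)
  define h where "h = (c (n + 1) - c n) / 2"
  have h: "0 < h" "h < 1/2" unfolding h_def using c_less[of n] c_gap[of n] by auto
  have "z E = m *\<^sub>R cis (pi * \<phi>)" using z by (simp add: scaleR_conv_of_real)
  then have "mass n E = m * cos (pi * \<phi> - pi * ((c n + c (n + 1)) / 2))"
    unfolding mass_def by (simp only: inner_scaleR_right inner_cis)
  also have "pi * \<phi> - pi * ((c n + c (n + 1)) / 2) = pi * (\<phi> - (c n + c (n + 1)) / 2)" by (simp add: algebra_simps)
  finally have e: "mass n E = m * cos (pi * (\<phi> - (c n + c (n + 1)) / 2))" .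
  have ab: "\<bar>pi * (\<phi> - (c n + c (n + 1)) / 2)\<bar> \<le> pi * h"
    unfolding abs_mult h_def using \<phi> by (intro mult_mono) (auto simp: abs_if field_simps)
  have "cos (pi * h) \<le> cos \<bar>pi * (\<phi> - (c n + c (n + 1)) / 2)\<bar>"
    using ab h pi_gt_zero by (intro cos_monotone_0_pi_le) (auto simp: mult_le_cancel_left1)
  then have 1: "cos (pi * h) \<le> cos (pi * (\<phi> - (c n + c (n + 1)) / 2))" by simp
  have 2: "0 < cos (pi * h)" using mass_unit_pos[of n] k_pos unfolding mass_unit_def h_def by (simp add: zero_less_mult_iff)
  have "mass_unit n \<le> m * cos (pi * (\<phi> - (c n + c (n + 1)) / 2))"
    unfolding mass_unit_def h_def[symmetric] using m 1 2 k_pos by (intro mult_mono) auto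
  then show ?thesis using e by simp
qed

subsection \<open>Maps between semistable objects\<close>

lemma semistableD:
  assumes "E \<in> semistable \<phi>"
  shows "E \<in> cell (cell_index \<phi>)" "height \<phi> E = 0"
    "\<And>A B. \<lbrakk>tri C A E B; A \<in> cell (cell_index \<phi>); B \<in> cell (cell_index \<phi>)\<rbrakk> \<Longrightarrow> height \<phi> A \<le> 0"
  using assms unfolding semistable_def by blast+

lemma height_previous_cell:
  assumes "E \<in> cell (n - 1)" "c n < \<phi>" "\<phi> \<le> c (n + 1)" shows "height \<phi> E \<le> 0"
proof (cases "is_zero C E")
  case False
  obtain m \<psi> where m: "k \<le> m" "c (n - 1) < \<psi>" "\<psi> \<le> c (n - 1 + 1)" "z E = of_real m * cis (pi * \<psi>)"
    by (rule cell_phase[OF assms(1) False]) (rule that)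
  have "n + 1 = n - 1 + 2" by simp
  then have "c (n + 1) = c (n - 1) + 1" using c_per[of "n - 1"] by metis
  then have "sin (pi * (\<psi> - \<phi>)) < 0" using m assms by (intro sin_sign) auto
  then show ?thesis using height_cis[OF m(4)] m(1) k_pos by (simp add: mult_nonneg_nonpos)
qed (simp add: height_zero)

text \<open>
  Image factorisation takes place in the heart \<open>U (n - 1) \<inter> V (n + 1)\<close>, of which the cell \<open>n\<close> is a
  torsion class: quotients of \<open>E\<close> stay in the cell, and the kernel \<open>K\<close> only loses its
  torsion-free part \<open>K''\<close>, which lies in the cell \<open>n - 1\<close> and so has smaller phase.
\<close>

lemma semistable_orth_same_cell:
  assumes E: "E \<in> semistable \<phi>" and E': "E' \<in> semistable \<phi>'" and less: "\<phi>' < \<phi>"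
    and same: "cell_index \<phi>' = cell_index \<phi>"
  shows "orth C E E'"
proof -
  define n where "n = cell_index \<phi>"
  note D = semistableD[OF E, folded n_def] and D' = semistableD[OF E', unfolded same, folded n_def]
  have ci: "c n < \<phi>" "\<phi> \<le> c (n + 1)" "c n < \<phi>'" "\<phi>' \<le> c (n + 1)"
    using cell_index[of \<phi>] cell_index[of \<phi>'] same unfolding n_def by auto
  have EU: "E \<in> U n" "E \<in> V (n + 1)" and E'U: "E' \<in> U n" "E' \<in> V (n + 1)" using D D' unfolding cell_def by auto
  have n1: "U n \<subseteq> U (n - 1)" using U_mono[of "n - 1" n] by simp
  show ?thesis
  proof (rule orthI)
    fix f assume f: "f \<in> Hom C E E'"
    obtain N g h where T: "Tri C E E' N f g h" using TR1_cone[OF U_Obj[OF EU(1)] U_Obj[OF E'U(1)] f] by blast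
    have tN: "tri C E E' N" using triI[OF T] .
    have N: "N \<in> U n" "N \<in> V (n + 3)"
    proof -
      show "N \<in> U n" using U_cone[OF tN E'U(1)] EU(1) U_mono[of "n - 2" n] by auto
      have "Sh C E \<in> V (n + 3)" using V_Sh[OF EU(2)] by (simp add: add.assoc)
      moreover have "E' \<in> V (n + 3)" using E'U(2) V_mono[of "n + 1" "n + 3"] by auto
      ultimately show "N \<in> V (n + 3)" using V_mid[OF tri_rot[OF tN]] by blast
    qed
    \<comment> \<open>Truncating the cone gives the cokernel \<open>Q\<close> and the shifted kernel \<open>N'\<close> of \<open>f\<close>, and \<open>I\<close> below is the image.\<close>
    obtain N' Q where Q: "N' \<in> U (n + 1)" "Q \<in> V (n + 1)" "tri C N' N Q"
      using UV_cut[of N "n + 1"] U_Obj[OF N(1)] by blast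
    have N'V: "N' \<in> V (n + 3)"
      using V_cocone[OF Q(3) N(2)] Q(2) V_mono[of "n + 1" "n + 3 + 2"] by auto
    obtain u v w where Q3: "Tri C N' N Q u v w" using Q(3) unfolding tri_def by blast
    obtain I m s l where img: "Tri C I E' Q m (v \<cdot> g) l" "s \<in> Hom C E I" "m \<cdot> s = f" and EI: "tri C E I N'"
      by (rule tri_image[OF T Q3])
    have I: "tri C I E' Q" "tri C E I N'" using triI[OF img(1)] EI by auto
    have IV: "I \<in> V (n + 1)"
      using V_cocone[OF I(1) E'U(2)] Q(2) V_mono[of "n + 1" "n + 1 + 2"] by auto
    have IU: "I \<in> U n" using U_mid[OF I(2) EU(1)] Q(1) U_Suc by blast
    have QU: "Q \<in> U n" using U_cone[OF I(1) E'U(1)] IU U_mono[of "n - 2" n] by auto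
    have Ic: "I \<in> cell n" and Qc: "Q \<in> cell n" using IV IU QU Q(2) unfolding cell_def by auto
    define K where "K = unshift C N'"
    have K: "tri C K E I" unfolding K_def by (rule tri_unshift[OF I(2)])
    have KU: "K \<in> U (n - 1)" using U_unshift[OF Q(1)] unfolding K_def by simp
    have "n + 3 - 2 = n + 1" by simp
    then have KV: "K \<in> V (n + 1)" using V_unshift[OF N'V] unfolding K_def by metis
    obtain K' K'' where KK: "K' \<in> U n" "K'' \<in> V n" "tri C K' K K''" using UV_cut[of K n] U_Obj[OF KU] by blast
    have K'V: "K' \<in> V (n + 1)" using V_cocone[OF KK(3) KV] KK(2) V_mono[of n "n + 1 + 2"] by auto
    have K''U: "K'' \<in> U (n - 1)" using U_cone[OF KK(3) KU] KK(1) U_mono[of "n - 1 - 2" n] by auto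
    have K'c: "K' \<in> cell n" and K''c: "K'' \<in> cell (n - 1)" using KK K'V K''U unfolding cell_def by auto
    obtain G where G: "tri C K' E G" "tri C K'' G I" using tri_octahedral[OF KK(3) K] by blast
    have GU: "G \<in> U n" using U_cone[OF G(1) EU(1)] KK(1) U_mono[of "n - 2" n] by auto
    have GV: "G \<in> V (n + 1)" using V_mid[OF G(2)] KK(2) V_Suc[of n] IV by blast
    have "G \<in> cell n" using GU GV unfolding cell_def by simp
    then have "height \<phi> K' \<le> 0" using D(3)[OF G(1) K'c] by simp
    moreover have "height \<phi> K'' \<le> 0" using height_previous_cell[OF K''c ci(1,2)] .
    ultimately have hI: "0 \<le> height \<phi> I" using height_tri[OF G(1), of \<phi>] height_tri[OF G(2), of \<phi>] D(2) by simp
    \<comment> \<open>As a quotient of \<open>E\<close> the image has phase at least \<open>\<phi>\<close>, as a subobject of \<open>E'\<close> at most \<open>\<phi>'\<close>.\<close>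
    have hI': "height \<phi>' I \<le> 0" using D'(3)[OF I(1) Ic Qc] .
    have "is_zero C I"
    proof (rule ccontr)
      assume nz: "\<not> is_zero C I"
      obtain \<psi> where "\<And>\<zeta>. c n < \<zeta> \<Longrightarrow> \<zeta> \<le> c (n + 1) \<Longrightarrow> 0 < height \<zeta> I \<longleftrightarrow> \<zeta> < \<psi>"
        "\<And>\<zeta>. c n < \<zeta> \<Longrightarrow> \<zeta> \<le> c (n + 1) \<Longrightarrow> height \<zeta> I < 0 \<longleftrightarrow> \<psi> < \<zeta>"
        by (rule cell_phase[OF Ic nz]) (rule that)
      then have "\<not> \<phi>' < \<psi>" "\<not> \<psi> < \<phi>" using hI hI' ci by (auto simp: not_less[symmetric])
      then show False using less by simp
    qed
    then have "s = Nul C E I" using img(2) U_Obj[OF EU(1)] unfolding is_zero_def by blast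
    then show "f = Nul C E E'"
      using img(3) Comp_Nul[of E I E' m] Tri_D[OF img(1)] U_Obj[OF EU(1)] by simp
  qed (use EU E'U U_Obj in auto)
qed

lemma preslicing_semistable: "preslicing C semistable"
proof unfold_locales
  show "E \<in> Obj C" if "E \<in> semistable \<phi>" for E \<phi> using semistableD(1)[OF that] cell_Obj by blast
  show "E' \<in> semistable \<phi>" if E: "E \<in> semistable \<phi>" and iso: "isomorphic C E E'" for E E' \<phi>
  proof -
    note D = semistableD[OF E]
    obtain O' where O': "is_zero C O'" using ex_zero by blast
    have "height \<phi> E' = height \<phi> E" using height_tri[OF tri_iso_right[OF iso O'], of \<phi>] height_zero[OF O'] by simp
    moreover have "height \<phi> A \<le> 0" if "tri C A E' B" "A \<in> cell (cell_index \<phi>)" "B \<in> cell (cell_index \<phi>)" for A B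
      using D(3)[OF tri_iso_middle[OF that(1) isomorphic_sym[OF iso]] that(2,3)] .
    ultimately show ?thesis using D(1,2) cell_iso[OF D(1) iso] unfolding semistable_def by auto
  qed
  show "Z \<in> semistable \<phi>" if Z: "is_zero C Z" for Z \<phi>
  proof -
    have "height \<phi> A \<le> 0" if A: "tri C A Z B" "A \<in> cell (cell_index \<phi>)" "B \<in> cell (cell_index \<phi>)" for A B
    proof -
      have "orth C A Z" using orth_zero(2)[OF Z] cell_Obj A(2) by blast
      moreover have "Sh C A \<in> cell (cell_index \<phi> + 2)" using cell_Sh[OF cell_Obj[OF A(2)]] A(2) by simp
      then have "orth C (Sh C A) B" by (rule cell_orth[OF _ A(3)]) simp
      ultimately show ?thesis using tri_zero1[OF A(1)] height_zero by simp
    qed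
    then show ?thesis using Z cell_zero height_zero unfolding semistable_def by auto
  qed
  show "orth C A B" if "\<phi>\<^sub>2 < \<phi>\<^sub>1" "A \<in> semistable \<phi>\<^sub>1" "B \<in> semistable \<phi>\<^sub>2" for \<phi>\<^sub>1 \<phi>\<^sub>2 A B
  proof (cases "cell_index \<phi>\<^sub>2 = cell_index \<phi>\<^sub>1")
    case True then show ?thesis using semistable_orth_same_cell that by blast
  next
    case False
    then have "cell_index \<phi>\<^sub>2 < cell_index \<phi>\<^sub>1" using cell_index_mono[of \<phi>\<^sub>2 \<phi>\<^sub>1] that(1) by simp
    then show ?thesis using cell_orth semistableD(1) that by blast
  qed
  show "Sh C A \<in> semistable (\<phi> + 1) \<longleftrightarrow> A \<in> semistable \<phi>" if A: "A \<in> Obj C" for A \<phi>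
  proof -
    let ?n = "cell_index \<phi>"
    have "(\<forall>X Y. tri C X (Sh C A) Y \<longrightarrow> X \<in> cell (?n + 2) \<longrightarrow> Y \<in> cell (?n + 2) \<longrightarrow> height (\<phi> + 1) X \<le> 0) \<longleftrightarrow>
      (\<forall>X Y. tri C X A Y \<longrightarrow> X \<in> cell ?n \<longrightarrow> Y \<in> cell ?n \<longrightarrow> height \<phi> X \<le> 0)" (is "?l \<longleftrightarrow> ?r")
    proof (intro iffI allI impI)
      fix X Y assume l: ?l and XY: "tri C X A Y" "X \<in> cell ?n" "Y \<in> cell ?n"
      have "Sh C X \<in> cell (?n + 2)" "Sh C Y \<in> cell (?n + 2)" using cell_Sh cell_Obj XY by simp_all
      then have "height (\<phi> + 1) (Sh C X) \<le> 0" using l tri_Sh[OF XY(1)] by blast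
      then show "height \<phi> X \<le> 0" using height_Sh cell_Obj[OF XY(2)] by simp
    next
      fix X Y assume r: ?r and XY: "tri C X (Sh C A) Y" "X \<in> cell (?n + 2)" "Y \<in> cell (?n + 2)"
      note o = tri_Obj[OF XY(1)]
      have "tri C (unshift C X) A (unshift C Y)"
        using tri_Sh_iff[of "unshift C X" A "unshift C Y"] XY(1) o A by simp
      moreover have "unshift C X \<in> cell ?n" "unshift C Y \<in> cell ?n"
        using cell_Sh[of "unshift C X" ?n] cell_Sh[of "unshift C Y" ?n] XY o by simp_all
      ultimately have "height \<phi> (unshift C X) \<le> 0" using r by blast
      then show "height (\<phi> + 1) X \<le> 0" using height_Sh[of "unshift C X" \<phi>] o by simp
    qed
    then show ?thesis unfolding semistable_def by (simp add: cell_index_Sh cell_Sh[OF A] height_Sh[OF A])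
  qed
qed

end

sublocale t_structure_chain \<subseteq> preslicing C semistable
  by (rule preslicing_semistable)

context t_structure_chain
begin

subsection \<open>Harder-Narasimhan filtrations\<close>

abbreviation "phases n \<equiv> {c n<..c (n + 1)}"

lemma hn_cell: "hn C semistable J E \<Longrightarrow> J \<subseteq> phases n \<Longrightarrow> E \<in> cell n"
proof (erule hn_induct_ext)
  fix \<phi> A assume J: "J \<subseteq> phases n" and \<phi>: "\<phi> \<in> J" and A: "A \<in> semistable \<phi>"
  have "cell_index \<phi> = n" using J \<phi> by (intro cell_index_eq) auto
  then show "A \<in> cell n" using semistableD(1)[OF A] by simp
qed (rule cell_zero cell_mid; assumption)+

lemma hn_height_sign:
  assumes "hn C semistable J E" "J \<subseteq> phases n" "c n < \<phi>" "\<phi> \<le> c (n + 1)"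
  shows "(\<And>\<psi>. \<psi> \<in> J \<Longrightarrow> \<phi> < \<psi>) \<Longrightarrow> 0 \<le> height \<phi> E" "(\<And>\<psi>. \<psi> \<in> J \<Longrightarrow> \<psi> \<le> \<phi>) \<Longrightarrow> height \<phi> E \<le> 0"
proof -
  have *: "is_zero C A \<or> (\<exists>m>0. height \<phi> A = m * sin (pi * (\<psi> - \<phi>)))" if "\<psi> \<in> J" "A \<in> semistable \<psi>" for \<psi> A
  proof (cases "is_zero C A")
    case False
    have n: "cell_index \<psi> = n" "c n < \<psi>" "\<psi> \<le> c (n + 1)" using that assms(2) cell_index_eq by auto
    note D = semistableD[OF that(2), unfolded n]
    obtain m \<xi> where m: "k \<le> m" "z A = of_real m * cis (pi * \<xi>)"
      and s1: "\<And>\<zeta>. c n < \<zeta> \<Longrightarrow> \<zeta> \<le> c (n + 1) \<Longrightarrow> 0 < height \<zeta> A \<longleftrightarrow> \<zeta> < \<xi>"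
      and s2: "\<And>\<zeta>. c n < \<zeta> \<Longrightarrow> \<zeta> \<le> c (n + 1) \<Longrightarrow> height \<zeta> A < 0 \<longleftrightarrow> \<xi> < \<zeta>"
      by (rule cell_phase[OF D(1) False]) (rule that)
    have "\<xi> = \<psi>" using D(2) s1[OF n(2,3)] s2[OF n(2,3)] by auto
    then show ?thesis using height_cis[OF m(2), of \<phi>] m(1) k_pos by (intro disjI2 exI[of _ m]) simp
  qed simp
  have range: "\<psi> - \<phi> < 1" "- 1 < \<psi> - \<phi>" if "\<psi> \<in> J" for \<psi> using that assms(2-4) c_gap[of n] by force+
  show "0 \<le> height \<phi> E" if J: "\<And>\<psi>. \<psi> \<in> J \<Longrightarrow> \<phi> < \<psi>"
    using assms(1)
  proof (rule hn_induct_ext)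
    fix \<psi> A assume "\<psi> \<in> J" "A \<in> semistable \<psi>"
    then show "0 \<le> height \<phi> A" using *[of \<psi> A] range[of \<psi>] J[of \<psi>] sin_sign(1)[of "\<psi> - \<phi>"] height_zero[of A] by auto
  qed (auto simp: height_zero height_tri)
  show "height \<phi> E \<le> 0" if J: "\<And>\<psi>. \<psi> \<in> J \<Longrightarrow> \<psi> \<le> \<phi>"
    using assms(1)
  proof (rule hn_induct_ext)
    fix \<psi> A assume "\<psi> \<in> J" "A \<in> semistable \<psi>"
    moreover have "sin (pi * (\<psi> - \<phi>)) \<le> 0" if "\<psi> \<in> J"
      using range[OF that] J[OF that] sin_sign(2)[of "\<psi> - \<phi>"] by (cases "\<psi> = \<phi>") auto
    ultimately show "height \<phi> A \<le> 0" using *[of \<psi> A] height_zero[of A] by (auto simp: mult_nonneg_nonpos)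
  qed (auto simp: height_zero height_tri)
qed

text \<open>
  Induction on the mass, which is additive and drops by at least \<open>mass_unit n\<close> in proper subobjects and
  quotients. If \<open>E\<close> of phase \<open>\<phi>\<close> is not semistable, it has a subobject with a nonzero part \<open>X\<close> of phases above \<open>\<phi>\<close>; then the quotient by \<open>X\<close> has a nonzero part \<open>Y'\<close> of phases at most
  \<open>\<phi>\<close>. So \<open>E\<close> is an extension of \<open>Y'\<close> by an object \<open>K\<close> built from factors of phases above \<open>\<phi>\<close>, and
  \<open>K\<close> has a filtration because its mass is smaller.
\<close>

lemma hn_exists_in_cell:
  assumes "E \<in> cell n" shows "hn C semistable (phases n) E"
  using assms
proof (induction "nat \<lfloor>mass n E / mass_unit n\<rfloor>" arbitrary: E rule: less_induct)
  case less
  note up = mass_unit_pos[of n]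
  have smaller: "hn C semistable (phases n) A"
    if A: "A \<in> cell n" and m: "mass n A + mass_unit n \<le> mass n E" for A
  proof (cases "is_zero C A")
    case False
    have mA: "mass_unit n \<le> mass n A" using mass_lower[OF A False] .
    have "mass n A / mass_unit n + 1 = (mass n A + mass_unit n) / mass_unit n" using up by (simp add: add_divide_distrib)
    also have "\<dots> \<le> mass n E / mass_unit n" using m up by (intro divide_right_mono) auto
    finally have "\<lfloor>mass n A / mass_unit n + 1\<rfloor> \<le> \<lfloor>mass n E / mass_unit n\<rfloor>" by (rule floor_mono)
    then have "\<lfloor>mass n A / mass_unit n\<rfloor> + 1 \<le> \<lfloor>mass n E / mass_unit n\<rfloor>" by simp
    moreover have "0 \<le> \<lfloor>mass n A / mass_unit n\<rfloor>" using mA up by simp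
    ultimately have "nat \<lfloor>mass n A / mass_unit n\<rfloor> < nat \<lfloor>mass n E / mass_unit n\<rfloor>"
      by (subst nat_mono_iff) linarith+
    then show ?thesis by (rule less.hyps[OF _ A])
  qed (rule hn_zero)
  show ?case
  proof (cases "is_zero C E")
    case False
    obtain m \<phi> where \<phi>: "c n < \<phi>" "\<phi> \<le> c (n + 1)" and hE: "height \<phi> E = 0"
      by (rule cell_phase[OF less.prems False]) (rule that)
    have n: "cell_index \<phi> = n" using cell_index_eq \<phi> by blast
    show ?thesis
    proof (cases "E \<in> semistable \<phi>")
      case True then show ?thesis using hn_single \<phi> by simp
    next
      case not_ss: False
      then obtain A B where AB: "tri C A E B" "A \<in> cell n" "B \<in> cell n" "0 < height \<phi> A"
        using less.prems hE n unfolding semistable_def by (auto simp: not_le)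
      have hB: "height \<phi> B < 0" using height_tri[OF AB(1), of \<phi>] hE AB(4) by simp
      have nB: "\<not> is_zero C B" using hB height_zero[of B \<phi>] by auto
      have "hn C semistable (phases n) A"
        using smaller[OF AB(2)] mass_lower[OF AB(3) nB] mass_tri[OF AB(1), of n] by simp
      then obtain X Y where XY: "tri C X A Y" "hn C semistable (phases n \<inter> {\<phi><..}) X" "hn C semistable (phases n - {\<phi><..}) Y"
        using hn_cut[of "phases n" A "{\<phi><..}"] by auto
      have Xc: "X \<in> cell n" and Yc: "Y \<in> cell n" using hn_cell[OF XY(2)] hn_cell[OF XY(3)] by auto
      have "height \<phi> Y \<le> 0" using hn_height_sign(2)[OF XY(3) _ \<phi>] by auto
      then have hX: "0 < height \<phi> X" using height_tri[OF XY(1), of \<phi>] AB(4) by simp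
      then have nX: "\<not> is_zero C X" using height_zero[of X \<phi>] by auto
      obtain B' where B': "tri C X E B'" "tri C Y B' B" using tri_octahedral[OF XY(1) AB(1)] by blast
      have B'c: "B' \<in> cell n" using cell_mid[OF B'(2) Yc AB(3)] .
      have hB': "height \<phi> B' < 0" using height_tri[OF B'(1), of \<phi>] hE hX by simp
      have "hn C semistable (phases n) B'"
        using smaller[OF B'c] mass_lower[OF Xc nX] mass_tri[OF B'(1), of n] by simp
      then obtain X' Y' where X'Y': "tri C X' B' Y'" "hn C semistable (phases n \<inter> {\<phi><..}) X'" "hn C semistable (phases n - {\<phi><..}) Y'"
        using hn_cut[of "phases n" B' "{\<phi><..}"] by auto
      have X'c: "X' \<in> cell n" and Y'c: "Y' \<in> cell n" using hn_cell[OF X'Y'(2)] hn_cell[OF X'Y'(3)] by auto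
      have "0 \<le> height \<phi> X'" using hn_height_sign(1)[OF X'Y'(2) _ \<phi>] by auto
      then have hY': "height \<phi> Y' < 0" using height_tri[OF X'Y'(1), of \<phi>] hB' by simp
      then have nY': "\<not> is_zero C Y'" using height_zero[of Y' \<phi>] by auto
      obtain K where K: "tri C X K X'" "tri C K E Y'" using tri_octahedral'[OF B'(1) X'Y'(1)] by blast
      have Kc: "K \<in> cell n" using cell_mid[OF K(1) Xc X'c] .
      have hnK: "hn C semistable (phases n) K"
        using smaller[OF Kc] mass_lower[OF Y'c nY'] mass_tri[OF K(2), of n] by simp
      have "hn C semistable (phases n \<inter> {\<phi><..}) K"
      proof (rule hn_refine_lower[OF hnK])
        fix \<xi> W assume \<xi>: "\<xi> \<in> phases n - {\<phi><..}" and W: "W \<in> semistable \<xi>"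
        have hW: "hn C semistable {\<xi>} W" by (rule hn_single[OF W]) simp
        have "orth C X W" "orth C X' W" by (rule hn_orth[OF XY(2) hW] hn_orth[OF X'Y'(2) hW]; use \<xi> in auto)+
        then show "orth C K W" using tri_orth_right[OF K(1) P_Obj[OF W]] by blast
      qed auto
      then have "hn C semistable (phases n \<inter> {\<phi><..} \<union> (phases n - {\<phi><..})) E"
        by (rule hn_concat[OF X'Y'(3) _ K(2)]) auto
      moreover have "phases n \<inter> {\<phi><..} \<union> (phases n - {\<phi><..}) = phases n" by auto
      ultimately show ?thesis by simp
    qed
  qed (rule hn_zero)
qed

text \<open>
  The cells from \<open>n\<close> to \<open>m - 1\<close> are filtered one by one; the truncations separate them.
\<close>

lemma hn_exists_between:
  assumes "n \<le> m" "E \<in> U n" "E \<in> V m" shows "hn C semistable {c n<..c m} E"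
  using assms
proof (induction m arbitrary: E rule: int_ge_induct)
  case base
  then have "orth C E E" using UV_orth by blast
  then show ?case using is_zero_iff U_Obj base hn_zero by blast
next
  case (step m)
  obtain X Y where XY: "X \<in> U m" "Y \<in> V m" "tri C X E Y" using UV_cut[of E m] U_Obj[OF step.prems(1)] by blast
  have XV: "X \<in> V (m + 1)" using V_cocone[OF XY(3) step.prems(2)] XY(2) V_mono[of m "m + 1 + 2"] by auto
  have YU: "Y \<in> U n" using U_cone[OF XY(3) step.prems(1)] XY(1) U_mono[of "n - 2" m] step.hyps by auto
  have 1: "hn C semistable {c m<..c (m + 1)} X"
    using hn_exists_in_cell XY(1) XV unfolding cell_def by blast
  have 2: "hn C semistable {c n<..c m} Y" using step.IH[OF YU XY(2)] .
  have "hn C semistable ({c m<..c (m + 1)} \<union> {c n<..c m}) E"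
    by (rule hn_concat[OF 2 1 XY(3)]) auto
  then show ?case by (rule hn_mono) (use c_mono_le[OF step.hyps] c_less[of m] in auto)
qed

lemma slicing_category_semistable: "slicing_category C semistable"
proof unfold_locales
  fix E assume E: "E \<in> Obj C"
  then obtain n m where nm: "E \<in> U n" "E \<in> V m" using UV_bounded by blast
  have "n \<le> max n m" "E \<in> V (max n m)" using nm V_mono[of m "max n m"] by auto
  then have "hn C semistable {c n<..c (max n m)} E" using hn_exists_between nm(1) by blast
  then show "hn C semistable UNIV E" by (rule hn_mono) simp
qed

lemma stable_category_semistable: "stable_category C semistable z"
proof -
  interpret S: slicing_category C semistable by (rule slicing_category_semistable)
  show ?thesis
  proof unfold_locales
    show "z Y = z X + z W" if "tri C X Y W" for X Y W using z_tri[OF that] .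
    show "\<exists>m>0. z E = of_real m * cis (pi * \<phi>)" if E: "E \<in> semistable \<phi>" and nz: "\<not> is_zero C E" for E \<phi>
    proof -
      note D = semistableD[OF E]
      obtain m \<xi> where m: "k \<le> m" "z E = of_real m * cis (pi * \<xi>)"
        and s1: "\<And>\<zeta>. c (cell_index \<phi>) < \<zeta> \<Longrightarrow> \<zeta> \<le> c (cell_index \<phi> + 1) \<Longrightarrow> 0 < height \<zeta> E \<longleftrightarrow> \<zeta> < \<xi>"
        and s2: "\<And>\<zeta>. c (cell_index \<phi>) < \<zeta> \<Longrightarrow> \<zeta> \<le> c (cell_index \<phi> + 1) \<Longrightarrow> height \<zeta> E < 0 \<longleftrightarrow> \<xi> < \<zeta>"
        by (rule cell_phase[OF D(1) nz]) (rule that)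
      have "\<xi> = \<phi>" using D(2) s1[OF cell_index] s2[OF cell_index] by auto
      then show ?thesis using m k_pos by (intro exI[of _ m]) auto
    qed
  qed
qed

lemma semistable_mass_bound:
  assumes "E \<in> semistable \<phi>" "\<not> is_zero C E" shows "k \<le> norm (z E)"
proof -
  obtain m \<xi> where "k \<le> m" "z E = of_real m * cis (pi * \<xi>)"
    by (rule cell_phase[OF semistableD(1)[OF assms(1)] assms(2)]) (rule that)
  then show ?thesis using k_pos by (simp add: norm_mult)
qed

lemma slices_semistable_greaterThan: "slices C semistable {c n<..} = U n"
proof (intro equalityI subsetI)
  fix E assume E: "E \<in> slices C semistable {c n<..}"
  then show "E \<in> U n"
  proof (induction rule: slices_induct)
    case (base \<phi> A)
    have "n \<le> cell_index \<phi>"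
      using base(1) cell_index(2)[of \<phi>] c_mono_le[of "cell_index \<phi> + 1" n] by fastforce
    then show ?case using semistableD(1)[OF base(2)] U_mono unfolding cell_def by blast
  qed (rule U_mid)
next
  fix E assume E: "E \<in> U n"
  then obtain m where m: "E \<in> V m" using UV_bounded U_Obj by blast
  then have "E \<in> V (max n m)" using V_mono[of m "max n m"] by auto
  then have "hn C semistable {c n<..c (max n m)} E" using hn_exists_between[of n "max n m"] E by simp
  then have "hn C semistable {c n<..} E" by (rule hn_mono) auto
  then show "E \<in> slices C semistable {c n<..}" by (rule hn_imp_slices) (auto intro: exI[of _ "c n + 1"] simp: gt_ex)
qed

lemma slices_semistable_atMost: "slices C semistable {..c n} = V n"
proof (intro equalityI subsetI)
  fix E assume E: "E \<in> slices C semistable {..c n}"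
  then show "E \<in> V n"
  proof (induction rule: slices_induct)
    case (base \<phi> A)
    have "cell_index \<phi> + 1 \<le> n"
      using base(1) cell_index(1)[of \<phi>] c_mono_le[of n "cell_index \<phi>"] by fastforce
    then show ?case using semistableD(1)[OF base(2)] V_mono unfolding cell_def by blast
  qed (rule V_mid)
next
  fix E assume E: "E \<in> V n"
  then obtain m where m: "E \<in> U m" using UV_bounded V_Obj by blast
  then have "E \<in> U (min n m)" using U_mono[of "min n m" m] by auto
  then have "hn C semistable {c (min n m)<..c n} E" using hn_exists_between[of "min n m" n] E by simp
  then have "hn C semistable {..c n} E" by (rule hn_mono) auto
  then show "E \<in> slices C semistable {..c n}" by (rule hn_imp_slices) auto
qed

end

section \<open>Reasonable stability conditions are locally finite\<close>

lemma (in preslicing) slices_orth_Sh: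
  assumes "X \<in> slices C P I" "Y \<in> slices C P J" "\<And>x y. x \<in> I \<Longrightarrow> y \<in> J \<Longrightarrow> y < x + 1" shows "orth C (Sh C X) Y"
  by (rule slices_orth[OF slices_Sh[OF assms(1)] assms(2)]) (use assms(3) in auto)

context slicing_category
begin

lemma slices_openI:
  assumes "\<alpha> < \<beta>" "X \<in> Obj C"
    "\<And>\<psi> B. \<psi> \<le> \<alpha> \<Longrightarrow> B \<in> P \<psi> \<Longrightarrow> orth C X B" "\<And>\<psi> A. \<beta> \<le> \<psi> \<Longrightarrow> A \<in> P \<psi> \<Longrightarrow> orth C A X"
  shows "X \<in> slices C P {\<alpha><..<\<beta>}"
  using assms by (simp add: slices_greaterThanLessThan slices_greaterThan slices_lessThan)

text \<open>
  In \<open>P(\<alpha>, \<beta>)\<close> with \<open>\<beta> \<le> \<alpha> + 1\<close> a strict monomorphism is the first map of a distinguished triangle: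
  its cone \<open>N\<close> lies in \<open>P(\<alpha>, \<beta> + 1)\<close>, the truncation \<open>N''\<close> of \<open>N\<close> below \<open>\<beta>\<close> is the cokernel, and the
  kernel of the cokernel is the cocone \<open>M\<close> of \<open>E \<rightarrow> N''\<close>.
\<close>

lemma strict_subobject_Tri:
  assumes ab: "\<alpha> < \<beta>" "\<beta> \<le> \<alpha> + 1"
    and strict: "strict_subobject C (slices C P {\<alpha><..<\<beta>}) E K k"
  obtains F g h where "Tri C K E F k g h" "F \<in> slices C P {\<alpha><..<\<beta>}"
proof -
  let ?S = "slices C P {\<alpha><..<\<beta>}"
  obtain F g0 where ker: "is_kernel C ?S K E F k g0" using strict unfolding strict_subobject_def by blast
  then have KEF: "K \<in> ?S" "E \<in> ?S" "F \<in> ?S" and k: "k \<in> Hom C K E" and g0: "g0 \<in> Hom C E F" "g0 \<cdot> k = Nul C K F"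
    and un: "\<And>T t. T \<in> ?S \<Longrightarrow> t \<in> Hom C T E \<Longrightarrow> g0 \<cdot> t = Nul C T F \<Longrightarrow> \<exists>!s. s \<in> Hom C T K \<and> k \<cdot> s = t"
    unfolding is_kernel_def by simp_all
  note o = slices_Obj[OF KEF(1)] slices_Obj[OF KEF(2)] slices_Obj[OF KEF(3)]
  have Pdown: "orth C X B" if "X \<in> ?S" "\<psi> \<le> \<alpha>" "B \<in> P \<psi>" for X B \<psi>
    using slices_orth[OF that(1) slices_P[OF that(3), of "{\<psi>}"]] that(2) by auto
  have Pdown': "orth C (Sh C X) B" if "X \<in> ?S" "\<psi> \<le> \<alpha>" "B \<in> P \<psi>" for X B \<psi>
    using slices_orth_Sh[OF that(1) slices_P[OF that(3), of "{\<psi>}"]] that(2) by auto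
  have Pup: "orth C A X" if "X \<in> ?S" "\<beta> \<le> \<psi>" "A \<in> P \<psi>" for X A \<psi>
    using slices_orth[OF slices_P[OF that(3), of "{\<psi>}"] that(1)] that(2) by auto
  have Pup': "orth C (Sh C A) X" if "X \<in> ?S" "\<beta> \<le> \<psi>" "A \<in> P \<psi>" for X A \<psi>
    using slices_orth_Sh[OF slices_P[OF that(3), of "{\<psi>}"] that(1)] that(2) by auto
  obtain N g h where T: "Tri C K E N k g h" using TR1_cone[OF o(1,2) k] by blast
  note tT = triI[OF T] and tyT = Tri_D[OF T]
  have Ndown: "orth C N B" if "\<psi> \<le> \<alpha>" "B \<in> P \<psi>" for \<psi> B
    by (rule tri_orth_right3[OF tT P_Obj[OF that(2)] Pdown[OF KEF(2) that] Pdown'[OF KEF(1) that]])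
  obtain N' N'' where N0: "tri C N' N N''" "hn C P (UNIV \<inter> {\<beta>..}) N'" "hn C P (UNIV - {\<beta>..}) N''"
    using hn_cut[OF HN[of N], of "{\<beta>..}"] tyT by auto
  have "UNIV - {\<beta>..} = {..<\<beta>}" by auto
  then have N': "N' \<in> slices C P {\<beta>..}" and N''1: "N'' \<in> slices C P {..<\<beta>}"
    using N0 hn_imp_slices[of "{\<beta>..}" N'] hn_imp_slices[of "{..<\<beta>}" N''] by auto
  obtain a p b where T2: "Tri C N' N N'' a p b" using N0(1) unfolding tri_def by blast
  note tyT2 = Tri_D[OF T2]
  have N'': "N'' \<in> ?S"
  proof (rule slices_openI[OF ab(1)])
    show "orth C N'' B" if "\<psi> \<le> \<alpha>" "B \<in> P \<psi>" for \<psi> B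
    proof (rule tri_orth_right3[OF N0(1) P_Obj[OF that(2)] Ndown[OF that]])
      show "orth C (Sh C N') B"
        by (rule slices_orth_Sh[OF N' slices_P[OF that(2), of "{\<psi>}"]]) (use that(1) ab in auto)
    qed
    show "orth C A N''" if "\<beta> \<le> \<psi>" "A \<in> P \<psi>" for \<psi> A
      by (rule slices_orth[OF slices_P[OF that(2), of "{\<psi>}"] N''1]) (use that(1) in auto)
  qed (use tyT2 in simp)
  obtain M m s l where T3: "Tri C M E N'' m (p \<cdot> g) l" and s: "s \<in> Hom C K M" "m \<cdot> s = k" and KM: "tri C K M N'"
    by (rule tri_image[OF T T2])
  note tyT3 = Tri_D[OF T3]
  have M: "M \<in> ?S"
  proof (rule slices_openI[OF ab(1)])
    show "orth C M B" if "\<psi> \<le> \<alpha>" "B \<in> P \<psi>" for \<psi> B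
    proof (rule tri_orth_right[OF KM P_Obj[OF that(2)] Pdown[OF KEF(1) that]])
      show "orth C N' B"
        by (rule slices_orth[OF N' slices_P[OF that(2), of "{\<psi>}"]]) (use that(1) ab in auto)
    qed
    show "orth C A M" if "\<beta> \<le> \<psi>" "A \<in> P \<psi>" for \<psi> A
      by (rule tri_orth_left1[OF triI[OF T3] P_Obj[OF that(2)] Pup[OF KEF(2) that] Pup'[OF N'' that]])
  qed (use tyT3 in simp)
  \<comment> \<open>The cokernel of a kernel: the map \<open>g0\<close>, of which \<open>k\<close> is the kernel, factors through \<open>N''\<close>, so \<open>m\<close> factors through \<open>k\<close>.\<close>
  have "g0 \<cdot> m = Nul C M F"
  proof -
    obtain t where t: "t \<in> Hom C N F" "t \<cdot> g = g0" using exact_right[OF T o(3) g0] by blast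
    have "orth C N' F" by (rule slices_orth[OF N' KEF(3)]) auto
    then have "t \<cdot> a = Nul C N' F" using orthD Comp_in tyT2 t o by blast
    then obtain t' where t': "t' \<in> Hom C N'' F" "t' \<cdot> p = t" using exact_right[OF T2 o(3) t(1)] by blast
    have "g0 = t' \<cdot> (p \<cdot> g)" using Comp_assoc[of E N N'' F g p t'] t t' tyT tyT2 o by simp
    then have "g0 \<cdot> m = t' \<cdot> (p \<cdot> g \<cdot> m)" using Comp_assoc[of M E N'' F m "p \<cdot> g" t'] t' tyT3 o by simp
    also have "\<dots> = Nul C M F" using Tri_comp_zero[OF T3] Comp_Nul[of M N'' F t'] t' tyT3 o by simp
    finally show ?thesis .
  qed
  then obtain s' where s': "s' \<in> Hom C M K" "k \<cdot> s' = m" using un[OF M] tyT3 by blast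
  have ss: "s' \<cdot> s \<in> Hom C K K" "s \<cdot> s' \<in> Hom C M M" using s s' Comp_in tyT3 o by blast+
  have 1: "s' \<cdot> s = Ide C K"
  proof -
    have "k \<cdot> (s' \<cdot> s) = k" using Comp_assoc[of K M K E s s' k] s s' k tyT3 o by simp
    then show ?thesis using un[OF KEF(1) k g0(2)] ss(1) Ide_in[OF o(1)] Comp_Ide[OF o(1,2) k] by blast
  qed
  have 2: "s \<cdot> s' = Ide C M"
  proof (rule endo_eq_Ide_left[OF tyT3(1) o(2) ss(2) tyT3(4)])
    show "m \<cdot> (s \<cdot> s') = m" using Comp_assoc[of M K M E s' s m] s s' tyT3 o by simp
    fix d assume d: "d \<in> Hom C M M" "m \<cdot> d = Nul C M E"
    obtain j where j: "Tri C (unshift C N'') M E j m (p \<cdot> g)" "j \<in> Hom C (unshift C N'') M"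
      using unrot[of M E "unshift C N''" m "p \<cdot> g" l] T3 tyT3 by auto
    obtain e where e: "e \<in> Hom C M (unshift C N'')" "j \<cdot> e = d" using exact_left[OF j(1) _ d] tyT3 by blast
    have "orth C (Sh C M) N''" by (rule slices_orth_Sh[OF M N'']) (use ab in auto)
    then have "orth C M (unshift C N'')" using orth_unshift tyT3 by simp
    then have "e = Nul C M (unshift C N'')" using e(1) orthD by blast
    then show "d = Nul C M M" using e Comp_Nul[of M "unshift C N''" M j] j(2) tyT3 by simp
  qed
  have "Tri C K E N'' k (p \<cdot> g) (ShM C s' \<cdot> l)"
  proof (rule TR1_iso[OF T3])
    show "is_iso C M K s'" unfolding is_iso_def using 1 2 s s' by blast
    show "is_iso C E E (Ide C E)" "is_iso C N'' N'' (Ide C N'')" using is_iso_Ide o tyT3 by auto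
    show "ShM C s' \<cdot> l \<in> Hom C N'' (Sh C K)" using Comp_in[of N'' "Sh C M" "Sh C K"] ShM_in s' tyT3 o by simp
    then show "ShM C s' \<cdot> l = ShM C s' \<cdot> l \<cdot> Ide C N''" using tyT3 o by (simp add: Comp_Ide_Hom)
    show "Ide C E \<cdot> m = k \<cdot> s'" using s' tyT3 by (simp add: Ide_Comp_Hom)
    show "Ide C N'' \<cdot> (p \<cdot> g) = p \<cdot> g \<cdot> Ide C E" using tyT3 by (simp add: Ide_Comp_Hom Comp_Ide_Hom)
  qed (use k o tyT3 in auto)
  then show thesis using that N'' by blast
qed

end

text \<open>
  The form in which a bounded additive measure stops a chain: each step either is trivial or
  increases the measure by at least \<open>\<kappa>\<close>.
\<close>

lemma increments_eventually_small:
  fixes f :: "nat \<Rightarrow> real"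
  assumes step: "\<And>n. Q n \<or> f n + \<kappa> \<le> f (Suc n)" and mono: "\<And>n. f n \<le> f (Suc n)" and bound: "\<And>n. f n \<le> B" and "0 < \<kappa>"
  shows "\<exists>N. \<forall>n\<ge>N. Q n"
proof -
  have "incseq f" using mono by (rule incseq_SucI)
  then obtain L where L: "f \<longlonglongrightarrow> L" using incseq_convergent[of f B] bound by blast
  have "(\<lambda>n. f (Suc n) - f n) \<longlonglongrightarrow> L - L" by (intro tendsto_diff L LIMSEQ_Suc)
  then have "eventually (\<lambda>n. f (Suc n) - f n < \<kappa>) sequentially"
    using order_tendstoD(2)[of _ 0 sequentially \<kappa>] \<open>0 < \<kappa>\<close> by simp
  then obtain N where N: "\<And>n. n \<ge> N \<Longrightarrow> f (Suc n) - f n < \<kappa>" unfolding eventually_sequentially by blast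
  have "Q n" if "n \<ge> N" for n using step[of n] N[OF that] by linarith
  then show ?thesis by blast
qed

context stable_category
begin

text \<open>
  On \<open>P(\<phi> - 1/4, \<phi> + 1/4)\<close> the projection of the charge to the direction of phase \<open>\<phi>\<close> is additive on
  strict exact sequences and at least \<open>k cos (\<pi>/4)\<close> on nonzero objects, which bounds lengths.
\<close>

lemma finite_length_of_lower_bound:
  assumes k0: "0 < k0" and k: "\<And>\<phi> A. A \<in> P \<phi> \<Longrightarrow> \<not> is_zero C A \<Longrightarrow> k0 \<le> norm (z A)"
  shows "finite_length C (slices C P {\<phi> - 1/4<..<\<phi> + 1/4})"
proof -
  define S where "S = slices C P {\<phi> - 1/4<..<\<phi> + 1/4}"
  define \<l> where "\<l> X = inner (cis (pi * \<phi>)) (z X)" for X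
  define \<kappa> where "\<kappa> = k0 * cos (pi / 4)"
  have cos4: "0 < cos (pi / 4)" by (intro cos_gt_zero) simp_all
  have \<kappa>: "0 < \<kappa>" unfolding \<kappa>_def using k0 cos4 by simp
  have l_tri: "\<l> Y = \<l> X + \<l> W" if "tri C X Y W" for X Y W
    unfolding \<l>_def z_tri[OF that] by (rule inner_add_right)
  have lower: "\<kappa> \<le> \<l> X" if X: "X \<in> S" "\<not> is_zero C X" for X
    unfolding \<kappa>_def \<l>_def
  proof (rule slices_inner_lower[OF X(1)[unfolded S_def] _ _ _ _ X(2)])
    fix \<psi> assume \<psi>: "\<psi> \<in> {\<phi> - 1/4<..<\<phi> + 1/4}"
    have "\<bar>pi * \<psi> - pi * \<phi>\<bar> = pi * \<bar>\<psi> - \<phi>\<bar>" by (simp add: abs_mult right_diff_distrib[symmetric])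
    also have "\<bar>\<psi> - \<phi>\<bar> \<le> 1/4" unfolding abs_le_iff using \<psi> by auto
    then have "pi * \<bar>\<psi> - \<phi>\<bar> \<le> pi * (1/4)" by (intro mult_left_mono) auto
    finally have "cos (pi / 4) \<le> cos \<bar>pi * \<psi> - pi * \<phi>\<bar>" by (intro cos_monotone_0_pi_le) auto
    then show "cos (pi / 4) \<le> inner (cis (pi * \<phi>)) (cis (pi * \<psi>))" unfolding inner_cis by simp
  next
    show "k0 \<le> norm (z A)" if "A \<in> P \<psi>" "\<not> is_zero C A" for \<psi> A using k that .
  qed (use k0 cos4 in auto)
  have zero: "\<l> X = 0" if "is_zero C X" for X using z_zero[OF that] by (simp add: \<l>_def)
  have nonneg: "0 \<le> \<l> X" if "X \<in> S" for X using lower[OF that] zero[of X] \<kappa> by (cases "is_zero C X") auto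
  have triS: "\<exists>F g h. Tri C K E F k g h \<and> F \<in> S" if str: "strict_subobject C S E K k" for E K k
  proof -
    obtain F g h where "Tri C K E F k g h" "F \<in> S"
      unfolding S_def by (rule strict_subobject_Tri[OF _ _ str[unfolded S_def]]) auto
    then show ?thesis by blast
  qed
  have KS: "K \<in> S" "E \<in> S" if "strict_subobject C S E K k" for E K k
    using that unfolding strict_subobject_def is_kernel_def by auto
  have upper: "\<l> K \<le> \<l> E" if str: "strict_subobject C S E K k" for E K k
    using triS[OF str] l_tri[OF triI] nonneg by fastforce
  have step: "subobject_le C L l K k \<and> \<l> K = \<l> L \<or> \<l> K + \<kappa> \<le> \<l> L"
    if strK: "strict_subobject C S E K k" and strL: "strict_subobject C S E L l" and le: "subobject_le C K k L l" for E K k L l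
  proof -
    obtain u where u: "u \<in> Hom C K L" "l \<cdot> u = k" using le unfolding subobject_le_def by blast
    obtain F g h where TK: "Tri C K E F k g h" "F \<in> S" using triS[OF strK] by blast
    obtain F' g' h' where TL: "Tri C L E F' l g' h'" "F' \<in> S" using triS[OF strL] by blast
    note tyK = Tri_D[OF TK(1)] and tyL = Tri_D[OF TL(1)]
    obtain W p q where TW: "Tri C K L W u p q" using TR1_cone[of K L u] tyK tyL u by blast
    note tyW = Tri_D[OF TW]
    have "Tri C K E F (l \<cdot> u) g h" using TK(1) u(2) by simp
    then have t: "tri C W F F'" using TR4[OF TW TL(1)] unfolding tri_def by blast
    have W: "W \<in> S"
      unfolding S_def
    proof (rule slices_openI)
      show "orth C W B" if "\<psi> \<le> \<phi> - 1/4" "B \<in> P \<psi>" for \<psi> B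
      proof (rule tri_orth_right3[OF triI[OF TW] P_Obj[OF that(2)]])
        show "orth C L B"
          by (rule slices_orth[OF KS(1)[OF strL, unfolded S_def] slices_P[OF that(2), of "{\<psi>}"]]) (use that(1) in auto)
        show "orth C (Sh C K) B"
          by (rule slices_orth_Sh[OF KS(1)[OF strK, unfolded S_def] slices_P[OF that(2), of "{\<psi>}"]]) (use that(1) in auto)
      qed
      show "orth C A W" if "\<phi> + 1/4 \<le> \<psi>" "A \<in> P \<psi>" for \<psi> A
      proof (rule tri_orth_left1[OF t P_Obj[OF that(2)]])
        show "orth C A F"
          by (rule slices_orth[OF slices_P[OF that(2), of "{\<psi>}"] TK(2)[unfolded S_def]]) (use that(1) in auto)
        show "orth C (Sh C A) F'"
          by (rule slices_orth_Sh[OF slices_P[OF that(2), of "{\<psi>}"] TL(2)[unfolded S_def]]) (use that(1) in auto)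
      qed
    qed (use tyW in auto)
    have lW: "\<l> L = \<l> K + \<l> W" by (rule l_tri[OF triI[OF TW]])
    show ?thesis
    proof (cases "is_zero C W")
      case True
      then have "is_iso C K L u" by (rule Tri_zero_is_iso[OF TW])
      then obtain v where v: "v \<in> Hom C L K" "u \<cdot> v = Ide C L" unfolding is_iso_def by blast
      have "k \<cdot> v = l" using Comp_assoc[of L K L E v u l] u v tyK tyL by (simp add: Comp_Ide_Hom)
      then have "subobject_le C L l K k" unfolding subobject_le_def using v by blast
      then show ?thesis using lW zero[OF True] by simp
    next
      case False
      then show ?thesis using lW lower[OF W] by simp
    qed
  qed
  show ?thesis
    unfolding finite_length_def S_def[symmetric]
  proof (intro ballI allI impI conjI)
    fix E and K :: "nat \<Rightarrow> 'a" and k :: "nat \<Rightarrow> 'b" assume str: "\<forall>n. strict_subobject C S E (K n) (k n)"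
    { assume up: "\<forall>n::nat. subobject_le C (K n) (k n) (K (Suc n)) (k (Suc n))"
      show "\<exists>N. \<forall>n\<ge>N. subobject_le C (K (Suc n)) (k (Suc n)) (K n) (k n)"
      proof (rule increments_eventually_small[of _ "\<lambda>n. \<l> (K n)" \<kappa> "\<l> E"])
        fix n
        note st = step[OF str[rule_format, of n] str[rule_format, of "Suc n"] up[rule_format, of n]]
        show "subobject_le C (K (Suc n)) (k (Suc n)) (K n) (k n) \<or> \<l> (K n) + \<kappa> \<le> \<l> (K (Suc n))" using st by blast
        show "\<l> (K n) \<le> \<l> (K (Suc n))" using st \<kappa> by auto
        show "\<l> (K n) \<le> \<l> E" using upper str by blast
      qed (rule \<kappa>) }
    { assume down: "\<forall>n::nat. subobject_le C (K (Suc n)) (k (Suc n)) (K n) (k n)"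
      show "\<exists>N. \<forall>n\<ge>N. subobject_le C (K n) (k n) (K (Suc n)) (k (Suc n))"
      proof (rule increments_eventually_small[of _ "\<lambda>n. - \<l> (K n)" \<kappa> 0])
        fix n
        note st = step[OF str[rule_format, of "Suc n"] str[rule_format, of n] down[rule_format, of n]]
        show "subobject_le C (K n) (k n) (K (Suc n)) (k (Suc n)) \<or> - \<l> (K n) + \<kappa> \<le> - \<l> (K (Suc n))" using st by auto
        show "- \<l> (K n) \<le> - \<l> (K (Suc n))" using st \<kappa> by auto
        show "- \<l> (K n) \<le> 0" using nonneg[OF KS(1)[OF str[rule_format, of n]]] by simp
      qed (rule \<kappa>) }
  qed
qed

end

lemma reasonable_iff:
  "reasonable C \<sigma> \<longleftrightarrow> (\<exists>k>0. \<forall>E\<in>semistables C \<sigma>. k \<le> norm (fst \<sigma> (K0_class C E)))"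
proof
  assume "reasonable C \<sigma>"
  then obtain e where e: "0 < e" "e < (INF E\<in>semistables C \<sigma>. ennreal (norm (fst \<sigma> (K0_class C E))))"
    unfolding reasonable_def using dense by blast
  from e(2) obtain k where k: "e = ennreal k" "0 \<le> k" by (cases e) auto
  have "k \<le> norm (fst \<sigma> (K0_class C E))" if E: "E \<in> semistables C \<sigma>" for E
  proof -
    have "ennreal k \<le> ennreal (norm (fst \<sigma> (K0_class C E)))"
      using e(2) INF_lower[OF E, of "\<lambda>E. ennreal (norm (fst \<sigma> (K0_class C E)))"] unfolding k by (meson less_imp_le order.trans)
    then show ?thesis by simp
  qed
  moreover have "0 < k" using e(1) k by (simp add: ennreal_less_zero_iff)
  ultimately show "\<exists>k>0. \<forall>E\<in>semistables C \<sigma>. k \<le> norm (fst \<sigma> (K0_class C E))" by blast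
next
  assume "\<exists>k>0. \<forall>E\<in>semistables C \<sigma>. k \<le> norm (fst \<sigma> (K0_class C E))"
  then obtain k where k: "0 < k" "\<And>E. E \<in> semistables C \<sigma> \<Longrightarrow> k \<le> norm (fst \<sigma> (K0_class C E))" by blast
  have "ennreal k \<le> (INF E\<in>semistables C \<sigma>. ennreal (norm (fst \<sigma> (K0_class C E))))"
    by (intro INF_greatest ennreal_leI k)
  moreover have "0 < ennreal k" using k(1) by simp
  ultimately show "reasonable C \<sigma>" unfolding reasonable_def by (rule less_le_trans[rotated])
qed

lemma reasonable_imp_locally_finite:
  assumes "triangulated_category C" "stability_condition C \<sigma>" "reasonable C \<sigma>"
  shows "locally_finite C \<sigma>"
proof -
  interpret stable_category C "snd \<sigma>" "\<lambda>E. fst \<sigma> (K0_class C E)"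
    by (rule stability_condition_category[OF assms(1,2)])
  obtain k where k: "0 < k" "\<And>E. E \<in> semistables C \<sigma> \<Longrightarrow> k \<le> norm (fst \<sigma> (K0_class C E))"
    using assms(3) unfolding reasonable_iff by blast
  have "finite_length C (slices C (snd \<sigma>) {\<phi> - 1/4<..<\<phi> + 1/4})" for \<phi>
    by (rule finite_length_of_lower_bound[OF k(1)]) (use k(2) in \<open>auto simp: semistables_def\<close>)
  then show ?thesis unfolding locally_finite_def by (intro exI[of _ "1/4"]) auto
qed

section \<open>Basic neighbourhoods are open\<close>

lemma charge_norm_lessD:
  assumes "charge_norm C \<sigma> W < ennreal r"
    and nz: "\<And>E. E \<in> semistables C \<sigma> \<Longrightarrow> fst \<sigma> (K0_class C E) \<noteq> 0"
  obtains s where "0 \<le> s" "s < r"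
    "\<And>E. E \<in> semistables C \<sigma> \<Longrightarrow> norm (W (K0_class C E)) \<le> s * norm (fst \<sigma> (K0_class C E))"
proof -
  obtain s where s: "charge_norm C \<sigma> W = ennreal s" "0 \<le> s" using assms(1) by (cases "charge_norm C \<sigma> W") auto
  have "norm (W (K0_class C E)) \<le> s * norm (fst \<sigma> (K0_class C E))" if E: "E \<in> semistables C \<sigma>" for E
  proof -
    have "ennreal (norm (W (K0_class C E)) / norm (fst \<sigma> (K0_class C E))) \<le> ennreal s"
      unfolding s(1)[symmetric] charge_norm_def by (rule SUP_upper[OF E])
    then show ?thesis using s(2) nz[OF E] by (simp add: divide_le_eq)
  qed
  moreover have "s < r" using assms(1) s by (simp add: ennreal_less_iff)
  ultimately show thesis using that s(2) by blast
qed

lemma charge_norm_lessI: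
  assumes "\<And>E. E \<in> semistables C \<sigma> \<Longrightarrow> norm (W (K0_class C E)) \<le> s * norm (fst \<sigma> (K0_class C E))"
    and nz: "\<And>E. E \<in> semistables C \<sigma> \<Longrightarrow> fst \<sigma> (K0_class C E) \<noteq> 0" and "0 \<le> s" "s < r"
  shows "charge_norm C \<sigma> W < ennreal r"
proof -
  have "charge_norm C \<sigma> W \<le> ennreal s"
    unfolding charge_norm_def
  proof (intro SUP_least ennreal_leI)
    fix E assume E: "E \<in> semistables C \<sigma>"
    show "norm (W (K0_class C E)) / norm (fst \<sigma> (K0_class C E)) \<le> s"
      using assms(1)[OF E] nz[OF E] by (simp add: divide_le_eq)
  qed
  also have "\<dots> < ennreal r" using assms(3,4) by (simp add: ennreal_less_iff)
  finally show ?thesis .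
qed

lemma slicing_dist_lessD:
  assumes "slicing_dist C P Q < ennreal r"
  obtains e where "0 \<le> e" "e < r" "\<And>\<phi>. Q \<phi> \<subseteq> slices C P {\<phi> - e..\<phi> + e}"
proof -
  obtain e where "0 \<le> e" "\<And>\<phi>. Q \<phi> \<subseteq> slices C P {\<phi> - e..\<phi> + e}" "ennreal e < ennreal r"
    using assms unfolding slicing_dist_def INF_less_iff by blast
  then show thesis using that by (simp add: ennreal_less_iff)
qed

lemma slicing_dist_lessI:
  assumes "0 \<le> e" "e < r" "\<And>\<phi>. Q \<phi> \<subseteq> slices C P {\<phi> - e..\<phi> + e}"
  shows "slicing_dist C P Q < ennreal r"
proof -
  have "slicing_dist C P Q \<le> ennreal e"
    unfolding slicing_dist_def by (rule INF_lower) (use assms in auto)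
  also have "\<dots> < ennreal r" using assms by (simp add: ennreal_less_iff)
  finally show ?thesis .
qed

lemma slices_trans:
  assumes "E \<in> slices C Q I" "\<And>\<phi>. \<phi> \<in> I \<Longrightarrow> Q \<phi> \<subseteq> slices C P J" shows "E \<in> slices C P J"
  using assms(1)
proof (induction rule: slices_induct)
  case (base \<phi> A) then show ?case using assms(2) by blast
qed (rule slices_ext)

text \<open>
  An object of \<open>P \<phi>\<close> has no maps to objects of \<open>Q \<psi>\<close> for \<open>\<psi> < \<phi> - e\<close>, since these have \<open>P\<close>-phases below \<open>\<phi>\<close>. By
  this and the dual statement, orthogonality bounds its \<open>Q\<close>-phases.
\<close>

lemma slicing_dist_sym:
  assumes "slicing_category C P" "slicing_category C Q" "0 \<le> e"
    and sub: "\<And>\<phi>. Q \<phi> \<subseteq> slices C P {\<phi> - e..\<phi> + e}"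
  shows "P \<phi> \<subseteq> slices C Q {\<phi> - e..\<phi> + e}"
proof
  interpret P: slicing_category C P by fact
  interpret Q: slicing_category C Q by fact
  fix E assume E: "E \<in> P \<phi>"
  have E': "E \<in> slices C P {\<phi>}" by (rule P.slices_P[OF E]) simp
  have "E \<in> slices C Q {\<phi> - e..}"
    unfolding Q.slices_atLeast
  proof (intro conjI allI impI ballI P.P_Obj[OF E])
    fix \<psi> B assume \<psi>: "\<psi> < \<phi> - e" and B: "B \<in> Q \<psi>"
    have "B \<in> slices C P {\<psi> - e..\<psi> + e}" using sub[of \<psi>] B by blast
    then show "orth C E B" by (rule P.slices_orth[OF E']) (use \<psi> in auto)
  qed
  moreover have "E \<in> slices C Q {..\<phi> + e}"
    unfolding Q.slices_atMost
  proof (intro conjI allI impI ballI P.P_Obj[OF E])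
    fix \<psi> B assume \<psi>: "\<phi> + e < \<psi>" and B: "B \<in> Q \<psi>"
    have "B \<in> slices C P {\<psi> - e..\<psi> + e}" using sub[of \<psi>] B by blast
    then show "orth C B E" by (rule P.slices_orth[OF _ E']) (use \<psi> in auto)
  qed
  ultimately show "E \<in> slices C Q {\<phi> - e..\<phi> + e}" using assms(3) by (simp add: Q.slices_atLeastAtMost)
qed

lemma (in stable_category) z_nonzero: "E \<in> P \<phi> \<Longrightarrow> \<not> is_zero C E \<Longrightarrow> z E \<noteq> 0"
  using z_phase[of E \<phi>] by auto

lemma semistables_nonzero:
  assumes "triangulated_category C" "stability_condition C \<sigma>" "E \<in> semistables C \<sigma>"
  shows "fst \<sigma> (K0_class C E) \<noteq> 0"
proof -
  interpret stable_category C "snd \<sigma>" "\<lambda>E. fst \<sigma> (K0_class C E)"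
    by (rule stability_condition_category[OF assms(1,2)])
  show ?thesis using assms(3) z_nonzero unfolding semistables_def by blast
qed

lemma sin_pi_pos: "0 < x \<Longrightarrow> x < 1 \<Longrightarrow> 0 < sin (pi * x)" for x :: real
  by (intro sin_gt_zero) simp_all

lemma sin_pi_le: "0 \<le> x \<Longrightarrow> sin (pi * x) \<le> 4 * x" for x :: real
proof -
  assume "0 \<le> x"
  then have "sin (pi * x) \<le> pi * x" by (intro sin_x_le_x) simp
  also have "\<dots> \<le> 4 * x" using \<open>0 \<le> x\<close> pi_less_4 by (intro mult_right_mono) auto
  finally show ?thesis .
qed

text \<open>
  For \<open>\<tau>\<close> in the ball about \<open>\<sigma>\<close> the norms of \<open>\<sigma>\<close> and \<open>\<tau>\<close> are comparable: a \<open>\<sigma>\<close>-semistable object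
  has \<open>\<tau>\<close>-factors of phases within \<open>1/8\<close> of its own, so that their charges do not cancel.
\<close>

lemma stab_ball_open:
  assumes C: "triangulated_category C" and \<sigma>: "stability_condition C \<sigma>" and \<epsilon>: "0 < \<epsilon>" "\<epsilon> < 1/8"
  shows "stab_open C (stab_ball C \<epsilon> \<sigma>)"
  unfolding stab_open_def
proof (intro conjI ballI)
  show "stab_ball C \<epsilon> \<sigma> \<subseteq> Stab C" unfolding stab_ball_def by blast
  fix \<tau> assume \<tau>: "\<tau> \<in> stab_ball C \<epsilon> \<sigma>"
  then have \<tau>s: "stability_condition C \<tau>" unfolding stab_ball_def Stab_def by blast
  interpret P: stable_category C "snd \<sigma>" "\<lambda>E. fst \<sigma> (K0_class C E)"
    by (rule stability_condition_category[OF C \<sigma>])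
  interpret Q: stable_category C "snd \<tau>" "\<lambda>E. fst \<tau> (K0_class C E)"
    by (rule stability_condition_category[OF C \<tau>s])
  have cn: "charge_norm C \<sigma> (\<lambda>x. fst \<tau> x - fst \<sigma> x) < ennreal (sin (pi * \<epsilon>))"
    using \<tau> unfolding stab_ball_def by blast
  obtain s where s: "0 \<le> s" "s < sin (pi * \<epsilon>)" and
    sb: "\<And>E. E \<in> semistables C \<sigma> \<Longrightarrow> norm (fst \<tau> (K0_class C E) - fst \<sigma> (K0_class C E)) \<le> s * norm (fst \<sigma> (K0_class C E))"
    by (rule charge_norm_lessD[OF cn semistables_nonzero[OF C \<sigma>]]) (assumption, rule that)
  have "slicing_dist C (snd \<sigma>) (snd \<tau>) < ennreal \<epsilon>" using \<tau> unfolding stab_ball_def by blast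
  then obtain e where e: "0 \<le> e" "e < \<epsilon>" and
    eb: "\<And>\<phi>. snd \<tau> \<phi> \<subseteq> slices C (snd \<sigma>) {\<phi> - e..\<phi> + e}"
    by (rule slicing_dist_lessD) (rule that)
  have eb': "snd \<sigma> \<phi> \<subseteq> slices C (snd \<tau>) {\<phi> - e..\<phi> + e}" for \<phi>
    by (rule slicing_dist_sym[OF P.slicing_category_axioms Q.slicing_category_axioms e(1) eb])
  \<comment> \<open>Half of the slack that \<open>\<tau>\<close> leaves. An error relative to \<open>\<tau>\<close> costs a factor \<open>4\<close> relative to \<open>\<sigma>\<close>, and \<open>sin (\<pi> \<eta>) \<le> 4 \<eta>\<close>.\<close>
  define \<eta> where "\<eta> = min ((\<epsilon> - e) / 2) ((sin (pi * \<epsilon>) - s) / 32)"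
  have \<eta>: "0 < \<eta>" "\<eta> < 1/8" "e + \<eta> < \<epsilon>" "s + 16 * \<eta> < sin (pi * \<epsilon>)"
    unfolding \<eta>_def using e s \<epsilon> by (auto simp: min_def field_simps)
  have s1: "s \<le> 1" using s(2) sin_le_one[of "pi * \<epsilon>"] by linarith
  have "stab_ball C \<eta> \<tau> \<subseteq> stab_ball C \<epsilon> \<sigma>"
  proof
    fix \<rho> assume \<rho>: "\<rho> \<in> stab_ball C \<eta> \<tau>"
    then have \<rho>S: "\<rho> \<in> Stab C" and \<rho>s: "stability_condition C \<rho>" unfolding stab_ball_def Stab_def by auto
    interpret R: stable_category C "snd \<rho>" "\<lambda>E. fst \<rho> (K0_class C E)"
      by (rule stability_condition_category[OF C \<rho>s])
    have cn': "charge_norm C \<tau> (\<lambda>x. fst \<rho> x - fst \<tau> x) < ennreal (sin (pi * \<eta>))"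
      using \<rho> unfolding stab_ball_def by blast
    obtain r where r: "0 \<le> r" "r < sin (pi * \<eta>)" and
      rb: "\<And>E. E \<in> semistables C \<tau> \<Longrightarrow> norm (fst \<rho> (K0_class C E) - fst \<tau> (K0_class C E)) \<le> r * norm (fst \<tau> (K0_class C E))"
      by (rule charge_norm_lessD[OF cn' semistables_nonzero[OF C \<tau>s]]) (assumption, rule that)
    have r4: "r \<le> 4 * \<eta>" using r(2) sin_pi_le[of \<eta>] \<eta>(1) by linarith
    have "slicing_dist C (snd \<tau>) (snd \<rho>) < ennreal \<eta>" using \<rho> unfolding stab_ball_def by blast
    then obtain d where d: "0 \<le> d" "d < \<eta>" and
      db: "\<And>\<phi>. snd \<rho> \<phi> \<subseteq> slices C (snd \<tau>) {\<phi> - d..\<phi> + d}"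
      by (rule slicing_dist_lessD) (rule that)
    have "slicing_dist C (snd \<sigma>) (snd \<rho>) < ennreal \<epsilon>"
    proof (rule slicing_dist_lessI[of "e + d"])
      show "snd \<rho> \<phi> \<subseteq> slices C (snd \<sigma>) {\<phi> - (e + d)..\<phi> + (e + d)}" for \<phi>
      proof
        fix E assume "E \<in> snd \<rho> \<phi>"
        then have "E \<in> slices C (snd \<tau>) {\<phi> - d..\<phi> + d}" using db by blast
        then show "E \<in> slices C (snd \<sigma>) {\<phi> - (e + d)..\<phi> + (e + d)}"
        proof (rule slices_trans)
          fix \<psi> assume \<psi>: "\<psi> \<in> {\<phi> - d..\<phi> + d}"
          have "slices C (snd \<sigma>) {\<psi> - e..\<psi> + e} \<subseteq> slices C (snd \<sigma>) {\<phi> - (e + d)..\<phi> + (e + d)}"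
            by (rule slices_mono) (use \<psi> in auto)
          then show "snd \<tau> \<psi> \<subseteq> slices C (snd \<sigma>) {\<phi> - (e + d)..\<phi> + (e + d)}" using eb by blast
        qed
      qed
    qed (use e d \<eta> in auto)
    moreover have "charge_norm C \<sigma> (\<lambda>x. fst \<rho> x - fst \<sigma> x) < ennreal (sin (pi * \<epsilon>))"
    proof (rule charge_norm_lessI[OF _ semistables_nonzero[OF C \<sigma>]])
      show "0 \<le> s + 16 * \<eta>" "s + 16 * \<eta> < sin (pi * \<epsilon>)" using s \<eta> by auto
      fix E assume E: "E \<in> semistables C \<sigma>"
      then obtain \<phi> where \<phi>: "E \<in> snd \<sigma> \<phi>" unfolding semistables_def by blast
      let ?Z = "fst \<sigma> (K0_class C E)" and ?U = "fst \<tau> (K0_class C E)" and ?W = "fst \<rho> (K0_class C E)"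
      have "norm (?W - ?U) * (1/2) \<le> r * inner (cis (pi * \<phi>)) ?U"
      proof (rule Q.slices_inner_bound[of E "{\<phi> - e..\<phi> + e}"])
        show "E \<in> slices C (snd \<tau>) {\<phi> - e..\<phi> + e}" using eb' \<phi> by blast
        fix \<psi> assume \<psi>: "\<psi> \<in> {\<phi> - e..\<phi> + e}"
        have "\<bar>pi * \<psi> - pi * \<phi>\<bar> = pi * \<bar>\<psi> - \<phi>\<bar>" by (simp add: abs_mult right_diff_distrib[symmetric])
        also have "\<bar>\<psi> - \<phi>\<bar> \<le> 1/3" unfolding abs_le_iff using \<psi> e \<epsilon> by auto
        then have "pi * \<bar>\<psi> - \<phi>\<bar> \<le> pi * (1/3)" by (intro mult_left_mono) auto
        finally have "cos (pi / 3) \<le> cos \<bar>pi * \<psi> - pi * \<phi>\<bar>" by (intro cos_monotone_0_pi_le) auto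
        then show "1/2 \<le> inner (cis (pi * \<phi>)) (cis (pi * \<psi>))" unfolding inner_cis by (simp add: cos_60)
      next
        show "fst \<rho> (K0_class C Y) - fst \<tau> (K0_class C Y) =
          fst \<rho> (K0_class C X) - fst \<tau> (K0_class C X) + (fst \<rho> (K0_class C W) - fst \<tau> (K0_class C W))"
          if "tri C X Y W" for X Y W using Q.z_tri[OF that] R.z_tri[OF that] by simp
        show "norm (fst \<rho> (K0_class C A) - fst \<tau> (K0_class C A)) \<le> r * norm (fst \<tau> (K0_class C A))"
          if "A \<in> snd \<tau> \<psi>" for A \<psi>
        proof (cases "is_zero C A")
          case True then show ?thesis using Q.z_zero R.z_zero by simp
        next
          case False then show ?thesis using rb that unfolding semistables_def by blast
        qed
      qed (use r in auto)
      also have "inner (cis (pi * \<phi>)) ?U \<le> norm ?U" using norm_cauchy_schwarz[of "cis (pi * \<phi>)" ?U] by simp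
      then have "r * inner (cis (pi * \<phi>)) ?U \<le> r * norm ?U" using r(1) by (rule mult_left_mono)
      also have "norm ?U \<le> 2 * norm ?Z"
      proof -
        have "norm ?U \<le> norm ?Z + norm (?U - ?Z)" using norm_triangle_sub by blast
        also have "\<dots> \<le> norm ?Z + 1 * norm ?Z" using sb[OF E] s1 mult_right_mono[of s 1 "norm ?Z"] by auto
        finally show ?thesis by simp
      qed
      then have "r * norm ?U \<le> (4 * \<eta>) * (2 * norm ?Z)" using r r4 \<eta>(1) by (intro mult_mono) auto
      finally have 1: "norm (?W - ?U) \<le> 16 * \<eta> * norm ?Z" by simp
      have "norm (?W - ?Z) \<le> norm (?W - ?U) + norm (?U - ?Z)" using norm_triangle_ineq[of "?W - ?U" "?U - ?Z"] by simp
      also have "\<dots> \<le> 16 * \<eta> * norm ?Z + s * norm ?Z" using 1 sb[OF E] by simp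
      finally show "norm (?W - ?Z) \<le> (s + 16 * \<eta>) * norm ?Z" by (simp add: algebra_simps)
    qed
    ultimately show "\<rho> \<in> stab_ball C \<epsilon> \<sigma>" using \<rho>S unfolding stab_ball_def by blast
  qed
  then show "\<exists>\<epsilon>'>0. \<epsilon>' < 1/8 \<and> stab_ball C \<epsilon>' \<tau> \<subseteq> stab_ball C \<epsilon> \<sigma>" using \<eta> by blast
qed

lemma stab_ball_center:
  assumes C: "triangulated_category C" and \<sigma>: "\<sigma> \<in> Stab C" and \<epsilon>: "0 < \<epsilon>" "\<epsilon> < 1/8"
  shows "\<sigma> \<in> stab_ball C \<epsilon> \<sigma>"
proof -
  have \<sigma>s: "stability_condition C \<sigma>" using \<sigma> unfolding Stab_def by blast
  have "charge_norm C \<sigma> (\<lambda>x. fst \<sigma> x - fst \<sigma> x) < ennreal (sin (pi * \<epsilon>))"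
    by (rule charge_norm_lessI[of _ _ _ 0, OF _ semistables_nonzero[OF C \<sigma>s]]) (use sin_pi_pos \<epsilon> in auto)
  moreover have "slicing_dist C (snd \<sigma>) (snd \<sigma>) < ennreal \<epsilon>"
    by (rule slicing_dist_lessI[of 0]) (use \<epsilon> in \<open>auto intro: slices_base\<close>)
  ultimately show ?thesis unfolding stab_ball_def using \<sigma> by blast
qed

section \<open>Semiorthogonal decompositions\<close>

locale semiorthogonal = triangulated_category +
  fixes D1 D2 :: "'a set"
  assumes sod: "semiorthogonal_decomposition C D1 D2"

sublocale semiorthogonal \<subseteq> D1: triangulated_sub C D1
  using sod by unfold_locales (simp add: semiorthogonal_decomposition_def)

sublocale semiorthogonal \<subseteq> D2: triangulated_sub C D2
  using sod by unfold_locales (simp add: semiorthogonal_decomposition_def)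

context semiorthogonal
begin

abbreviation (input) "lam \<equiv> lambda1 C D1 D2"
abbreviation (input) "rho \<equiv> rho2 C D1 D2"

lemma D21_orth: "X \<in> D2 \<Longrightarrow> Y \<in> D1 \<Longrightarrow> orth C X Y"
  using sod by (simp add: semiorthogonal_decomposition_def orth_def)

lemma decomposition_unique:
  assumes "tri C E2 E E1" "E2 \<in> D2" "E1 \<in> D1" "tri C F2 E F1" "F2 \<in> D2" "F1 \<in> D1"
  shows "isomorphic C E1 F1" "isomorphic C E2 F2"
  using tri_unique_right[OF assms(1,4)] tri_unique_left[OF assms(1,4)] assms D21_orth D2.S_Sh by blast+

lemma decomposition_exists: "E \<in> Obj C \<Longrightarrow> \<exists>E2\<in>D2. \<exists>E1\<in>D1. tri C E2 E E1"
  using sod by (simp add: semiorthogonal_decomposition_def tri_def)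

lemma lambda1_rho2:
  assumes "E \<in> Obj C"
  shows "lam E \<in> D1" "rho E \<in> D2" "tri C (rho E) E (lam E)"
proof -
  have "lam E \<in> D1 \<and> (\<exists>E2\<in>D2. \<exists>f g h. Tri C E2 E (lam E) f g h)"
    unfolding lambda1_def by (rule someI_ex) (use decomposition_exists[OF assms] in \<open>unfold tri_def, blast\<close>)
  then obtain F2 where l: "lam E \<in> D1" "F2 \<in> D2" "tri C F2 E (lam E)" unfolding tri_def by blast
  have "rho E \<in> D2 \<and> (\<exists>E1\<in>D1. \<exists>f g h. Tri C (rho E) E E1 f g h)"
    unfolding rho2_def by (rule someI_ex) (use decomposition_exists[OF assms] in \<open>unfold tri_def, blast\<close>)
  then obtain F1 where r: "rho E \<in> D2" "F1 \<in> D1" "tri C (rho E) E F1" unfolding tri_def by blast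
  show "lam E \<in> D1" "rho E \<in> D2" using l r by auto
  have "isomorphic C F2 (rho E)" by (rule decomposition_unique(2)[OF l(3,2,1) r(3,1,2)])
  then show "tri C (rho E) E (lam E)"
    by (rule tri_iso[OF l(3)]) (use isomorphic_refl assms D1.S_Obj[OF l(1)] in auto)
qed

lemma lambda1_rho2_iso:
  assumes "tri C E2 E E1" "E2 \<in> D2" "E1 \<in> D1"
  shows "isomorphic C E1 (lam E)" "isomorphic C E2 (rho E)"
  using decomposition_unique[OF assms] lambda1_rho2 tri_Obj[OF assms(1)] by blast+

lemma decomposition_swap:
  assumes "X1 \<in> D1" "Z2 \<in> D2" "tri C X1 B Z2" shows "tri C Z2 B X1"
  using tri_swap[OF assms(3)] D21_orth[OF assms(2) D1.S_Sh[OF assms(1)]] .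

text \<open>
  Exactness of the two projections without their functoriality: starting from the projections of \<open>X\<close> and \<open>Z\<close>,
  octahedra rearrange the four pieces of \<open>Y\<close> so that those of \<open>D2\<close> come first. The pieces \<open>rho Z\<close> and \<open>lam X\<close> can be swapped
  because there are no maps from \<open>D2\<close> to \<open>D1\<close>.
\<close>

lemma lambda1_rho2_tri:
  assumes "tri C X Y Z"
  shows "tri C (lam X) (lam Y) (lam Z)" "tri C (rho X) (rho Y) (rho Z)"
proof -
  note o = tri_Obj[OF assms]
  note X = lambda1_rho2[OF o(1)] and Z = lambda1_rho2[OF o(3)]
  obtain A where A: "tri C (rho X) Y A" "tri C (lam X) A Z" using tri_octahedral[OF X(3) assms] by blast
  obtain B where B: "tri C (lam X) B (rho Z)" "tri C B A (lam Z)" using tri_octahedral'[OF A(2) Z(3)] by blast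
  have B': "tri C (rho Z) B (lam X)" by (rule decomposition_swap[OF X(1) Z(2) B(1)])
  obtain G where G: "tri C (rho Z) A G" "tri C (lam X) G (lam Z)" using tri_octahedral[OF B' B(2)] by blast
  obtain Y2 where Y2: "tri C (rho X) Y2 (rho Z)" "tri C Y2 Y G" using tri_octahedral'[OF A(1) G(1)] by blast
  obtain Y2' where Y2': "Y2' \<in> D2" "isomorphic C Y2 Y2'" using D2.S_ext[OF Y2(1) X(2) Z(2)] by blast
  obtain G' where G': "G' \<in> D1" "isomorphic C G G'" using D1.S_ext[OF G(2) X(1) Z(1)] by blast
  have "tri C Y2' Y G'" by (rule tri_iso[OF Y2(2) Y2'(2) isomorphic_refl[OF o(2)] G'(2)])
  note iso = lambda1_rho2_iso[OF this Y2'(1) G'(1)]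
  have "isomorphic C G (lam Y)" "isomorphic C Y2 (rho Y)"
    using isomorphic_trans[OF G'(2) iso(1)] isomorphic_trans[OF Y2'(2) iso(2)] by auto
  then show "tri C (lam X) (lam Y) (lam Z)" "tri C (rho X) (rho Y) (rho Z)"
    using tri_iso_middle[OF G(2)] tri_iso_middle[OF Y2(1)] by auto
qed

lemma rho2_D1: "A \<in> D1 \<Longrightarrow> is_zero C (rho A)" and lambda1_D1: "A \<in> D1 \<Longrightarrow> isomorphic C A (lam A)"
proof -
  assume A: "A \<in> D1"
  obtain O' where O': "O' \<in> D2" "is_zero C O'" using D2.S_zero by blast
  have "tri C O' A A" by (rule tri_zero_left[OF D1.S_Obj[OF A] O'(2)])
  note iso = lambda1_rho2_iso[OF this O'(1) A]
  show "is_zero C (rho A)" "isomorphic C A (lam A)" using is_zero_iso[OF iso(2) O'(2)] iso(1) by auto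
qed

lemma lambda1_D2: "A \<in> D2 \<Longrightarrow> is_zero C (lam A)" and rho2_D2: "A \<in> D2 \<Longrightarrow> isomorphic C A (rho A)"
proof -
  assume A: "A \<in> D2"
  obtain O' where O': "O' \<in> D1" "is_zero C O'" using D1.S_zero by blast
  have "tri C A A O'" by (rule tri_zero_right[OF D2.S_Obj[OF A] O'(2)])
  note iso = lambda1_rho2_iso[OF this A O'(1)]
  show "is_zero C (lam A)" "isomorphic C A (rho A)" using is_zero_iso[OF iso(1) O'(2)] iso(2) by auto
qed

end

lemma (in preslicing) hn_bounded: "hn C P J E \<Longrightarrow> \<exists>lo hi. hn C P (J \<inter> {lo<..hi}) E"
proof (induction rule: hn.induct)
  case (zero E J) then show ?case using hn_zero by blast
next
  case (step J \<psi> K B E)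
  then obtain lo hi where K: "hn C P (J \<inter> {\<psi><..} \<inter> {lo<..hi}) K" by blast
  have "hn C P (J \<inter> {min lo (\<psi> - 1)<..max hi \<psi>}) E"
  proof (rule hn_step[OF _ _ step.hyps(3-5)])
    show "hn C P (J \<inter> {min lo (\<psi> - 1)<..max hi \<psi>} \<inter> {\<psi><..}) K" by (rule hn_mono[OF K]) auto
  qed (use step.hyps(2) in auto)
  then show ?case by blast
qed

lemma polar_form:
  fixes w :: complex
  obtains \<phi> where "x < \<phi>" "\<phi> \<le> x + 2" "w = of_real (norm w) * cis (pi * \<phi>)"
proof -
  define \<phi>0 where "\<phi>0 = Arg w / pi"
  define j where "j = \<lceil>(\<phi>0 - x) / 2\<rceil> - 1"
  have "real_of_int j = of_int \<lceil>(\<phi>0 - x) / 2\<rceil> - 1" unfolding j_def by simp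
  then have j: "of_int j < (\<phi>0 - x) / 2" "(\<phi>0 - x) / 2 \<le> of_int j + 1" using ceiling_correct[of "(\<phi>0 - x) / 2"] by linarith+
  have "cis (pi * (\<phi>0 - 2 * of_int j)) = cis (Arg w) * cis (2 * pi * of_int (- j))"
    unfolding cis_mult \<phi>0_def by (simp add: algebra_simps)
  also have "cis (2 * pi * of_int (- j)) = 1" by (rule cis_multiple_2pi) simp
  finally have "cis (pi * (\<phi>0 - 2 * of_int j)) = cis (Arg w)" by simp
  moreover have "w = of_real (norm w) * cis (Arg w)" using rcis_cmod_Arg[of w] by (simp add: rcis_def)
  ultimately have "w = of_real (norm w) * cis (pi * (\<phi>0 - 2 * of_int j))" by simp
  then show thesis by (rule that[rotated 2]) (use j in auto)
qed

section \<open>Gluing stability conditions\<close>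

locale gluing = semiorthogonal C D1 D2 +
  S1: stable_category "full_sub C D1" P1 z1 + S2: stable_category "full_sub C D2" P2 z2
  for C :: "('a, 'b) tricat" (structure) and D1 D2 P1 P2 z1 z2 +
  fixes a k :: real
  assumes a: "0 < a" "a < 1" and k_pos: "0 < k"
    and z1_lower: "\<lbrakk>A \<in> P1 \<phi>; \<not> is_zero C A\<rbrakk> \<Longrightarrow> k \<le> norm (z1 A)"
    and z2_lower: "\<lbrakk>A \<in> P2 \<phi>; \<not> is_zero C A\<rbrakk> \<Longrightarrow> k \<le> norm (z2 A)"
    and hom_0: "\<lbrakk>0 < \<phi>; \<psi> \<le> 1; A \<in> P1 \<phi>; B \<in> P2 \<psi>\<rbrakk> \<Longrightarrow> orth C A B"
    and hom_a: "\<lbrakk>a < \<phi>; \<psi> \<le> a + 1; A \<in> P1 \<phi>; B \<in> P2 \<psi>\<rbrakk> \<Longrightarrow> orth C A B"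
begin

abbreviation "Sl1 \<equiv> slices (full_sub C D1) P1"
abbreviation "Sl2 \<equiv> slices (full_sub C D2) P2"

text \<open>The cut points \<open>\<dots>, 0, a, 1, a + 1, 2, \<dots>\<close>.\<close>

definition cutpt :: "int \<Rightarrow> real" where
  "cutpt n = of_int (n div 2) + (if even n then 0 else a)"

text \<open>The objects whose two components have phases in \<open>I\<close>.\<close>

definition glued_slices :: "real set \<Rightarrow> 'a set" where
  "glued_slices I = {E \<in> Obj C. lam E \<in> Sl1 I \<and> rho E \<in> Sl2 I}"

definition charge :: "'a \<Rightarrow> complex" where
  "charge E = z1 (lam E) + z2 (rho E)"

lemma Sl1_D1: "E \<in> Sl1 I \<Longrightarrow> E \<in> D1" and Sl2_D2: "E \<in> Sl2 I \<Longrightarrow> E \<in> D2"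
  using S1.slices_Obj S2.slices_Obj by simp_all

lemma P1_D1: "A \<in> P1 \<phi> \<Longrightarrow> A \<in> D1" and P2_D2: "A \<in> P2 \<phi> \<Longrightarrow> A \<in> D2"
  using S1.P_Obj S2.P_Obj by simp_all

lemma glued_slicesI:
  assumes "tri C E2 E E1" "E2 \<in> Sl2 I" "E1 \<in> Sl1 I" "I \<noteq> {}" shows "E \<in> glued_slices I"
proof -
  have D: "E2 \<in> D2" "E1 \<in> D1" using assms Sl1_D1 Sl2_D2 by auto
  note iso = lambda1_rho2_iso[OF assms(1) D] and o = tri_Obj(2)[OF assms(1)]
  have "isomorphic (full_sub C D1) E1 (lam E)" "isomorphic (full_sub C D2) E2 (rho E)"
    using iso D lambda1_rho2[OF o] by (simp_all add: D1.isomorphic_full_sub D2.isomorphic_full_sub)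
  then have "lam E \<in> Sl1 I" "rho E \<in> Sl2 I"
    using S1.slices_iso[OF assms(3) _ assms(4)] S2.slices_iso[OF assms(2) _ assms(4)] by auto
  then show ?thesis using o unfolding glued_slices_def by simp
qed

lemma glued_slicesD:
  assumes "E \<in> glued_slices I"
  shows "E \<in> Obj C" "lam E \<in> Sl1 I" "rho E \<in> Sl2 I" "tri C (rho E) E (lam E)"
  using assms lambda1_rho2 unfolding glued_slices_def by auto

lemma Sl_orth_cross:
  assumes X: "X \<in> Sl1 I" and Y: "Y \<in> Sl2 J"
    and orth: "\<And>\<phi> \<psi> A B. \<lbrakk>\<phi> \<in> I; \<psi> \<in> J; A \<in> P1 \<phi>; B \<in> P2 \<psi>\<rbrakk> \<Longrightarrow> orth C A B"
  shows "orth C X Y"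
  using X
proof (induction rule: slices_induct)
  case (base \<phi> A)
  show ?case
    using Y
  proof (induction rule: slices_induct)
    case (base \<psi> B) then show ?case using orth \<open>\<phi> \<in> I\<close> \<open>A \<in> P1 \<phi>\<close> by simp
  next
    case (ext X Y Z)
    then have "tri C X Y Z" by simp
    then show ?case using tri_orth_left ext.IH D1.S_Obj[OF P1_D1[OF base(2)]] by simp
  qed
next
  case (ext U W Z)
  then have "tri C U W Z" by simp
  then show ?case using tri_orth_right ext.IH D2.S_Obj[OF Sl2_D2[OF Y]] by simp
qed

lemma hom_shift:
  fixes j :: int
  shows "(\<forall>A\<in>P1 (\<phi> + of_int j). \<forall>B\<in>P2 (\<psi> + of_int j). orth C A B) \<longleftrightarrow> (\<forall>A\<in>P1 \<phi>. \<forall>B\<in>P2 \<psi>. orth C A B)"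
proof -
  have per: "(\<forall>A\<in>P1 (\<phi> + (x + 1)). \<forall>B\<in>P2 (\<psi> + (x + 1)). orth C A B) \<longleftrightarrow> (\<forall>A\<in>P1 (\<phi> + x). \<forall>B\<in>P2 (\<psi> + x). orth C A B)" for x
  proof (intro iffI ballI)
    fix A B assume l: "\<forall>A\<in>P1 (\<phi> + (x + 1)). \<forall>B\<in>P2 (\<psi> + (x + 1)). orth C A B" and A: "A \<in> P1 (\<phi> + x)" and B: "B \<in> P2 (\<psi> + x)"
    have "Sh C A \<in> P1 (\<phi> + (x + 1))" "Sh C B \<in> P2 (\<psi> + (x + 1))"
      using S1.P_Sh[of A "\<phi> + x"] S2.P_Sh[of B "\<psi> + x"] P1_D1[OF A] P2_D2[OF B] A B by (simp_all add: add.assoc)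
    then have "orth C (Sh C A) (Sh C B)" using l by simp
    then show "orth C A B" using orth_Sh D1.S_Obj[OF P1_D1[OF A]] D2.S_Obj[OF P2_D2[OF B]] by simp
  next
    fix A B assume r: "\<forall>A\<in>P1 (\<phi> + x). \<forall>B\<in>P2 (\<psi> + x). orth C A B" and A: "A \<in> P1 (\<phi> + (x + 1))" and B: "B \<in> P2 (\<psi> + (x + 1))"
    note oA = D1.S_Obj[OF P1_D1[OF A]] and oB = D2.S_Obj[OF P2_D2[OF B]]
    have "unshift C A \<in> P1 (\<phi> + x)" "unshift C B \<in> P2 (\<psi> + x)"
      using S1.P_Sh[of "unshift C A" "\<phi> + x"] S2.P_Sh[of "unshift C B" "\<psi> + x"] D1.S_unshift[OF P1_D1[OF A]]
        D2.S_unshift[OF P2_D2[OF B]] A B oA oB by (simp_all add: add.assoc)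
    then have "orth C (unshift C A) (unshift C B)" using r by simp
    then show "orth C A B" using orth_Sh[of "unshift C A" "unshift C B"] oA oB by simp
  qed
  show ?thesis
    using int_periodic[of "\<lambda>x. \<forall>A\<in>P1 (\<phi> + x). \<forall>B\<in>P2 (\<psi> + x). orth C A B", OF per, of 0 j] by simp
qed

text \<open>The two vanishing hypotheses, propagated to all cut points by the shift.\<close>

lemma hom_cut:
  assumes "cutpt n < \<phi>" "\<psi> \<le> cutpt n + 1" "A \<in> P1 \<phi>" "B \<in> P2 \<psi>" shows "orth C A B"
proof -
  have "orth C A' B'" if AB': "A' \<in> P1 (\<phi> + of_int (- (n div 2)))" "B' \<in> P2 (\<psi> + of_int (- (n div 2)))" for A' B'
  proof (cases "even n")
    case True
    then show ?thesis using hom_0[OF _ _ AB'] assms(1,2) by (simp add: cutpt_def)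
  next
    case False
    then show ?thesis using hom_a[OF _ _ AB'] assms(1,2) by (simp add: cutpt_def)
  qed
  then show ?thesis using hom_shift[of \<phi> "- (n div 2)" \<psi>] assms(3,4) by simp
qed

lemma cut_step: "cutpt n < cutpt (n + 1)" "cutpt (n + 1) < cutpt n + 1" "cutpt (n + 2) = cutpt n + 1"
proof -
  have "even n \<Longrightarrow> (n + 1) div 2 = n div 2" "odd n \<Longrightarrow> (n + 1) div 2 = n div 2 + 1" "(n + 2) div 2 = n div 2 + 1" by presburger+
  then show "cutpt n < cutpt (n + 1)" "cutpt (n + 1) < cutpt n + 1" "cutpt (n + 2) = cutpt n + 1"
    unfolding cutpt_def using a by (cases "even n"; simp)+
qed

lemma cut_gap: "cutpt (n + 1) - cutpt n \<le> max a (1 - a)"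
proof -
  have "even n \<Longrightarrow> (n + 1) div 2 = n div 2" "odd n \<Longrightarrow> (n + 1) div 2 = n div 2 + 1" by presburger+
  then show ?thesis unfolding cutpt_def by (cases "even n") auto
qed

text \<open>
  Truncate both components. The extension of \<open>X1\<close> by \<open>Y2\<close> that occurs in the middle splits because
  \<open>Hom (X1, Y2[1]) = 0\<close>, so that these two pieces may be exchanged.
\<close>

lemma glued_cut:
  assumes "E \<in> Obj C" shows "\<exists>X\<in>glued_slices {cutpt n<..}. \<exists>Y\<in>glued_slices {..cutpt n}. tri C X E Y"
proof -
  note E = lambda1_rho2[OF assms]
  obtain X2 Y2 where 2: "tri (full_sub C D2) X2 (rho E) Y2" "X2 \<in> Sl2 {cutpt n<..}" "Y2 \<in> Sl2 {..cutpt n}"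
    using S2.slices_cut[of "rho E" "cutpt n"] E(2) by auto
  obtain X1 Y1 where 1: "tri (full_sub C D1) X1 (lam E) Y1" "X1 \<in> Sl1 {cutpt n<..}" "Y1 \<in> Sl1 {..cutpt n}"
    using S1.slices_cut[of "lam E" "cutpt n"] E(1) by auto
  have t: "tri C X2 (rho E) Y2" "tri C X1 (lam E) Y1" using 1 2 by auto
  obtain A where A: "tri C X2 E A" "tri C Y2 A (lam E)" using tri_octahedral[OF t(1) E(3)] by blast
  obtain B where B: "tri C Y2 B X1" "tri C B A Y1" using tri_octahedral'[OF A(2) t(2)] by blast
  have "Sh C Y2 \<in> Sl2 ((\<lambda>x. x + 1) ` {..cutpt n})" using S2.slices_Sh[OF 2(3)] by simp
  then have "orth C X1 (Sh C Y2)"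
  proof (rule Sl_orth_cross[OF 1(2)])
    fix \<phi> \<psi> A B assume "\<phi> \<in> {cutpt n<..}" "\<psi> \<in> (\<lambda>x. x + 1) ` {..cutpt n}" "A \<in> P1 \<phi>" "B \<in> P2 \<psi>"
    then show "orth C A B" by (intro hom_cut[of n \<phi> \<psi> A B]) auto
  qed
  \<comment> \<open>The order of the pieces of \<open>E\<close> changes from \<open>X2, Y2, X1, Y1\<close> to \<open>X2, X1, Y2, Y1\<close>.\<close>
  then have B': "tri C X1 B Y2" by (rule tri_swap[OF B(1)])
  obtain Y where Y: "tri C X1 A Y" "tri C Y2 Y Y1" using tri_octahedral[OF B' B(2)] by blast
  obtain X where X: "tri C X2 X X1" "tri C X E Y" using tri_octahedral'[OF A(1) Y(1)] by blast
  have "X \<in> glued_slices {cutpt n<..}" by (rule glued_slicesI[OF X(1) 2(2) 1(2)]) (simp add: gt_ex)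
  moreover have "Y \<in> glued_slices {..cutpt n}" by (rule glued_slicesI[OF Y(2) 2(3) 1(3)]) simp
  ultimately show ?thesis using X(2) by blast
qed

lemma unshift_full_sub: "X \<in> D1 \<Longrightarrow> unshift (full_sub C D1) X = unshift C X"
  "X \<in> D2 \<Longrightarrow> unshift (full_sub C D2) X = unshift C X"
proof -
  have "unshift (full_sub C S) X = unshift C X"
    if "triangulated_sub C S" "X \<in> S" for S X
  proof -
    interpret S: triangulated_sub C S by fact
    interpret F: triangulated_category "full_sub C S" by (rule S.triangulated_full_sub)
    have "Sh C (unshift (full_sub C S) X) = X" "unshift (full_sub C S) X \<in> S"
      using F.Sh_unshift[of X] F.unshift_Obj[of X] that by simp_all
    then show ?thesis using unshift_Sh[OF S.S_Obj] by metis
  qed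
  then show "X \<in> D1 \<Longrightarrow> unshift (full_sub C D1) X = unshift C X"
    "X \<in> D2 \<Longrightarrow> unshift (full_sub C D2) X = unshift C X"
    using D1.triangulated_sub_axioms D2.triangulated_sub_axioms by blast+
qed

lemma glued_slices_Sh:
  assumes "E \<in> glued_slices I" "I \<noteq> {}" "(\<lambda>x. x + 1) ` I \<subseteq> J" shows "Sh C E \<in> glued_slices J"
proof -
  note E = glued_slicesD[OF assms(1)]
  have "Sh C (lam E) \<in> Sl1 J" "Sh C (rho E) \<in> Sl2 J"
    using slices_monoD[OF S1.slices_Sh[OF E(2)] assms(3)] slices_monoD[OF S2.slices_Sh[OF E(3)] assms(3)] by simp_all
  then show ?thesis by (intro glued_slicesI[OF tri_Sh[OF E(4)]]) (use assms in auto)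
qed

lemma glued_slices_unshift:
  assumes "E \<in> glued_slices I" "I \<noteq> {}" "(\<lambda>x. x - 1) ` I \<subseteq> J" shows "unshift C E \<in> glued_slices J"
proof -
  note E = glued_slicesD[OF assms(1)]
  have "unshift C (lam E) \<in> Sl1 J" "unshift C (rho E) \<in> Sl2 J"
    using slices_monoD[OF S1.slices_unshift[OF E(2)] assms(3)] slices_monoD[OF S2.slices_unshift[OF E(3)] assms(3)]
      unshift_full_sub lambda1_rho2[OF E(1)] by simp_all
  moreover have "tri C (unshift C (rho E)) (unshift C E) (unshift C (lam E))"
    using tri_Sh_iff[of "unshift C (rho E)" "unshift C E" "unshift C (lam E)"] tri_Obj[OF E(4)] E(4) by simp
  ultimately show ?thesis by (intro glued_slicesI) (use assms in auto)
qed

lemma charge_tri: "tri C X Y W \<Longrightarrow> charge Y = charge X + charge W"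
proof -
  assume T: "tri C X Y W"
  note o = tri_Obj[OF T] and t = lambda1_rho2_tri[OF T]
  have "tri (full_sub C D1) (lam X) (lam Y) (lam W)" "tri (full_sub C D2) (rho X) (rho Y) (rho W)"
    using t lambda1_rho2 o by simp_all
  note z = S1.z_tri[OF this(1)] S2.z_tri[OF this(2)]
  show ?thesis unfolding charge_def z by simp
qed

lemma glued_slices_interval:
  assumes "c < d" shows "glued_slices {c<..d} = glued_slices {c<..} \<inter> glued_slices {..d}"
  unfolding glued_slices_def S1.slices_greaterThanAtMost[OF assms] S2.slices_greaterThanAtMost[OF assms] by blast

lemma charge_zero1: "is_zero C E \<Longrightarrow> E \<in> D1 \<Longrightarrow> z1 E = 0" and charge_zero2: "is_zero C E \<Longrightarrow> E \<in> D2 \<Longrightarrow> z2 E = 0"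
  using S1.z_zero S2.z_zero by (simp_all add: D1.is_zero_full_sub D2.is_zero_full_sub)

lemma nonzero_component: "E \<in> Obj C \<Longrightarrow> \<not> is_zero C E \<Longrightarrow> \<not> is_zero C (lam E) \<or> \<not> is_zero C (rho E)"
  using tri_zero2[OF lambda1_rho2(3)] by blast

definition lower :: real where "lower = k * cos (pi * (max a (1 - a) / 2))"

lemma cos_gap_pos: "0 < cos (pi * (max a (1 - a) / 2))"
proof (rule cos_gt_zero)
  show "pi * (max a (1 - a) / 2) < pi / 2" using a by simp
qed (use a in simp)

lemma cos_mid_cell:
  assumes "cutpt n < \<phi>" "\<phi> \<le> cutpt (n + 1)"
  shows "cos (pi * (max a (1 - a) / 2)) \<le> inner (cis (pi * ((cutpt n + cutpt (n + 1)) / 2))) (cis (pi * \<phi>))"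
proof -
  have "\<bar>\<phi> - (cutpt n + cutpt (n + 1)) / 2\<bar> \<le> max a (1 - a) / 2"
    using assms cut_gap[of n] unfolding abs_le_iff by (simp add: field_simps)
  then have "pi * \<bar>\<phi> - (cutpt n + cutpt (n + 1)) / 2\<bar> \<le> pi * (max a (1 - a) / 2)" by (intro mult_left_mono) auto
  moreover have "pi * \<bar>\<phi> - (cutpt n + cutpt (n + 1)) / 2\<bar> = \<bar>pi * \<phi> - pi * ((cutpt n + cutpt (n + 1)) / 2)\<bar>"
    by (simp only: right_diff_distrib[symmetric] abs_mult abs_of_pos[OF pi_gt_zero])
  ultimately have "\<bar>pi * \<phi> - pi * ((cutpt n + cutpt (n + 1)) / 2)\<bar> \<le> pi * (max a (1 - a) / 2)" by simp
  moreover have "pi * (max a (1 - a) / 2) \<le> pi" using a by simp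
  ultimately have "cos (pi * (max a (1 - a) / 2)) \<le> cos \<bar>pi * \<phi> - pi * ((cutpt n + cutpt (n + 1)) / 2)\<bar>"
    by (intro cos_monotone_0_pi_le) auto
  then show ?thesis unfolding inner_cis by simp
qed

text \<open>
  The positive cone of a cell is closed under sums, so \<open>z1 (lam E) + z2 (rho E)\<close> stays in it; since the
  cell is narrower than \<open>1\<close>, the projection to its middle direction bounds the modulus from below.
\<close>

lemma charge_in_sector:
  assumes E: "E \<in> glued_slices {cutpt n<..cutpt (n + 1)}" and nz: "\<not> is_zero C E"
  shows "\<exists>m\<ge>lower. \<exists>\<phi>. cutpt n < \<phi> \<and> \<phi> \<le> cutpt (n + 1) \<and> charge E = of_real m * cis (pi * \<phi>)"
proof -
  note ED = glued_slicesD[OF E] and c = cut_step[of n]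
  let ?I = "{cutpt n<..cutpt (n + 1)}"
  have D: "lam E \<in> D1" "rho E \<in> D2" using lambda1_rho2 ED(1) by auto
  have nzc: "\<not> is_zero C (lam E) \<or> \<not> is_zero C (rho E)" by (rule nonzero_component[OF ED(1) nz])
  define u where "u = cis (pi * ((cutpt n + cutpt (n + 1)) / 2))"
  have l0: "0 < lower" unfolding lower_def using k_pos cos_gap_pos by simp
  have 1: "lower \<le> inner u (z1 (lam E))" if "\<not> is_zero C (lam E)"
    unfolding lower_def u_def
    by (rule S1.slices_inner_lower[OF ED(2)])
      (use that cos_mid_cell z1_lower k_pos cos_gap_pos D in \<open>auto simp: D1.is_zero_full_sub P1_D1\<close>)
  have 2: "lower \<le> inner u (z2 (rho E))" if "\<not> is_zero C (rho E)"
    unfolding lower_def u_def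
    by (rule S2.slices_inner_lower[OF ED(3)])
      (use that cos_mid_cell z2_lower k_pos cos_gap_pos D in \<open>auto simp: D2.is_zero_full_sub P2_D2\<close>)
  have "lower \<le> inner u (charge E)"
    using 1 2 nzc l0 charge_zero1[OF _ D(1)] charge_zero2[OF _ D(2)] unfolding charge_def
    by (cases "is_zero C (lam E)"; cases "is_zero C (rho E)") (auto simp: inner_add_right)
  also have "\<dots> \<le> norm (charge E)" using norm_cauchy_schwarz[of u "charge E"] unfolding u_def by simp
  finally have norm: "lower \<le> norm (charge E)" .
  have sin1: "0 < inner (cis (pi * (cutpt n + 1/2))) (cis (pi * \<phi>))" if "\<phi> \<in> ?I" for \<phi>
    unfolding inner_cis_orthogonal by (rule sin_pi_pos) (use that c in auto)
  have sin2: "0 \<le> inner (- cis (pi * (cutpt (n + 1) + 1/2))) (cis (pi * \<phi>))" if "\<phi> \<in> ?I" for \<phi>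
  proof -
    have "0 \<le> sin (pi * (cutpt (n + 1) - \<phi>))"
      using that c sin_pi_pos[of "cutpt (n + 1) - \<phi>"] by (cases "\<phi> = cutpt (n + 1)") auto
    moreover have "pi * (\<phi> - cutpt (n + 1)) = - (pi * (cutpt (n + 1) - \<phi>))" by (simp add: algebra_simps)
    ultimately show ?thesis unfolding inner_minus_left inner_cis_orthogonal by (simp only: sin_minus minus_minus)
  qed
  have "0 < inner (cis (pi * (cutpt n + 1/2))) (charge E)"
  proof -
    have "0 < inner (cis (pi * (cutpt n + 1/2))) (z1 (lam E))" if "\<not> is_zero C (lam E)"
      by (rule S1.slices_inner_pos[OF ED(2) sin1]) (use that in \<open>auto simp: D1.is_zero_full_sub\<close>)
    moreover have "0 < inner (cis (pi * (cutpt n + 1/2))) (z2 (rho E))" if "\<not> is_zero C (rho E)"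
      by (rule S2.slices_inner_pos[OF ED(3) sin1]) (use that in \<open>auto simp: D2.is_zero_full_sub\<close>)
    ultimately show ?thesis
      using nzc charge_zero1[OF _ D(1)] charge_zero2[OF _ D(2)] unfolding charge_def
      by (cases "is_zero C (lam E)"; cases "is_zero C (rho E)") (auto simp: inner_add_right)
  qed
  moreover have "0 \<le> inner (- cis (pi * (cutpt (n + 1) + 1/2))) (charge E)"
    unfolding charge_def inner_add_right
    using S1.slices_inner_nonneg[OF ED(2) sin2] S2.slices_inner_nonneg[OF ED(3) sin2] by simp
  moreover obtain \<phi> where \<phi>: "cutpt n < \<phi>" "\<phi> \<le> cutpt n + 2" "charge E = of_real (norm (charge E)) * cis (pi * \<phi>)"
    by (rule polar_form)
  have inn: "inner (cis (pi * (x + 1/2))) (charge E) = norm (charge E) * sin (pi * (\<phi> - x))" for x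
  proof -
    have "charge E = norm (charge E) *\<^sub>R cis (pi * \<phi>)" using \<phi>(3) by (simp add: scaleR_conv_of_real)
    then have "inner (cis (pi * (x + 1/2))) (charge E) = inner (cis (pi * (x + 1/2))) (norm (charge E) *\<^sub>R cis (pi * \<phi>))" by simp
    then show ?thesis unfolding inner_scaleR_right inner_cis_orthogonal .
  qed
  have np: "0 < norm (charge E)" using norm l0 by linarith
  ultimately have s: "0 < sin (pi * (\<phi> - cutpt n))" "sin (pi * (\<phi> - cutpt (n + 1))) \<le> 0"
    unfolding inner_minus_left inn by (auto simp: zero_less_mult_iff mult_le_0_iff)
  have "\<phi> < cutpt n + 1"
  proof (rule ccontr)
    assume "\<not> \<phi> < cutpt n + 1"
    then have x: "0 \<le> \<phi> - cutpt n - 1" "\<phi> - cutpt n - 1 \<le> 1" using \<phi> by auto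
    have "pi * (\<phi> - cutpt n - 1) \<le> pi * 1" using x by (intro mult_left_mono) auto
    then have "0 \<le> sin (pi * (\<phi> - cutpt n - 1))" using x by (intro sin_ge_zero) auto
    moreover have "pi * (\<phi> - cutpt n) = pi * (\<phi> - cutpt n - 1) + pi" by (simp add: algebra_simps)
    ultimately have "sin (pi * (\<phi> - cutpt n)) \<le> 0" by (simp only: sin_periodic_pi)
    then show False using s by simp
  qed
  moreover have "\<phi> \<le> cutpt (n + 1)"
  proof (rule ccontr)
    assume "\<not> \<phi> \<le> cutpt (n + 1)"
    then have "0 < sin (pi * (\<phi> - cutpt (n + 1)))" using \<open>\<phi> < cutpt n + 1\<close> c by (intro sin_pi_pos) auto
    then show False using s by simp
  qed
  ultimately show ?thesis using \<phi> norm by blast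
qed

text \<open>
  Reasonableness enters through \<open>lower\<close>, which is positive because the cells are narrower than \<open>1\<close>.
\<close>

lemma t_structure_chain_glued:
  "t_structure_chain C (\<lambda>n. glued_slices {cutpt n<..}) (\<lambda>n. glued_slices {..cutpt n}) cutpt charge lower"
proof unfold_locales
  fix E E' n
  show "E \<in> glued_slices {cutpt n<..} \<Longrightarrow> E \<in> Obj C" "E \<in> glued_slices {..cutpt n} \<Longrightarrow> E \<in> Obj C"
    using glued_slicesD by blast+
  show "E \<in> glued_slices {cutpt n<..} \<Longrightarrow> isomorphic C E E' \<Longrightarrow> E' \<in> glued_slices {cutpt n<..}"
    using glued_slicesI[OF tri_iso_middle] glued_slicesD gt_ex by fastforce
  show "E \<in> glued_slices {..cutpt n} \<Longrightarrow> isomorphic C E E' \<Longrightarrow> E' \<in> glued_slices {..cutpt n}"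
    using glued_slicesI[OF tri_iso_middle] glued_slicesD by fastforce
  show "\<exists>X\<in>glued_slices {cutpt n<..}. \<exists>Y\<in>glued_slices {..cutpt n}. tri C X E Y" if "E \<in> Obj C"
    by (rule glued_cut[OF that])
  show "glued_slices {cutpt (n + 1)<..} \<subseteq> glued_slices {cutpt n<..}" "glued_slices {..cutpt n} \<subseteq> glued_slices {..cutpt (n + 1)}"
    unfolding glued_slices_def using cut_step(1)[of n]
      slices_mono[of "{cutpt (n + 1)<..}" "{cutpt n<..}"] slices_mono[of "{..cutpt n}" "{..cutpt (n + 1)}"] by fastforce+
  show "E \<in> glued_slices {cutpt n<..} \<Longrightarrow> Sh C E \<in> glued_slices {cutpt (n + 2)<..}"
    by (erule glued_slices_Sh) (auto simp: cut_step(3) gt_ex)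
  show "E \<in> glued_slices {..cutpt n} \<Longrightarrow> Sh C E \<in> glued_slices {..cutpt (n + 2)}"
    by (erule glued_slices_Sh) (auto simp: cut_step(3))
  have c: "cutpt n = cutpt (n - 2) + 1" using cut_step(3)[of "n - 2"] by simp
  show "E \<in> glued_slices {cutpt n<..} \<Longrightarrow> unshift C E \<in> glued_slices {cutpt (n - 2)<..}"
    by (erule glued_slices_unshift) (auto simp: c gt_ex)
  show "E \<in> glued_slices {..cutpt n} \<Longrightarrow> unshift C E \<in> glued_slices {..cutpt (n - 2)}"
    by (erule glued_slices_unshift) (auto simp: c)
  show "cutpt n < cutpt (n + 1)" "cutpt (n + 1) < cutpt n + 1" "cutpt (n + 2) = cutpt n + 1" by (rule cut_step)+
  show "0 < lower" unfolding lower_def using k_pos cos_gap_pos by simp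
  show "\<exists>m\<ge>lower. \<exists>\<phi>. cutpt n < \<phi> \<and> \<phi> \<le> cutpt (n + 1) \<and> charge E = of_real m * cis (pi * \<phi>)"
    if "E \<in> glued_slices {cutpt n<..}" "E \<in> glued_slices {..cutpt (n + 1)}" "\<not> is_zero C E"
    by (rule charge_in_sector[OF _ that(3)]) (use that glued_slices_interval cut_step(1) in auto)
next
  fix X Y n assume "X \<in> glued_slices {cutpt n<..}" "Y \<in> glued_slices {..cutpt n}"
  note X = glued_slicesD[OF this(1)] and Y = glued_slicesD[OF this(2)]
  note DX = lambda1_rho2[OF X(1)] and DY = lambda1_rho2[OF Y(1)]
  have "orth C (rho X) (rho Y)" using S2.slices_orth[OF X(3) Y(3)] by simp
  moreover have "orth C (lam X) (lam Y)" using S1.slices_orth[OF X(2) Y(2)] by simp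
  moreover have "orth C (rho X) (lam Y)" by (rule D21_orth[OF DX(2) DY(1)])
  moreover have "orth C (lam X) (rho Y)"
  proof (rule Sl_orth_cross[OF X(2) Y(3)])
    fix \<phi> \<psi> A B assume "\<phi> \<in> {cutpt n<..}" "\<psi> \<in> {..cutpt n}" "A \<in> P1 \<phi>" "B \<in> P2 \<psi>"
    then show "orth C A B" by (intro hom_cut[of n \<phi> \<psi> A B]) auto
  qed
  ultimately have "orth C (rho X) Y" "orth C (lam X) Y"
    using tri_orth_left[OF Y(4)] tri_Obj[OF X(4)] by auto
  then show "orth C X Y" using tri_orth_right[OF X(4) Y(1)] by blast
next
  fix E assume oE: "E \<in> Obj C"
  note E = lambda1_rho2[OF oE]
  obtain lo1 hi1 where 1: "hn (full_sub C D1) P1 {lo1<..hi1} (lam E)"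
    using S1.hn_bounded[OF S1.HN[of "lam E"]] E by auto
  obtain lo2 hi2 where 2: "hn (full_sub C D2) P2 {lo2<..hi2} (rho E)"
    using S2.hn_bounded[OF S2.HN[of "rho E"]] E by auto
  define n where "n = 2 * \<lfloor>min lo1 lo2\<rfloor>"
  define m where "m = 2 * \<lceil>max hi1 hi2\<rceil>"
  have n: "cutpt n \<le> lo1" "cutpt n \<le> lo2" unfolding n_def cutpt_def using of_int_floor_le[of "min lo1 lo2"] by auto
  have "of_int \<lceil>max hi1 hi2\<rceil> = cutpt m" unfolding m_def cutpt_def by simp
  then have m: "hi1 \<le> cutpt m" "hi2 \<le> cutpt m"
    using le_of_int_ceiling[of "max hi1 hi2"] max.cobounded1[of hi1 hi2] max.cobounded2[of hi2 hi1] by linarith+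
  have "lam E \<in> Sl1 {cutpt n<..}" by (rule S1.hn_heart_slices[OF 1]) (use n in \<open>auto simp: gt_ex\<close>)
  moreover have "rho E \<in> Sl2 {cutpt n<..}" by (rule S2.hn_heart_slices[OF 2]) (use n in \<open>auto simp: gt_ex\<close>)
  moreover have "lam E \<in> Sl1 {..cutpt m}" by (rule S1.hn_heart_slices[OF 1]) (use m in auto)
  moreover have "rho E \<in> Sl2 {..cutpt m}" by (rule S2.hn_heart_slices[OF 2]) (use m in auto)
  ultimately show "\<exists>n m. E \<in> glued_slices {cutpt n<..} \<and> E \<in> glued_slices {..cutpt m}"
    using oE unfolding glued_slices_def by blast
next
  show "charge Y = charge X + charge W" if "tri C X Y W" for X Y W by (rule charge_tri[OF that])
qed

end

sublocale gluing \<subseteq> G: t_structure_chain C "\<lambda>n. glued_slices {cutpt n<..}" "\<lambda>n. glued_slices {..cutpt n}" cutpt charge lower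
  by (rule t_structure_chain_glued)

context gluing
begin

lemma Sh_next_cut: "E \<in> glued_slices {cutpt n<..} \<Longrightarrow> Sh C E \<in> glued_slices {cutpt (n + 1)<..}"
  by (rule subsetD[OF G.U_mono[of "n + 1" "n + 2"] G.U_Sh]) simp_all

lemma charge_D1: "A \<in> D1 \<Longrightarrow> charge A = z1 A"
proof -
  assume A: "A \<in> D1"
  obtain O' where O': "O' \<in> D1" "is_zero C O'" using D1.S_zero by blast
  have l: "lam A \<in> D1" "rho A \<in> D2" using lambda1_rho2[OF D1.S_Obj[OF A]] by auto
  have "tri (full_sub C D1) A (lam A) O'" using tri_iso_right[OF lambda1_D1[OF A] O'(2)] A O' l by simp
  then have "z1 (lam A) = z1 A" using S1.z_tri charge_zero1 O' by fastforce
  then show ?thesis unfolding charge_def using charge_zero2[OF rho2_D1[OF A] l(2)] by simp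
qed

lemma charge_D2: "A \<in> D2 \<Longrightarrow> charge A = z2 A"
proof -
  assume A: "A \<in> D2"
  obtain O' where O': "O' \<in> D2" "is_zero C O'" using D2.S_zero by blast
  have l: "lam A \<in> D1" "rho A \<in> D2" using lambda1_rho2[OF D2.S_Obj[OF A]] by auto
  have "tri (full_sub C D2) A (rho A) O'" using tri_iso_right[OF rho2_D2[OF A] O'(2)] A O' l by simp
  then have "z2 (rho A) = z2 A" using S2.z_tri charge_zero2 O' by fastforce
  then show ?thesis unfolding charge_def using charge_zero1[OF lambda1_D2[OF A] l(1)] by simp
qed

lemma Sl1_glued: "A \<in> Sl1 I \<Longrightarrow> I \<noteq> {} \<Longrightarrow> A \<in> glued_slices I"
proof -
  assume A: "A \<in> Sl1 I" "I \<noteq> {}"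
  obtain O' where O': "O' \<in> D2" "is_zero C O'" using D2.S_zero by blast
  have "O' \<in> Sl2 I" by (rule S2.slices_zero) (use O' A in \<open>auto simp: D2.is_zero_full_sub\<close>)
  then show ?thesis by (rule glued_slicesI[OF tri_zero_left[OF D1.S_Obj[OF Sl1_D1[OF A(1)]] O'(2)] _ A])
qed

lemma Sl2_glued: "A \<in> Sl2 I \<Longrightarrow> I \<noteq> {} \<Longrightarrow> A \<in> glued_slices I"
proof -
  assume A: "A \<in> Sl2 I" "I \<noteq> {}"
  obtain O' where O': "O' \<in> D1" "is_zero C O'" using D1.S_zero by blast
  have "O' \<in> Sl1 I" by (rule S1.slices_zero) (use O' A in \<open>auto simp: D1.is_zero_full_sub\<close>)
  then show ?thesis by (rule glued_slicesI[OF tri_zero_right[OF D2.S_Obj[OF Sl2_D2[OF A(1)]] O'(2)] A(1) _ A(2)])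
qed

text \<open>
  A subobject \<open>G\<close> (within the cell) of an object \<open>A\<close> of \<open>D1\<close> has \<open>rho G = 0\<close>, hence is a subobject in
  \<open>D1\<close>; so semistability of \<open>A\<close> in \<open>D1\<close> implies semistability in the ambient category.
\<close>

lemma P1_semistable: "P1 \<phi> \<subseteq> G.semistable \<phi>"
proof
  fix A assume A: "A \<in> P1 \<phi>"
  define n where "n = G.cell_index \<phi>"
  have n: "cutpt n < \<phi>" "\<phi> \<le> cutpt (n + 1)" unfolding n_def by (rule G.cell_index)+
  have D: "A \<in> D1" by (rule P1_D1[OF A])
  have Sl: "A \<in> Sl1 {\<phi>}" by (rule S1.slices_P[OF A]) simp
  have "A \<in> Sl1 {cutpt n<..}" "A \<in> Sl1 {..cutpt (n + 1)}" by (rule slices_monoD[OF Sl]; use n in simp)+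
  then have Ac: "A \<in> G.cell n" unfolding G.cell_def using Sl1_glued gt_ex by auto
  have u: "inner (cis (pi * (\<phi> + 1/2))) (z1 A) = 0"
  proof -
    have "0 \<le> inner (cis (pi * (\<phi> + 1/2))) (z1 A)" "0 \<le> inner (- cis (pi * (\<phi> + 1/2))) (z1 A)"
      by (rule S1.slices_inner_nonneg[OF Sl]; simp add: inner_cis_orthogonal inner_minus_left)+
    then show ?thesis by simp
  qed
  have hA: "G.height \<phi> A = 0" unfolding G.height_def charge_D1[OF D] by (rule u)
  have "G.height \<phi> X \<le> 0" if XB: "tri C X A B" "X \<in> G.cell n" "B \<in> G.cell n" for X B
  proof -
    have X: "X \<in> glued_slices {cutpt n<..}" "X \<in> glued_slices {..cutpt (n + 1)}" and B: "B \<in> glued_slices {..cutpt (n + 1)}"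
      using XB unfolding G.cell_def by auto
    note XD = glued_slicesD[OF X(1)] and X1 = lambda1_rho2[OF glued_slicesD(1)[OF X(1)]]
    have "rho X \<in> glued_slices {cutpt n<..}" by (rule Sl2_glued[OF XD(3)]) (simp add: gt_ex)
    then have "Sh C (rho X) \<in> glued_slices {cutpt (n + 1)<..}" by (rule Sh_next_cut)
    then have "orth C (Sh C (rho X)) B" by (rule G.UV_orth[OF _ B])
    moreover have "orth C (rho X) A" by (rule D21_orth[OF X1(2) D])
    ultimately have "orth C (rho X) X" using tri_orth_left1[OF XB(1) D2.S_Obj[OF X1(2)]] by blast
    moreover have "orth C (Sh C (rho X)) (lam X)" by (rule D21_orth[OF D2.S_Sh[OF X1(2)] X1(1)])
    ultimately have zX: "is_zero C (rho X)" using tri_zero1[OF X1(3)] by blast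
    then have iso: "isomorphic C X (lam X)" by (rule tri_zero_imp_iso'[OF X1(3)])
    have "lam X \<in> Sl1 {..\<phi>}"
      unfolding S1.slices_atMost
    proof (intro conjI allI impI ballI)
      fix \<psi> W assume \<psi>: "\<phi> < \<psi>" and W: "W \<in> P1 \<psi>"
      have oW: "W \<in> Obj C" using D1.S_Obj P1_D1 W by blast
      have "W \<in> Sl1 {cutpt n<..}" by (rule S1.slices_P[OF W]) (use n \<psi> in simp)
      then have "W \<in> glued_slices {cutpt n<..}" by (rule Sl1_glued) (simp add: gt_ex)
      then have "Sh C W \<in> glued_slices {cutpt (n + 1)<..}" by (rule Sh_next_cut)
      then have "orth C (Sh C W) B" by (rule G.UV_orth[OF _ B])
      moreover have "orth C W A" using S1.P_orth[OF \<psi> W A] by simp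
      ultimately have "orth C W X" using tri_orth_left1[OF XB(1) oW] by blast
      then show "orth (full_sub C D1) W (lam X)" using orth_iso_right[OF iso _ oW] by simp
    qed (use X1 in simp)
    then have "lam X \<in> Sl1 {cutpt n<..\<phi>}" using XD(2) n by (simp add: S1.slices_greaterThanAtMost)
    then have "0 \<le> inner (- cis (pi * (\<phi> + 1/2))) (z1 (lam X))"
    proof (rule S1.slices_inner_nonneg)
      fix \<psi> assume \<psi>: "\<psi> \<in> {cutpt n<..\<phi>}"
      have "0 \<le> sin (pi * (\<phi> - \<psi>))"
        using \<psi> n cut_step(2)[of n] sin_pi_pos[of "\<phi> - \<psi>"] by (cases "\<phi> = \<psi>") auto
      moreover have "pi * (\<psi> - \<phi>) = - (pi * (\<phi> - \<psi>))" by (simp add: algebra_simps)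
      ultimately show "0 \<le> inner (- cis (pi * (\<phi> + 1/2))) (cis (pi * \<psi>))"
        unfolding inner_minus_left inner_cis_orthogonal by (simp only: sin_minus minus_minus)
    qed
    then show ?thesis unfolding G.height_def charge_def using charge_zero2[OF zX X1(2)] by simp
  qed
  then show "A \<in> G.semistable \<phi>" using Ac hA unfolding G.semistable_def n_def by blast
qed

lemma P2_semistable: "P2 \<phi> \<subseteq> G.semistable \<phi>"
proof
  fix A assume A: "A \<in> P2 \<phi>"
  define n where "n = G.cell_index \<phi>"
  have n: "cutpt n < \<phi>" "\<phi> \<le> cutpt (n + 1)" unfolding n_def by (rule G.cell_index)+
  have D: "A \<in> D2" by (rule P2_D2[OF A])
  have Sl: "A \<in> Sl2 {\<phi>}" by (rule S2.slices_P[OF A]) simp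
  have "A \<in> Sl2 {cutpt n<..}" "A \<in> Sl2 {..cutpt (n + 1)}" by (rule slices_monoD[OF Sl]; use n in simp)+
  then have Ac: "A \<in> G.cell n" unfolding G.cell_def using Sl2_glued gt_ex by auto
  have u: "inner (cis (pi * (\<phi> + 1/2))) (z2 A) = 0"
  proof -
    have "0 \<le> inner (cis (pi * (\<phi> + 1/2))) (z2 A)" "0 \<le> inner (- cis (pi * (\<phi> + 1/2))) (z2 A)"
      by (rule S2.slices_inner_nonneg[OF Sl]; simp add: inner_cis_orthogonal inner_minus_left)+
    then show ?thesis by simp
  qed
  have hA: "G.height \<phi> A = 0" unfolding G.height_def charge_D2[OF D] by (rule u)
  have "G.height \<phi> X \<le> 0" if XB: "tri C X A B" "X \<in> G.cell n" "B \<in> G.cell n" for X B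
  proof -
    have X: "X \<in> glued_slices {cutpt n<..}" and B: "B \<in> glued_slices {cutpt n<..}" "B \<in> glued_slices {..cutpt (n + 1)}"
      using XB unfolding G.cell_def by auto
    note BD = glued_slicesD[OF B(2)] and B1 = lambda1_rho2[OF glued_slicesD(1)[OF B(1)]]
    have SX: "Sh C X \<in> glued_slices {cutpt (n + 1)<..}" by (rule Sh_next_cut[OF X])
    have "lam B \<in> glued_slices {..cutpt (n + 1)}" by (rule Sl1_glued[OF BD(2)]) simp
    then have "orth C (Sh C X) (lam B)" by (rule G.UV_orth[OF SX])
    moreover have "orth C A (lam B)" by (rule D21_orth[OF D B1(1)])
    ultimately have "orth C B (lam B)" using tri_orth_right3[OF XB(1) D1.S_Obj[OF B1(1)]] by blast
    moreover have "orth C (Sh C (rho B)) (lam B)" by (rule D21_orth[OF D2.S_Sh[OF B1(2)] B1(1)])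
    ultimately have zB: "is_zero C (lam B)" using tri_zero3[OF B1(3)] by blast
    then have iso: "isomorphic C B (rho B)" using isomorphic_sym[OF tri_zero_imp_iso[OF B1(3)]] by blast
    have "rho B \<in> Sl2 {\<phi>..}"
      unfolding S2.slices_atLeast
    proof (intro conjI allI impI ballI)
      fix \<psi> W assume \<psi>: "\<psi> < \<phi>" and W: "W \<in> P2 \<psi>"
      have oW: "W \<in> Obj C" using D2.S_Obj P2_D2 W by blast
      have "W \<in> Sl2 {..cutpt (n + 1)}" by (rule S2.slices_P[OF W]) (use n \<psi> in simp)
      then have "W \<in> glued_slices {..cutpt (n + 1)}" by (rule Sl2_glued) simp
      then have "orth C (Sh C X) W" by (rule G.UV_orth[OF SX])
      moreover have "orth C A W" using S2.P_orth[OF \<psi> A W] by simp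
      ultimately have "orth C B W" using tri_orth_right3[OF XB(1) oW] by blast
      then show "orth (full_sub C D2) (rho B) W" using orth_iso_left[OF iso _ oW] by simp
    qed (use B1 in simp)
    then have "rho B \<in> Sl2 {\<phi>..cutpt (n + 1)}" using BD(3) n by (simp add: S2.slices_atLeastAtMost)
    then have "0 \<le> inner (cis (pi * (\<phi> + 1/2))) (z2 (rho B))"
    proof (rule S2.slices_inner_nonneg)
      fix \<psi> assume \<psi>: "\<psi> \<in> {\<phi>..cutpt (n + 1)}"
      have "0 \<le> sin (pi * (\<psi> - \<phi>))"
        using \<psi> n cut_step(2)[of n] sin_pi_pos[of "\<psi> - \<phi>"] by (cases "\<phi> = \<psi>") auto
      then show "0 \<le> inner (cis (pi * (\<phi> + 1/2))) (cis (pi * \<psi>))" unfolding inner_cis_orthogonal .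
    qed
    then have "0 \<le> G.height \<phi> B" unfolding G.height_def charge_def using charge_zero1[OF zB B1(1)] by simp
    then show ?thesis using G.height_tri[OF XB(1), of \<phi>] hA by simp
  qed
  then show "A \<in> G.semistable \<phi>" using Ac hA unfolding G.semistable_def n_def by blast
qed

end

context gluing
begin

text \<open>
  The refined chain of t-structures has the glued heart and charge; any other glued stability condition
  has the same heart and charge, so the description in the definition of \<open>gl\<close> picks this one.
\<close>

lemma gl_glued:
  assumes P: "snd \<sigma>\<^sub>1 = P1" "snd \<sigma>\<^sub>2 = P2"
    and z: "\<And>E. E \<in> D1 \<Longrightarrow> fst \<sigma>\<^sub>1 (K0_class (full_sub C D1) E) = z1 E"
      "\<And>E. E \<in> D2 \<Longrightarrow> fst \<sigma>\<^sub>2 (K0_class (full_sub C D2) E) = z2 E"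
    and hom: "Hom_le_vanishes C 0 (heart (full_sub C D1) \<sigma>\<^sub>1) (heart (full_sub C D2) \<sigma>\<^sub>2)"
  shows "glued C D1 D2 (gl C D1 D2 (\<sigma>\<^sub>1, \<sigma>\<^sub>2)) \<sigma>\<^sub>1 \<sigma>\<^sub>2"
    and "snd (gl C D1 D2 (\<sigma>\<^sub>1, \<sigma>\<^sub>2)) = G.semistable"
    and "\<And>E. E \<in> Obj C \<Longrightarrow> fst (gl C D1 D2 (\<sigma>\<^sub>1, \<sigma>\<^sub>2)) (K0_class C E) = charge E"
    and "reasonable C (gl C D1 D2 (\<sigma>\<^sub>1, \<sigma>\<^sub>2))"
proof -
  interpret S: stable_category C G.semistable charge by (rule G.stable_category_semistable)
  obtain Z where Z: "stability_condition C (Z, G.semistable)" and ZE: "\<And>E. E \<in> Obj C \<Longrightarrow> Z (K0_class C E) = charge E"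
    by (rule S.stability_condition_exists) (rule that)
  have c01: "cutpt 0 = 0" "cutpt 2 = 1" by (simp_all add: cutpt_def)
  have "slices C G.semistable {0<..1} = glued_slices {0<..} \<inter> glued_slices {..1}"
    using G.slices_semistable_greaterThan[of 0] G.slices_semistable_atMost[of 2] S.slices_greaterThanAtMost[of 0 1] unfolding c01 by simp
  then have heart: "slices C G.semistable {0<..1} = glued_slices {0<..1}" using glued_slices_interval[of 0 1] by simp
  have glued: "glued C D1 D2 (Z, G.semistable) \<sigma>\<^sub>1 \<sigma>\<^sub>2"
    unfolding glued_def
  proof (intro conjI ballI Z hom)
    show "heart C (Z, G.semistable) = {E \<in> Obj C. lam E \<in> heart (full_sub C D1) \<sigma>\<^sub>1 \<and> rho E \<in> heart (full_sub C D2) \<sigma>\<^sub>2}"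
      unfolding heart_def snd_conv heart P by (rule glued_slices_def)
    fix E assume E: "E \<in> Obj C"
    show "fst (Z, G.semistable) (K0_class C E) =
        fst \<sigma>\<^sub>1 (K0_class (full_sub C D1) (lam E)) + fst \<sigma>\<^sub>2 (K0_class (full_sub C D2) (rho E))"
      using ZE[OF E] z lambda1_rho2[OF E] by (simp add: charge_def)
  qed
  have "\<tau> = (Z, G.semistable)" if \<tau>: "glued C D1 D2 \<tau> \<sigma>\<^sub>1 \<sigma>\<^sub>2" for \<tau>
  proof -
    obtain W Q where WQ: "\<tau> = (W, Q)" by (cases \<tau>)
    have st: "stability_condition C (W, Q)" and hr: "heart C (W, Q) = heart C (Z, G.semistable)"
      and ch: "\<And>E. E \<in> Obj C \<Longrightarrow> W (K0_class C E) = Z (K0_class C E)"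
      using \<tau> glued unfolding glued_def WQ by simp_all
    have "W = Z"
      by (rule charge_unique) (use st Z ch in \<open>simp_all add: stability_condition_def\<close>)
    have "Q = G.semistable"
    proof (rule slicing_determined_by_heart[of C Q "\<lambda>E. W (K0_class C E)"])
      show "stable_category C Q (\<lambda>E. W (K0_class C E))"
        using stability_condition_category[OF triangulated_category_axioms st] by simp
      show "stable_category C G.semistable (\<lambda>E. W (K0_class C E))"
        using stability_condition_category[OF triangulated_category_axioms Z] unfolding \<open>W = Z\<close> by simp
      show "slices C Q {0<..1} = slices C G.semistable {0<..1}" using hr unfolding heart_def by simp
    qed
    then show ?thesis using WQ \<open>W = Z\<close> by simp
  qed
  then have gl: "gl C D1 D2 (\<sigma>\<^sub>1, \<sigma>\<^sub>2) = (Z, G.semistable)"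
    unfolding gl_def prod.case using glued by (intro the_equality)
  show "glued C D1 D2 (gl C D1 D2 (\<sigma>\<^sub>1, \<sigma>\<^sub>2)) \<sigma>\<^sub>1 \<sigma>\<^sub>2" "snd (gl C D1 D2 (\<sigma>\<^sub>1, \<sigma>\<^sub>2)) = G.semistable"
    "\<And>E. E \<in> Obj C \<Longrightarrow> fst (gl C D1 D2 (\<sigma>\<^sub>1, \<sigma>\<^sub>2)) (K0_class C E) = charge E"
    unfolding gl using glued ZE by simp_all
  show "reasonable C (gl C D1 D2 (\<sigma>\<^sub>1, \<sigma>\<^sub>2))"
    unfolding reasonable_iff gl
  proof (intro exI[of _ lower] conjI ballI)
    show "0 < lower" by (rule G.k_pos)
    fix E assume "E \<in> semistables C (Z, G.semistable)"
    then obtain \<phi> where E: "E \<in> G.semistable \<phi>" "\<not> is_zero C E" unfolding semistables_def by auto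
    show "lower \<le> norm (fst (Z, G.semistable) (K0_class C E))"
      using G.semistable_mass_bound[OF E] ZE[OF G.P_Obj[OF E(1)]] by simp
  qed
qed

end

lemma funpow_unshift_Sh:
  assumes "triangulated_category C" "X \<in> Obj C" shows "(unshift C ^^ q) ((Sh C ^^ q) X) = X"
proof -
  interpret triangulated_category C by fact
  have o: "(Sh C ^^ q) X \<in> Obj C" for q using assms(2) by (induction q) auto
  show ?thesis
  proof (induction q)
    case (Suc q)
    have "(unshift C ^^ Suc q) ((Sh C ^^ Suc q) X) = (unshift C ^^ q) (unshift C (Sh C ((Sh C ^^ q) X)))"
      by (subst funpow_Suc_right) (simp only: o_apply funpow.simps(2))
    then show ?case using Suc o[of q] by simp
  qed simp
qed

text \<open>
  Shift \<open>A\<close> down and \<open>B\<close> up into the phases \<open>(c, c + 1]\<close>: the maps become \<open>Hom\<close> in degree \<open>- (p + q) \<le> 0\<close>.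
\<close>

lemma (in semiorthogonal) orth_of_Hom_le_vanishes:
  assumes "slicing_category (full_sub C D1) P1" "slicing_category (full_sub C D2) P2"
    and van: "Hom_le_vanishes C 0 (slices (full_sub C D1) P1 {c<..c + 1}) (slices (full_sub C D2) P2 {c<..c + 1})"
    and \<phi>: "c < \<phi>" "\<psi> \<le> c + 1" and A: "A \<in> P1 \<phi>" and B: "B \<in> P2 \<psi>"
  shows "orth C A B"
proof -
  interpret S1: slicing_category "full_sub C D1" P1 by fact
  interpret S2: slicing_category "full_sub C D2" P2 by fact
  have oA: "A \<in> D1" "B \<in> D2" using S1.P_Obj[OF A] S2.P_Obj[OF B] by simp_all
  note oC = D1.S_Obj[OF oA(1)] D2.S_Obj[OF oA(2)]
  define p where "p = nat (\<lceil>\<phi> - c\<rceil> - 1)"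
  define q where "q = nat (1 - \<lceil>\<psi> - c\<rceil>)"
  have "0 < \<lceil>\<phi> - c\<rceil>" "\<lceil>\<psi> - c\<rceil> \<le> 1" using \<phi> by (simp_all add: ceiling_le_one)
  then have "real p = of_int \<lceil>\<phi> - c\<rceil> - 1" "real q = 1 - of_int \<lceil>\<psi> - c\<rceil>" unfolding p_def q_def by (simp_all add: of_nat_nat)
  then have range: "c < \<phi> - real p" "\<phi> - real p \<le> c + 1" "c < \<psi> + real q" "\<psi> + real q \<le> c + 1"
    using ceiling_correct[of "\<phi> - c"] ceiling_correct[of "\<psi> - c"] by linarith+
  have Ap: "(unshift C ^^ p) A \<in> P1 (\<phi> - real p) \<and> (unshift C ^^ p) A \<in> D1" for p
  proof (induction p)
    case (Suc p)
    let ?X = "(unshift C ^^ p) A"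
    have X: "?X \<in> D1" "?X \<in> Obj C" using Suc D1.S_Obj by auto
    then have u: "unshift C ?X \<in> D1" "Sh C (unshift C ?X) = ?X" using D1.S_unshift by auto
    have "unshift C ?X \<in> P1 (\<phi> - real (Suc p))"
      using S1.P_Sh[of "unshift C ?X" "\<phi> - real (Suc p)"] u Suc by (simp add: algebra_simps)
    then show ?case using u by simp
  qed (use A oA in simp)
  have Bq: "(Sh C ^^ q) B \<in> P2 (\<psi> + real q) \<and> (Sh C ^^ q) B \<in> D2" for q
  proof (induction q)
    case (Suc q)
    let ?X = "(Sh C ^^ q) B"
    have "Sh C ?X \<in> P2 (\<psi> + real q + 1)" using S2.P_Sh[of ?X "\<psi> + real q"] Suc by simp
    then show ?case using D2.S_Sh Suc by (simp add: algebra_simps)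
  qed (use B oA in simp)
  have A': "(unshift C ^^ p) A \<in> slices (full_sub C D1) P1 {c<..c + 1}"
    by (rule S1.slices_P[OF conjunct1[OF Ap]]) (use range in simp)
  have B': "(Sh C ^^ q) B \<in> slices (full_sub C D2) P2 {c<..c + 1}"
    by (rule S2.slices_P[OF conjunct1[OF Bq]]) (use range in simp)
  have "shift C (- int (p + q)) ((Sh C ^^ q) B) = (unshift C ^^ (p + q)) ((Sh C ^^ q) B)"
  proof (cases "p + q = 0")
    case False
    then have "\<not> 0 \<le> - int (p + q)" by linarith
    then show ?thesis unfolding shift_def unshift_def by (simp only: if_False minus_minus nat_int)
  qed (simp add: shift_def)
  also have "\<dots> = (unshift C ^^ p) B" by (simp add: funpow_add funpow_unshift_Sh[OF triangulated_category_axioms oC(2)])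
  finally have "orth C ((unshift C ^^ p) A) ((unshift C ^^ p) B)"
    using van[unfolded Hom_le_vanishes_def, rule_format, OF A' B', of "- int (p + q)"] unfolding orth_def by simp
  moreover have uo: "(unshift C ^^ p) X \<in> Obj C" if "X \<in> Obj C" for p X using that by (induction p) auto
  have "orth C ((unshift C ^^ p) A) ((unshift C ^^ p) B) \<longleftrightarrow> orth C A B" for p
  proof (induction p)
    case (Suc p)
    then show ?case
      using orth_Sh[of "(unshift C ^^ Suc p) A" "(unshift C ^^ Suc p) B"] uo[OF oC(1), of p] uo[OF oC(2), of p] by simp
  qed simp
  ultimately show ?thesis by simp
qed

lemma glue_domain_gluing:
  assumes C: "triangulated_category C" "semiorthogonal_decomposition C D1 D2" and a: "0 < a" "a < 1"
    and \<sigma>: "(\<sigma>\<^sub>1, \<sigma>\<^sub>2) \<in> glue_domain C D1 D2 a"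
  obtains k where "gluing C D1 D2 (snd \<sigma>\<^sub>1) (snd \<sigma>\<^sub>2) (\<lambda>E. fst \<sigma>\<^sub>1 (K0_class (full_sub C D1) E))
    (\<lambda>E. fst \<sigma>\<^sub>2 (K0_class (full_sub C D2) E)) a k"
proof -
  interpret triangulated_category C by fact
  interpret semiorthogonal C D1 D2 using C(2) by unfold_locales
  have st: "stability_condition (full_sub C D1) \<sigma>\<^sub>1" "stability_condition (full_sub C D2) \<sigma>\<^sub>2"
    and re: "reasonable (full_sub C D1) \<sigma>\<^sub>1" "reasonable (full_sub C D2) \<sigma>\<^sub>2"
    and van: "Hom_le_vanishes C 0 (slices (full_sub C D1) (snd \<sigma>\<^sub>1) {0<..0 + 1}) (slices (full_sub C D2) (snd \<sigma>\<^sub>2) {0<..0 + 1})"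
      "Hom_le_vanishes C 0 (slices (full_sub C D1) (snd \<sigma>\<^sub>1) {a<..a + 1}) (slices (full_sub C D2) (snd \<sigma>\<^sub>2) {a<..a + 1})"
    using \<sigma> unfolding glue_domain_def Stab_def by simp_all
  interpret S1: stable_category "full_sub C D1" "snd \<sigma>\<^sub>1" "\<lambda>E. fst \<sigma>\<^sub>1 (K0_class (full_sub C D1) E)"
    by (rule stability_condition_category[OF D1.triangulated_full_sub st(1)])
  interpret S2: stable_category "full_sub C D2" "snd \<sigma>\<^sub>2" "\<lambda>E. fst \<sigma>\<^sub>2 (K0_class (full_sub C D2) E)"
    by (rule stability_condition_category[OF D2.triangulated_full_sub st(2)])
  note orth = orth_of_Hom_le_vanishes[OF S1.slicing_category_axioms S2.slicing_category_axioms]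
  obtain k1 where k1: "0 < k1" "\<And>E. E \<in> semistables (full_sub C D1) \<sigma>\<^sub>1 \<Longrightarrow> k1 \<le> norm (fst \<sigma>\<^sub>1 (K0_class (full_sub C D1) E))"
    using re(1) unfolding reasonable_iff by blast
  obtain k2 where k2: "0 < k2" "\<And>E. E \<in> semistables (full_sub C D2) \<sigma>\<^sub>2 \<Longrightarrow> k2 \<le> norm (fst \<sigma>\<^sub>2 (K0_class (full_sub C D2) E))"
    using re(2) unfolding reasonable_iff by blast
  have "gluing C D1 D2 (snd \<sigma>\<^sub>1) (snd \<sigma>\<^sub>2) (\<lambda>E. fst \<sigma>\<^sub>1 (K0_class (full_sub C D1) E))
    (\<lambda>E. fst \<sigma>\<^sub>2 (K0_class (full_sub C D2) E)) a (min k1 k2)"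
  proof unfold_locales
    show "0 < a" "a < 1" "0 < min k1 k2" using a k1 k2 by auto
    show "min k1 k2 \<le> norm (fst \<sigma>\<^sub>1 (K0_class (full_sub C D1) A))" if "A \<in> snd \<sigma>\<^sub>1 \<phi>" "\<not> is_zero C A" for A \<phi>
    proof -
      have "A \<in> semistables (full_sub C D1) \<sigma>\<^sub>1" using that unfolding semistables_def by (auto simp: D1.is_zero_full_sub)
      then show ?thesis using k1(2) by fastforce
    qed
    show "min k1 k2 \<le> norm (fst \<sigma>\<^sub>2 (K0_class (full_sub C D2) A))" if "A \<in> snd \<sigma>\<^sub>2 \<phi>" "\<not> is_zero C A" for A \<phi>
    proof -
      have "A \<in> semistables (full_sub C D2) \<sigma>\<^sub>2" using that unfolding semistables_def by (auto simp: D2.is_zero_full_sub)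
      then show ?thesis using k2(2) by fastforce
    qed
    show "orth C A B" if "0 < \<phi>" "\<psi> \<le> 1" "A \<in> snd \<sigma>\<^sub>1 \<phi>" "B \<in> snd \<sigma>\<^sub>2 \<psi>" for \<phi> \<psi> A B
      by (rule orth[OF van(1) that(1) _ that(3,4)]) (use that in simp)
    show "orth C A B" if "a < \<phi>" "\<psi> \<le> a + 1" "A \<in> snd \<sigma>\<^sub>1 \<phi>" "B \<in> snd \<sigma>\<^sub>2 \<psi>" for \<phi> \<psi> A B
      by (rule orth[OF van(2) that])
  qed
  then show thesis by (rule that)
qed

section \<open>Continuity\<close>

lemma slices_full_sub_trans:
  assumes "E \<in> slices (full_sub C S) P I" "\<And>\<phi>. \<phi> \<in> I \<Longrightarrow> P \<phi> \<subseteq> slices C Q J" shows "E \<in> slices C Q J"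
  using assms(1)
proof (induction rule: slices_induct)
  case (base \<phi> A) show ?case by (rule subsetD[OF assms(2)[OF base(1)] base(2)])
next
  case (ext X Y Z)
  then have "tri C X Y Z" by simp
  then show ?case using ext.IH by (rule slices_ext)
qed

text \<open>
  Both components move by at most \<open>\<delta>\<close>, and their semistable factors are semistable in \<open>C\<close>.
\<close>

lemma glued_slices_transfer:
  assumes "gluing C D1 D2 P1 P2 z1 z2 a k" "gluing C D1 D2 Q1 Q2 w1 w2 a l"
    and P1: "\<And>\<phi>. P1 \<phi> \<subseteq> slices (full_sub C D1) Q1 {\<phi> - \<delta>..\<phi> + \<delta>}"
    and P2: "\<And>\<phi>. P2 \<phi> \<subseteq> slices (full_sub C D2) Q2 {\<phi> - \<delta>..\<phi> + \<delta>}"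
    and J: "\<And>\<phi>. \<phi> \<in> I \<Longrightarrow> {\<phi> - \<delta>..\<phi> + \<delta>} \<subseteq> J"
    and E: "E \<in> gluing.glued_slices C D1 D2 P1 P2 I" and R: "\<And>\<phi>. Q1 \<phi> \<subseteq> R \<phi>" "\<And>\<phi>. Q2 \<phi> \<subseteq> R \<phi>"
  shows "E \<in> slices C R J"
proof -
  interpret A: gluing C D1 D2 P1 P2 z1 z2 a k by fact
  note ED = A.glued_slicesD[OF E]
  have step: "P \<phi> \<subseteq> slices C R J"
    if \<phi>: "\<phi> \<in> I" and P: "P \<phi> \<subseteq> slices (full_sub C S) Q {\<phi> - \<delta>..\<phi> + \<delta>}" and Q: "\<And>\<psi>. Q \<psi> \<subseteq> R \<psi>" for \<phi> P Q S
  proof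
    fix X assume "X \<in> P \<phi>"
    then have "X \<in> slices (full_sub C S) Q {\<phi> - \<delta>..\<phi> + \<delta>}" by (rule subsetD[OF P])
    then show "X \<in> slices C R J"
    proof (rule slices_full_sub_trans)
      fix \<psi> assume \<psi>: "\<psi> \<in> {\<phi> - \<delta>..\<phi> + \<delta>}"
      show "Q \<psi> \<subseteq> slices C R J"
      proof
        fix W assume "W \<in> Q \<psi>"
        then have "W \<in> R \<psi>" by (rule subsetD[OF Q])
        then show "W \<in> slices C R J" by (rule slices_base) (rule subsetD[OF J[OF \<phi>] \<psi>])
      qed
    qed
  qed
  have "P1 \<phi> \<subseteq> slices C R J" "P2 \<phi> \<subseteq> slices C R J" if "\<phi> \<in> I" for \<phi>
    using step[of \<phi> P1 D1 Q1, OF that P1[of \<phi>]] step[of \<phi> P2 D2 Q2, OF that P2[of \<phi>]] R by simp_all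
  note sub = this
  have 1: "lambda1 C D1 D2 E \<in> slices C R J"
    by (rule slices_full_sub_trans[where I = I and P = P1 and S = D1]) (use ED(2) sub(1) in simp_all)
  have 2: "rho2 C D1 D2 E \<in> slices C R J"
    by (rule slices_full_sub_trans[where I = I and P = P2 and S = D2]) (use ED(3) sub(2) in simp_all)
  show ?thesis by (rule slices_ext[OF ED(4) 2 1])
qed

lemma sin_pi_ge:
  fixes t :: real
  assumes "0 < e" "e \<le> t" "t \<le> 1 - e" shows "sin (pi * e) \<le> sin (pi * t)"
proof -
  have *: "sin (pi * e) \<le> sin (pi * s)" if "e \<le> s" "s \<le> 1/2" for s
  proof (rule sin_monotone_2pi_le)
    have "0 \<le> pi * e" using assms(1) by simp
    then show "- (pi / 2) \<le> pi * e" using pi_gt_zero by linarith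
    show "pi * e \<le> pi * s" using that by (intro mult_left_mono) auto
    have "pi * s \<le> pi * (1/2)" using that by (intro mult_left_mono) auto
    then show "pi * s \<le> pi / 2" by simp
  qed
  show ?thesis
  proof (cases "t \<le> 1/2")
    case False
    have "sin (pi * t) = sin (pi - pi * t)" by simp
    also have "pi - pi * t = pi * (1 - t)" by (simp add: algebra_simps)
    finally show ?thesis using *[of "1 - t"] False assms by simp
  qed (use * assms in simp)
qed

locale gluing_pair = A: gluing C D1 D2 P1 P2 z1 z2 a k + B: gluing C D1 D2 Q1 Q2 w1 w2 a l
  for C :: "('a, 'b) tricat" (structure) and D1 D2 P1 P2 z1 z2 a k Q1 Q2 w1 w2 l +
  fixes \<delta> \<eta> :: real
  assumes \<delta>0: "0 \<le> \<delta>" and \<eta>0: "0 \<le> \<eta>"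
    and Q1: "\<And>\<phi>. Q1 \<phi> \<subseteq> slices (full_sub C D1) P1 {\<phi> - \<delta>..\<phi> + \<delta>}"
    and Q2: "\<And>\<phi>. Q2 \<phi> \<subseteq> slices (full_sub C D2) P2 {\<phi> - \<delta>..\<phi> + \<delta>}"
    and w1: "\<And>A \<phi>. A \<in> P1 \<phi> \<Longrightarrow> norm (w1 A - z1 A) \<le> \<eta> * norm (z1 A)"
    and w2: "\<And>A \<phi>. A \<in> P2 \<phi> \<Longrightarrow> norm (w2 A - z2 A) \<le> \<eta> * norm (z2 A)"
begin

abbreviation "width \<equiv> max a (1 - a)"

lemma P1_Q1: "P1 \<phi> \<subseteq> slices (full_sub C D1) Q1 {\<phi> - \<delta>..\<phi> + \<delta>}"
  by (rule slicing_dist_sym[OF A.S1.slicing_category_axioms B.S1.slicing_category_axioms \<delta>0 Q1])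

lemma P2_Q2: "P2 \<phi> \<subseteq> slices (full_sub C D2) Q2 {\<phi> - \<delta>..\<phi> + \<delta>}"
  by (rule slicing_dist_sym[OF A.S2.slicing_category_axioms B.S2.slicing_category_axioms \<delta>0 Q2])

lemma transfer_AB:
  assumes "E \<in> A.glued_slices I" "\<And>\<phi>. \<phi> \<in> I \<Longrightarrow> {\<phi> - \<delta>..\<phi> + \<delta>} \<subseteq> J" shows "E \<in> slices C B.G.semistable J"
  using glued_slices_transfer[OF A.gluing_axioms B.gluing_axioms P1_Q1 P2_Q2 assms(2,1) B.P1_semistable B.P2_semistable] .

lemma transfer_BA:
  assumes "E \<in> B.glued_slices I" "\<And>\<phi>. \<phi> \<in> I \<Longrightarrow> {\<phi> - \<delta>..\<phi> + \<delta>} \<subseteq> J" shows "E \<in> slices C A.G.semistable J"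
  using glued_slices_transfer[OF B.gluing_axioms A.gluing_axioms Q1 Q2 assms(2,1) A.P1_semistable A.P2_semistable] .

text \<open>On a cell the charges of the two components do not cancel, so the relative error does not blow up.\<close>

lemma charge_close:
  assumes E: "E \<in> A.G.semistable \<phi>"
  shows "norm (B.charge E - A.charge E) \<le> \<eta> / cos (pi * (width / 2)) * norm (A.charge E)"
proof -
  define n where "n = A.G.cell_index \<phi>"
  define u where "u = cis (pi * ((A.cutpt n + A.cutpt (n + 1)) / 2))"
  define \<kappa> where "\<kappa> = cos (pi * (width / 2))"
  have \<kappa>: "0 < \<kappa>" unfolding \<kappa>_def by (rule A.cos_gap_pos)
  have "E \<in> A.G.cell n" unfolding n_def by (rule A.G.semistableD(1)[OF E])
  then have "E \<in> A.glued_slices {A.cutpt n<..A.cutpt (n + 1)}"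
    unfolding A.G.cell_def A.glued_slices_interval[OF A.cut_step(1)] .
  note ED = A.glued_slicesD[OF this]
  have "norm (w1 (A.lam E) - z1 (A.lam E)) * \<kappa> \<le> \<eta> * inner u (z1 (A.lam E))"
  proof (rule A.S1.slices_inner_bound[OF ED(2)])
    show "\<kappa> \<le> inner u (cis (pi * \<psi>))" if "\<psi> \<in> {A.cutpt n<..A.cutpt (n + 1)}" for \<psi>
      unfolding \<kappa>_def u_def by (rule A.cos_mid_cell) (use that in auto)
    show "w1 Y - z1 Y = (w1 X - z1 X) + (w1 W - z1 W)" if "tri (full_sub C D1) X Y W" for X Y W
      unfolding A.S1.z_tri[OF that] B.S1.z_tri[OF that] by simp
  qed (use w1 \<eta>0 \<kappa> in auto)
  moreover have "norm (w2 (A.rho E) - z2 (A.rho E)) * \<kappa> \<le> \<eta> * inner u (z2 (A.rho E))"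
  proof (rule A.S2.slices_inner_bound[OF ED(3)])
    show "\<kappa> \<le> inner u (cis (pi * \<psi>))" if "\<psi> \<in> {A.cutpt n<..A.cutpt (n + 1)}" for \<psi>
      unfolding \<kappa>_def u_def by (rule A.cos_mid_cell) (use that in auto)
    show "w2 Y - z2 Y = (w2 X - z2 X) + (w2 W - z2 W)" if "tri (full_sub C D2) X Y W" for X Y W
      unfolding A.S2.z_tri[OF that] B.S2.z_tri[OF that] by simp
  qed (use w2 \<eta>0 \<kappa> in auto)
  moreover have "norm (B.charge E - A.charge E) \<le> norm (w1 (A.lam E) - z1 (A.lam E)) + norm (w2 (A.rho E) - z2 (A.rho E))"
  proof -
    have "B.charge E - A.charge E = (w1 (A.lam E) - z1 (A.lam E)) + (w2 (A.rho E) - z2 (A.rho E))"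
      unfolding A.charge_def B.charge_def by simp
    then show ?thesis using norm_triangle_ineq by metis
  qed
  then have "norm (B.charge E - A.charge E) * \<kappa> \<le> (norm (w1 (A.lam E) - z1 (A.lam E)) + norm (w2 (A.rho E) - z2 (A.rho E))) * \<kappa>"
    using \<kappa> by (intro mult_right_mono) auto
  ultimately have "norm (B.charge E - A.charge E) * \<kappa> \<le> \<eta> * inner u (A.charge E)"
    unfolding A.charge_def by (simp add: inner_add_right algebra_simps)
  also have "\<dots> \<le> \<eta> * norm (A.charge E)"
    using norm_cauchy_schwarz[of u "A.charge E"] \<eta>0 unfolding u_def by (intro mult_left_mono) auto
  finally show ?thesis using \<kappa> unfolding \<kappa>_def[symmetric] by (simp add: field_simps)
qed

text \<open>
  An object whose phases for the first slicing stay at distance \<open>e\<close> from the line of phase \<open>\<phi>\<close>, on its positive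
  side, cannot have its charge for the second stability condition on the negative side.
\<close>

lemma zero_of_opposite_charges:
  assumes X: "X \<in> slices C A.G.semistable J" and u: "norm u = 1"
    and e: "0 < e" "e < 1" and J: "\<And>\<psi>. \<psi> \<in> J \<Longrightarrow> sin (pi * e) \<le> inner u (cis (pi * \<psi>))"
    and small: "\<eta> < cos (pi * (width / 2)) * sin (pi * e)"
    and neg: "inner u (B.charge X) \<le> 0"
  shows "is_zero C X"
proof (rule ccontr)
  assume nz: "\<not> is_zero C X"
  interpret S: stable_category C A.G.semistable A.charge by (rule A.G.stable_category_semistable)
  define \<kappa> where "\<kappa> = cos (pi * (width / 2))"
  define s where "s = sin (pi * e)"
  have \<kappa>: "0 < \<kappa>" unfolding \<kappa>_def by (rule A.cos_gap_pos)
  have s: "0 < s" unfolding s_def by (rule sin_pi_pos[OF e])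
  have pos: "0 < inner u (A.charge X)"
    by (rule S.slices_inner_pos[OF X _ nz]) (use J s in \<open>unfold s_def, fastforce\<close>)
  have "norm (B.charge X - A.charge X) * s \<le> \<eta> / \<kappa> * inner u (A.charge X)"
  proof (rule S.slices_inner_bound[OF X])
    show "B.charge Y - A.charge Y = (B.charge X - A.charge X) + (B.charge W - A.charge W)" if "tri C X Y W" for X Y W
      unfolding A.charge_tri[OF that] B.charge_tri[OF that] by simp
  qed (use J charge_close \<eta>0 \<kappa> s in \<open>auto simp: s_def \<kappa>_def\<close>)
  moreover have "inner u (A.charge X - B.charge X) \<le> norm (B.charge X - A.charge X)"
    using norm_cauchy_schwarz[of u "A.charge X - B.charge X"] u by (simp add: norm_minus_commute)
  then have "inner u (A.charge X) \<le> norm (B.charge X - A.charge X)" using neg by (simp add: inner_diff_right)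
  then have "inner u (A.charge X) * s \<le> norm (B.charge X - A.charge X) * s" using s by (intro mult_right_mono) auto
  ultimately have "inner u (A.charge X) * s \<le> inner u (A.charge X) * (\<eta> / \<kappa>)" by (simp add: mult.commute)
  then have "s \<le> \<eta> / \<kappa>" by (rule mult_left_le_imp_le[OF _ pos])
  then show False using small \<kappa> unfolding \<kappa>_def[symmetric] s_def[symmetric] by (simp add: field_simps)
qed

text \<open>
  The components of \<open>F\<close> have phases in a cell for the second pair, hence at distance at most \<open>\<delta>\<close> from it for the first pair;
  this settles the case of \<open>\<phi>\<close> within \<open>e\<close> of an end of the cell. Otherwise the part \<open>X\<close> of phases above \<open>\<phi> + e\<close> still has phases at most \<open>\<phi>\<close> for
  the second slicing, because its complement has phases below \<open>\<phi> + 1\<close>; so its two charges would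
  lie on opposite sides of the line of phase \<open>\<phi>\<close>.
\<close>

lemma semistable_close:
  assumes e: "0 < e" and width: "width + \<delta> \<le> 1 - e" and small: "\<eta> < cos (pi * (width / 2)) * sin (pi * e)"
  shows "B.G.semistable \<phi> \<subseteq> slices C A.G.semistable {\<phi> - (e + \<delta>)..\<phi> + (e + \<delta>)}"
proof
  interpret SA: stable_category C A.G.semistable A.charge by (rule A.G.stable_category_semistable)
  interpret SB: stable_category C B.G.semistable B.charge by (rule B.G.stable_category_semistable)
  fix F assume F: "F \<in> B.G.semistable \<phi>"
  define n where "n = B.G.cell_index \<phi>"
  define lo where "lo = A.cutpt n"
  define hi where "hi = A.cutpt (n + 1)"
  have \<phi>: "lo < \<phi>" "\<phi> \<le> hi" unfolding lo_def hi_def n_def by (rule B.G.cell_index)+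
  have gap: "hi - lo + \<delta> \<le> 1 - e" using A.cut_gap[of n] width unfolding lo_def hi_def by linarith
  have e1: "e < 1" using gap \<phi> \<delta>0 by linarith
  have oF: "F \<in> Obj C" by (rule B.G.P_Obj[OF F])
  have Fcell: "F \<in> B.glued_slices {lo<..}" "F \<in> B.glued_slices {..hi}"
    using B.G.semistableD(1)[OF F] unfolding B.G.cell_def lo_def hi_def n_def by auto
  have Flo: "F \<in> slices C A.G.semistable {lo - \<delta><..}" by (rule transfer_BA[OF Fcell(1)]) auto
  have Fhi: "F \<in> slices C A.G.semistable {..hi + \<delta>}" by (rule transfer_BA[OF Fcell(2)]) auto
  have A_lo: "X \<in> slices C B.G.semistable {lo - \<delta><..}" if "X \<in> slices C A.G.semistable {lo<..}" for X
  proof (rule transfer_AB)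
    show "X \<in> A.glued_slices {lo<..}" using that unfolding lo_def A.G.slices_semistable_greaterThan .
  qed auto
  have A_hi: "X \<in> slices C B.G.semistable {..hi + \<delta>}" if "X \<in> slices C A.G.semistable {..hi}" for X
  proof (rule transfer_AB)
    show "X \<in> A.glued_slices {..hi}" using that unfolding hi_def A.G.slices_semistable_atMost .
  qed auto
  have upper: "F \<in> slices C A.G.semistable {..\<phi> + (e + \<delta>)}"
  proof (cases "\<phi> + e \<le> hi")
    case False
    then show ?thesis by (intro slices_monoD[OF Fhi]) auto
  next
    case True
    obtain X Y where XY: "tri C X F Y" "X \<in> slices C A.G.semistable {\<phi> + e<..}" "Y \<in> slices C A.G.semistable {..\<phi> + e}"
      by (rule SA.slices_cut[OF oF])
    have oX: "X \<in> Obj C" using A.tri_Obj[OF XY(1)] by simp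
    have YB: "Y \<in> slices C B.G.semistable {..hi + \<delta>}"
      by (rule A_hi[OF slices_monoD[OF XY(3)]]) (use True in auto)
    have "X \<in> slices C A.G.semistable {..hi + \<delta>}"
      unfolding SA.slices_atMost
    proof (intro conjI allI impI ballI oX)
      fix \<psi> W assume \<psi>: "hi + \<delta> < \<psi>" and W: "W \<in> A.G.semistable \<psi>"
      have W': "W \<in> slices C A.G.semistable {\<psi>}" by (rule A.G.slices_P[OF W]) simp
      show "orth C W X"
      proof (rule A.tri_orth_left1[OF XY(1) A.G.P_Obj[OF W]])
        show "orth C W F" by (rule A.G.slices_orth[OF W' Fhi]) (use \<psi> in auto)
        show "orth C (Sh C W) Y" by (rule A.G.slices_orth_Sh[OF W' XY(3)]) (use \<psi> True \<delta>0 in auto)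
      qed
    qed
    then have XA: "X \<in> slices C A.G.semistable {\<phi> + e<..hi + \<delta>}"
      if "\<phi> + e < hi + \<delta>" using XY(2) that by (simp add: SA.slices_greaterThanAtMost)
    have X1: "X \<in> slices C B.G.semistable {..\<phi>}"
      unfolding SB.slices_atMost
    proof (intro conjI allI impI ballI oX)
      fix \<psi> W assume \<psi>: "\<phi> < \<psi>" and W: "W \<in> B.G.semistable \<psi>"
      have W': "W \<in> slices C B.G.semistable {\<psi>}" by (rule B.G.slices_P[OF W]) simp
      show "orth C W X"
      proof (rule A.tri_orth_left1[OF XY(1) B.G.P_Obj[OF W]])
        show "orth C W F" by (rule B.G.P_orth[OF \<psi> W F])
        show "orth C (Sh C W) Y" by (rule B.G.slices_orth_Sh[OF W' YB]) (use \<psi> \<phi> gap e in auto)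
      qed
    qed
    have X2: "X \<in> slices C B.G.semistable {lo - \<delta><..}"
      by (rule A_lo[OF slices_monoD[OF XY(2)]]) (use \<phi> e in auto)
    \<comment> \<open>The second charge of \<open>X\<close> lies on the negative side of the line of phase \<open>\<phi>\<close>.\<close>
    have XB: "X \<in> slices C B.G.semistable {lo - \<delta><..\<phi>}" using X1 X2 \<phi> \<delta>0 by (simp add: SB.slices_greaterThanAtMost)
    have neg: "inner (cis (pi * (\<phi> + 1/2))) (B.charge X) \<le> 0"
    proof -
      have "0 \<le> inner (- cis (pi * (\<phi> + 1/2))) (B.charge X)"
      proof (rule SB.slices_inner_nonneg[OF XB])
        fix \<psi> assume \<psi>: "\<psi> \<in> {lo - \<delta><..\<phi>}"
        have "0 \<le> sin (pi * (\<phi> - \<psi>))"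
          using \<psi> \<phi> gap e sin_pi_pos[of "\<phi> - \<psi>"] by (cases "\<phi> = \<psi>") auto
        moreover have "pi * (\<psi> - \<phi>) = - (pi * (\<phi> - \<psi>))" by (simp add: algebra_simps)
        ultimately show "0 \<le> inner (- cis (pi * (\<phi> + 1/2))) (cis (pi * \<psi>))"
          unfolding inner_minus_left inner_cis_orthogonal by (simp only: sin_minus minus_minus)
      qed
      then show ?thesis by simp
    qed
    have "is_zero C X"
    proof (cases "\<phi> + e < hi + \<delta>")
      case True
      show ?thesis
      proof (rule zero_of_opposite_charges[OF XA[OF True] _ e e1 _ small neg])
        fix \<psi> assume \<psi>: "\<psi> \<in> {\<phi> + e<..hi + \<delta>}"
        show "sin (pi * e) \<le> inner (cis (pi * (\<phi> + 1/2))) (cis (pi * \<psi>))"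
          unfolding inner_cis_orthogonal by (rule sin_pi_ge[OF e]) (use \<psi> \<phi> gap in auto)
      qed simp
    next
      case False
      have "orth C X X" by (rule A.G.slices_orth[OF XY(2) \<open>X \<in> slices C A.G.semistable {..hi + \<delta>}\<close>]) (use False in auto)
      then show ?thesis using A.is_zero_iff oX by blast
    qed
    then have "isomorphic C Y F" using A.isomorphic_sym[OF A.tri_zero_imp_iso'[OF XY(1)]] by blast
    then have "F \<in> slices C A.G.semistable {..\<phi> + e}" by (rule A.G.slices_iso[OF XY(3)]) simp
    then show ?thesis by (rule slices_monoD) (use \<delta>0 in auto)
  qed
  have lower: "F \<in> slices C A.G.semistable {\<phi> - (e + \<delta>)..}"
  proof (cases "lo \<le> \<phi> - e")
    case False
    then show ?thesis by (intro slices_monoD[OF Flo]) auto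
  next
    case True
    obtain X Y where XY: "tri C X F Y" "X \<in> slices C A.G.semistable {\<phi> - e<..}" "Y \<in> slices C A.G.semistable {..\<phi> - e}"
      by (rule SA.slices_cut[OF oF])
    have oY: "Y \<in> Obj C" using A.tri_Obj[OF XY(1)] by simp
    have XB: "X \<in> slices C B.G.semistable {lo - \<delta><..}"
      by (rule A_lo[OF slices_monoD[OF XY(2)]]) (use True in auto)
    have YA1: "Y \<in> slices C A.G.semistable {lo - \<delta><..}"
      unfolding SA.slices_greaterThan
    proof (intro conjI allI impI ballI oY)
      fix \<psi> W assume \<psi>: "\<psi> \<le> lo - \<delta>" and W: "W \<in> A.G.semistable \<psi>"
      have W': "W \<in> slices C A.G.semistable {\<psi>}" by (rule A.G.slices_P[OF W]) simp
      show "orth C Y W"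
      proof (rule A.tri_orth_right3[OF XY(1) A.G.P_Obj[OF W]])
        show "orth C F W" by (rule A.G.slices_orth[OF Flo W']) (use \<psi> in auto)
        show "orth C (Sh C X) W" by (rule A.G.slices_orth_Sh[OF XY(2) W']) (use \<psi> True \<delta>0 in auto)
      qed
    qed
    have Y1: "Y \<in> slices C B.G.semistable {\<phi>..}"
      unfolding SB.slices_atLeast
    proof (intro conjI allI impI ballI oY)
      fix \<psi> W assume \<psi>: "\<psi> < \<phi>" and W: "W \<in> B.G.semistable \<psi>"
      have W': "W \<in> slices C B.G.semistable {\<psi>}" by (rule B.G.slices_P[OF W]) simp
      show "orth C Y W"
      proof (rule A.tri_orth_right3[OF XY(1) B.G.P_Obj[OF W]])
        show "orth C F W" by (rule B.G.P_orth[OF \<psi> F W])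
        show "orth C (Sh C X) W" by (rule B.G.slices_orth_Sh[OF XB W']) (use \<psi> \<phi> gap e in auto)
      qed
    qed
    have Y2: "Y \<in> slices C B.G.semistable {..hi + \<delta>}"
      by (rule A_hi[OF slices_monoD[OF XY(3)]]) (use \<phi> e in auto)
    \<comment> \<open>Dually, the second charge of \<open>Y\<close> lies on the positive side.\<close>
    have YB: "Y \<in> slices C B.G.semistable {\<phi>..hi + \<delta>}" using Y1 Y2 \<phi> \<delta>0 by (simp add: SB.slices_atLeastAtMost)
    have neg: "inner (- cis (pi * (\<phi> + 1/2))) (B.charge Y) \<le> 0"
    proof -
      have "0 \<le> inner (cis (pi * (\<phi> + 1/2))) (B.charge Y)"
      proof (rule SB.slices_inner_nonneg[OF YB])
        fix \<psi> assume \<psi>: "\<psi> \<in> {\<phi>..hi + \<delta>}"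
        have "0 \<le> sin (pi * (\<psi> - \<phi>))"
          using \<psi> \<phi> gap e sin_pi_pos[of "\<psi> - \<phi>"] by (cases "\<phi> = \<psi>") auto
        then show "0 \<le> inner (cis (pi * (\<phi> + 1/2))) (cis (pi * \<psi>))" unfolding inner_cis_orthogonal .
      qed
      then show ?thesis by simp
    qed
    have "is_zero C Y"
    proof (cases "lo - \<delta> < \<phi> - e")
      case True
      have YA: "Y \<in> slices C A.G.semistable {lo - \<delta><..\<phi> - e}" using YA1 XY(3) True by (simp add: SA.slices_greaterThanAtMost)
      show ?thesis
      proof (rule zero_of_opposite_charges[OF YA _ e e1 _ small neg])
        fix \<psi> assume \<psi>: "\<psi> \<in> {lo - \<delta><..\<phi> - e}"
        have "sin (pi * e) \<le> sin (pi * (\<phi> - \<psi>))" by (rule sin_pi_ge[OF e]) (use \<psi> \<phi> gap in auto)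
        moreover have "pi * (\<psi> - \<phi>) = - (pi * (\<phi> - \<psi>))" by (simp add: algebra_simps)
        ultimately show "sin (pi * e) \<le> inner (- cis (pi * (\<phi> + 1/2))) (cis (pi * \<psi>))"
          unfolding inner_minus_left inner_cis_orthogonal by (simp only: sin_minus minus_minus)
      qed simp
    next
      case False
      have "orth C Y Y" by (rule A.G.slices_orth[OF YA1 XY(3)]) (use False in auto)
      then show ?thesis using A.is_zero_iff oY by blast
    qed
    then have "isomorphic C X F" by (rule A.tri_zero_imp_iso[OF XY(1)])
    then have "F \<in> slices C A.G.semistable {\<phi> - e<..}" by (rule A.G.slices_iso[OF XY(2)]) (simp add: gt_ex)
    then show ?thesis by (rule slices_monoD) (use \<delta>0 in auto)
  qed
  show "F \<in> slices C A.G.semistable {\<phi> - (e + \<delta>)..\<phi> + (e + \<delta>)}"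
    using upper lower e \<delta>0 by (simp add: SA.slices_atLeastAtMost)
qed

end

lemma glue_domain_gl:
  assumes C: "triangulated_category C" "semiorthogonal_decomposition C D1 D2" and a: "0 < a" "a < 1"
    and \<sigma>: "(\<sigma>\<^sub>1, \<sigma>\<^sub>2) \<in> glue_domain C D1 D2 a"
  shows "glued C D1 D2 (gl C D1 D2 (\<sigma>\<^sub>1, \<sigma>\<^sub>2)) \<sigma>\<^sub>1 \<sigma>\<^sub>2"
    and "reasonable C (gl C D1 D2 (\<sigma>\<^sub>1, \<sigma>\<^sub>2))"
    and "gl C D1 D2 (\<sigma>\<^sub>1, \<sigma>\<^sub>2) \<in> Stab C"
proof -
  obtain k where g: "gluing C D1 D2 (snd \<sigma>\<^sub>1) (snd \<sigma>\<^sub>2) (\<lambda>E. fst \<sigma>\<^sub>1 (K0_class (full_sub C D1) E))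
    (\<lambda>E. fst \<sigma>\<^sub>2 (K0_class (full_sub C D2) E)) a k" by (rule glue_domain_gluing[OF C a \<sigma>])
  have "Hom_le_vanishes C 0 (heart (full_sub C D1) \<sigma>\<^sub>1) (heart (full_sub C D2) \<sigma>\<^sub>2)"
    using \<sigma> unfolding glue_domain_def heart_def by simp
  note res = gluing.gl_glued[OF g refl refl refl refl this]
  show 1: "glued C D1 D2 (gl C D1 D2 (\<sigma>\<^sub>1, \<sigma>\<^sub>2)) \<sigma>\<^sub>1 \<sigma>\<^sub>2" by (rule res(1))
  show 2: "reasonable C (gl C D1 D2 (\<sigma>\<^sub>1, \<sigma>\<^sub>2))" by (rule res(4))
  have "stability_condition C (gl C D1 D2 (\<sigma>\<^sub>1, \<sigma>\<^sub>2))" using 1 by (simp add: glued_def)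
  then show "gl C D1 D2 (\<sigma>\<^sub>1, \<sigma>\<^sub>2) \<in> Stab C"
    using reasonable_imp_locally_finite[OF C(1) _ 2] by (simp add: Stab_def)
qed

lemma stab_ball_dest:
  assumes C: "triangulated_category C" and \<sigma>: "stability_condition C \<sigma>" and \<tau>: "\<tau> \<in> stab_ball C \<delta> \<sigma>"
  shows "snd \<tau> \<phi> \<subseteq> slices C (snd \<sigma>) {\<phi> - \<delta>..\<phi> + \<delta>}"
    and "A \<in> snd \<sigma> \<phi> \<Longrightarrow> norm (fst \<tau> (K0_class C A) - fst \<sigma> (K0_class C A)) \<le> sin (pi * \<delta>) * norm (fst \<sigma> (K0_class C A))"
proof -
  interpret S: stable_category C "snd \<sigma>" "\<lambda>E. fst \<sigma> (K0_class C E)"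
    by (rule stability_condition_category[OF C \<sigma>])
  have \<tau>s: "stability_condition C \<tau>" and n: "charge_norm C \<sigma> (\<lambda>x. fst \<tau> x - fst \<sigma> x) < ennreal (sin (pi * \<delta>))"
    and d: "slicing_dist C (snd \<sigma>) (snd \<tau>) < ennreal \<delta>"
    using \<tau> unfolding stab_ball_def Stab_def by auto
  interpret T: stable_category C "snd \<tau>" "\<lambda>E. fst \<tau> (K0_class C E)"
    by (rule stability_condition_category[OF C \<tau>s])
  obtain e where e: "0 \<le> e" "e < \<delta>" and sub: "\<And>\<phi>. snd \<tau> \<phi> \<subseteq> slices C (snd \<sigma>) {\<phi> - e..\<phi> + e}"
    by (rule slicing_dist_lessD[OF d]) (rule that)
  have "slices C (snd \<sigma>) {\<phi> - e..\<phi> + e} \<subseteq> slices C (snd \<sigma>) {\<phi> - \<delta>..\<phi> + \<delta>}"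
    by (rule slices_mono) (use e in auto)
  with sub[of \<phi>] show "snd \<tau> \<phi> \<subseteq> slices C (snd \<sigma>) {\<phi> - \<delta>..\<phi> + \<delta>}" by (rule order.trans)
  obtain s where s: "0 \<le> s" "s < sin (pi * \<delta>)" and
    sb: "\<And>E. E \<in> semistables C \<sigma> \<Longrightarrow> norm (fst \<tau> (K0_class C E) - fst \<sigma> (K0_class C E)) \<le> s * norm (fst \<sigma> (K0_class C E))"
    by (rule charge_norm_lessD[OF n semistables_nonzero[OF C \<sigma>]]) (assumption, rule that)
  assume A: "A \<in> snd \<sigma> \<phi>"
  show "norm (fst \<tau> (K0_class C A) - fst \<sigma> (K0_class C A)) \<le> sin (pi * \<delta>) * norm (fst \<sigma> (K0_class C A))"
  proof (cases "is_zero C A")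
    case True
    then show ?thesis using S.z_zero T.z_zero by simp
  next
    case False
    then have "A \<in> semistables C \<sigma>" using A unfolding semistables_def by auto
    from sb[OF this] show ?thesis by (rule order.trans) (use s in \<open>intro mult_right_mono; simp\<close>)
  qed
qed

text \<open>
  The phases for the glued slicing change by at most \<open>e + \<delta>\<close>, where \<open>e\<close> is so small that a cell enlarged by \<open>\<delta>\<close> is still
  shorter than \<open>1 - e\<close>, and \<open>\<delta>\<close> is so small that charges within a cell move by less than an angle \<open>\<pi> e\<close>.
\<close>

lemma gl_continuous_at:
  assumes C: "triangulated_category C" "semiorthogonal_decomposition C D1 D2" and a: "0 < a" "a < 1"
    and \<sigma>: "(\<sigma>\<^sub>1, \<sigma>\<^sub>2) \<in> glue_domain C D1 D2 a" and \<epsilon>: "0 < \<epsilon>" "\<epsilon> < 1/8"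
  obtains \<delta> where "0 < \<delta>" "\<delta> < 1/8"
    "\<And>\<tau>\<^sub>1 \<tau>\<^sub>2. \<lbrakk>(\<tau>\<^sub>1, \<tau>\<^sub>2) \<in> glue_domain C D1 D2 a; \<tau>\<^sub>1 \<in> stab_ball (full_sub C D1) \<delta> \<sigma>\<^sub>1;
        \<tau>\<^sub>2 \<in> stab_ball (full_sub C D2) \<delta> \<sigma>\<^sub>2\<rbrakk> \<Longrightarrow> gl C D1 D2 (\<tau>\<^sub>1, \<tau>\<^sub>2) \<in> stab_ball C \<epsilon> (gl C D1 D2 (\<sigma>\<^sub>1, \<sigma>\<^sub>2))"
proof -
  interpret semiorthogonal C D1 D2 using C by (simp add: semiorthogonal_def semiorthogonal_axioms_def)
  obtain k where g: "gluing C D1 D2 (snd \<sigma>\<^sub>1) (snd \<sigma>\<^sub>2) (\<lambda>E. fst \<sigma>\<^sub>1 (K0_class (full_sub C D1) E))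
    (\<lambda>E. fst \<sigma>\<^sub>2 (K0_class (full_sub C D2) E)) a k" by (rule glue_domain_gluing[OF C a \<sigma>])
  have \<sigma>s: "stability_condition (full_sub C D1) \<sigma>\<^sub>1" "stability_condition (full_sub C D2) \<sigma>\<^sub>2"
    using \<sigma> unfolding glue_domain_def Stab_def by simp_all
  define w where "w = max a (1 - a)"
  define \<kappa> where "\<kappa> = cos (pi * (w / 2))"
  have \<kappa>: "0 < \<kappa>" unfolding \<kappa>_def w_def by (rule gluing.cos_gap_pos[OF g])
  \<comment> \<open>\<open>w\<close> is the width of the wider cells; \<open>e \<le> (1 - w) / 2\<close> leaves room for \<open>e\<close> and \<open>\<delta> \<le> e\<close>.\<close>
  define e where "e = min (\<epsilon> / 4) ((1 - w) / 2)"
  have "w < 1" unfolding w_def using a by simp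
  then have e: "0 < e" "e \<le> \<epsilon> / 4" "e \<le> (1 - w) / 2"
    using \<epsilon> min.cobounded1[of "\<epsilon> / 4" "(1 - w) / 2"] min.cobounded2[of "\<epsilon> / 4" "(1 - w) / 2"] by (simp_all add: e_def)
  have se: "0 < sin (pi * e)" by (rule sin_pi_pos) (use e \<epsilon> in auto)
  \<comment> \<open>By \<open>sin (\<pi> \<delta>) \<le> 4 \<delta>\<close> this makes the error \<open>sin (\<pi> \<delta>) / \<kappa>\<close> of the charges smaller than \<open>sin (\<pi> e)\<close>.\<close>
  define \<delta> where "\<delta> = min e (\<kappa> * sin (pi * e) / 8)"
  have "\<delta> \<le> \<kappa> * sin (pi * e) / 8" unfolding \<delta>_def by (rule min.cobounded2)
  then have \<delta>: "0 < \<delta>" "\<delta> \<le> e" "8 * \<delta> \<le> \<kappa> * sin (pi * e)" using e se \<kappa> by (simp_all add: \<delta>_def)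
  have "2 * e \<le> 1 - w" using e(3) by simp
  then have narrow: "w + \<delta> \<le> 1 - e" using \<delta>(2) by linarith
  have \<delta>8: "\<delta> < 1/8" using \<delta> e \<epsilon> by linarith
  have s0: "0 < sin (pi * \<delta>)" by (rule sin_pi_pos) (use \<delta> \<delta>8 in auto)
  have small: "sin (pi * \<delta>) < \<kappa> * sin (pi * e)" using sin_pi_le[of \<delta>] \<delta> by linarith
  have quot: "sin (pi * \<delta>) / \<kappa> < sin (pi * \<epsilon>)"
  proof -
    have "sin (pi * \<delta>) / \<kappa> < sin (pi * e)" using small \<kappa> by (simp add: field_simps)
    also have "\<dots> \<le> sin (pi * \<epsilon>)" by (rule sin_pi_ge) (use e \<epsilon> in auto)
    finally show ?thesis .
  qed
  show thesis
  proof (rule that[OF \<delta>(1) \<delta>8])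
    fix \<tau>\<^sub>1 \<tau>\<^sub>2
    assume \<tau>: "(\<tau>\<^sub>1, \<tau>\<^sub>2) \<in> glue_domain C D1 D2 a"
      and b: "\<tau>\<^sub>1 \<in> stab_ball (full_sub C D1) \<delta> \<sigma>\<^sub>1" "\<tau>\<^sub>2 \<in> stab_ball (full_sub C D2) \<delta> \<sigma>\<^sub>2"
    obtain l where h: "gluing C D1 D2 (snd \<tau>\<^sub>1) (snd \<tau>\<^sub>2) (\<lambda>E. fst \<tau>\<^sub>1 (K0_class (full_sub C D1) E))
      (\<lambda>E. fst \<tau>\<^sub>2 (K0_class (full_sub C D2) E)) a l" by (rule glue_domain_gluing[OF C a \<tau>])
    note b1 = stab_ball_dest[OF D1.triangulated_full_sub \<sigma>s(1) b(1)]
      and b2 = stab_ball_dest[OF D2.triangulated_full_sub \<sigma>s(2) b(2)]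
    interpret gluing_pair C D1 D2 "snd \<sigma>\<^sub>1" "snd \<sigma>\<^sub>2" "\<lambda>E. fst \<sigma>\<^sub>1 (K0_class (full_sub C D1) E)"
      "\<lambda>E. fst \<sigma>\<^sub>2 (K0_class (full_sub C D2) E)" a k "snd \<tau>\<^sub>1" "snd \<tau>\<^sub>2"
      "\<lambda>E. fst \<tau>\<^sub>1 (K0_class (full_sub C D1) E)" "\<lambda>E. fst \<tau>\<^sub>2 (K0_class (full_sub C D2) E)" l \<delta> "sin (pi * \<delta>)"
    proof (intro gluing_pair.intro g h gluing_pair_axioms.intro)
      show "0 \<le> \<delta>" "0 \<le> sin (pi * \<delta>)" using \<delta> s0 by auto
    qed (rule b1 b2; assumption?)+
    have hom: "Hom_le_vanishes C 0 (heart (full_sub C D1) \<sigma>\<^sub>1) (heart (full_sub C D2) \<sigma>\<^sub>2)"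
      "Hom_le_vanishes C 0 (heart (full_sub C D1) \<tau>\<^sub>1) (heart (full_sub C D2) \<tau>\<^sub>2)"
      using \<sigma> \<tau> unfolding glue_domain_def heart_def by simp_all
    note gl\<sigma> = A.gl_glued[OF refl refl refl refl hom(1)] and gl\<tau> = B.gl_glued[OF refl refl refl refl hom(2)]
    have st: "stability_condition C (gl C D1 D2 (\<sigma>\<^sub>1, \<sigma>\<^sub>2))" using gl\<sigma>(1) by (simp add: glued_def)
    show "gl C D1 D2 (\<tau>\<^sub>1, \<tau>\<^sub>2) \<in> stab_ball C \<epsilon> (gl C D1 D2 (\<sigma>\<^sub>1, \<sigma>\<^sub>2))"
      unfolding stab_ball_def
    proof (intro CollectI conjI glue_domain_gl(3)[OF C a \<tau>])
      show "charge_norm C (gl C D1 D2 (\<sigma>\<^sub>1, \<sigma>\<^sub>2))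
          (\<lambda>x. fst (gl C D1 D2 (\<tau>\<^sub>1, \<tau>\<^sub>2)) x - fst (gl C D1 D2 (\<sigma>\<^sub>1, \<sigma>\<^sub>2)) x) < ennreal (sin (pi * \<epsilon>))"
      proof (rule charge_norm_lessI[OF _ semistables_nonzero[OF C(1) st] _ quot])
        show "0 \<le> sin (pi * \<delta>) / \<kappa>" using s0 \<kappa> by simp
        fix E assume "E \<in> semistables C (gl C D1 D2 (\<sigma>\<^sub>1, \<sigma>\<^sub>2))"
        then obtain \<phi> where E: "E \<in> A.G.semistable \<phi>" unfolding semistables_def gl\<sigma>(2) by blast
        have "E \<in> Obj C" by (rule A.G.P_Obj[OF E])
        then show "norm (fst (gl C D1 D2 (\<tau>\<^sub>1, \<tau>\<^sub>2)) (K0_class C E) - fst (gl C D1 D2 (\<sigma>\<^sub>1, \<sigma>\<^sub>2)) (K0_class C E))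
            \<le> sin (pi * \<delta>) / \<kappa> * norm (fst (gl C D1 D2 (\<sigma>\<^sub>1, \<sigma>\<^sub>2)) (K0_class C E))"
          using charge_close[OF E] gl\<sigma>(3) gl\<tau>(3) unfolding \<kappa>_def w_def by simp
      qed
      show "slicing_dist C (snd (gl C D1 D2 (\<sigma>\<^sub>1, \<sigma>\<^sub>2))) (snd (gl C D1 D2 (\<tau>\<^sub>1, \<tau>\<^sub>2))) < ennreal \<epsilon>"
      proof (rule slicing_dist_lessI)
        show "0 \<le> e + \<delta>" "e + \<delta> < \<epsilon>" using e \<delta> \<epsilon> by auto
        show "snd (gl C D1 D2 (\<tau>\<^sub>1, \<tau>\<^sub>2)) \<phi> \<subseteq> slices C (snd (gl C D1 D2 (\<sigma>\<^sub>1, \<sigma>\<^sub>2))) {\<phi> - (e + \<delta>)..\<phi> + (e + \<delta>)}" for \<phi>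
          unfolding gl\<sigma>(2) gl\<tau>(2)
        proof (rule semistable_close[OF e(1)])
          show "max a (1 - a) + \<delta> \<le> 1 - e" using narrow unfolding w_def .
          show "sin (pi * \<delta>) < cos (pi * (max a (1 - a) / 2)) * sin (pi * e)" using small unfolding \<kappa>_def w_def .
        qed
      qed
    qed
  qed
qed

theorem theorem4p3:
  fixes C :: "('o, 'm) tricat" and D1 D2 :: "'o set" and a :: real
  assumes "triangulated_category C"
    and "semiorthogonal_decomposition C D1 D2"
    and "0 < a" and "a < 1"
  shows "(\<forall>(\<sigma>\<^sub>1, \<sigma>\<^sub>2) \<in> glue_domain C D1 D2 a.
            glued C D1 D2 (gl C D1 D2 (\<sigma>\<^sub>1, \<sigma>\<^sub>2)) \<sigma>\<^sub>1 \<sigma>\<^sub>2 \<and>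
            reasonable C (gl C D1 D2 (\<sigma>\<^sub>1, \<sigma>\<^sub>2))) \<and>
         continuous_map
           (subtopology (prod_topology (stab_topology (full_sub C D1)) (stab_topology (full_sub C D2)))
              (glue_domain C D1 D2 a))
           (stab_topology C) (gl C D1 D2)"
proof (intro conjI)
  interpret semiorthogonal C D1 D2 using assms by (simp add: semiorthogonal_def semiorthogonal_axioms_def)
  let ?S = "glue_domain C D1 D2 a"
  let ?T1 = "stab_topology (full_sub C D1)" and ?T2 = "stab_topology (full_sub C D2)"
  let ?X = "subtopology (prod_topology ?T1 ?T2) ?S"
  note res = glue_domain_gl[OF assms]
  show "\<forall>(\<sigma>\<^sub>1, \<sigma>\<^sub>2)\<in>?S. glued C D1 D2 (gl C D1 D2 (\<sigma>\<^sub>1, \<sigma>\<^sub>2)) \<sigma>\<^sub>1 \<sigma>\<^sub>2 \<and> reasonable C (gl C D1 D2 (\<sigma>\<^sub>1, \<sigma>\<^sub>2))"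
    using res(1,2) by auto
  have S_Stab: "?S \<subseteq> Stab (full_sub C D1) \<times> Stab (full_sub C D2)" unfolding glue_domain_def by auto
  then have top: "topspace ?X = ?S" by (auto simp: topspace_stab_topology)
  show "continuous_map ?X (stab_topology C) (gl C D1 D2)"
    unfolding continuous_map_def top topspace_stab_topology
  proof (intro conjI allI impI)
    show "gl C D1 D2 \<in> ?S \<rightarrow> Stab C" using res(3) by (auto simp: Pi_def)
    fix U assume "openin (stab_topology C) U"
    then have U: "stab_open C U" by (simp add: openin_stab_topology)
    show "openin ?X {x \<in> ?S. gl C D1 D2 x \<in> U}"
    proof (subst openin_subopen, intro ballI)
      fix x assume x: "x \<in> {x \<in> ?S. gl C D1 D2 x \<in> U}"
      obtain \<sigma>\<^sub>1 \<sigma>\<^sub>2 where x_eq: "x = (\<sigma>\<^sub>1, \<sigma>\<^sub>2)" by (cases x)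
      have \<sigma>: "(\<sigma>\<^sub>1, \<sigma>\<^sub>2) \<in> ?S" and inU: "gl C D1 D2 (\<sigma>\<^sub>1, \<sigma>\<^sub>2) \<in> U" using x x_eq by auto
      have \<sigma>S: "\<sigma>\<^sub>1 \<in> Stab (full_sub C D1)" "\<sigma>\<^sub>2 \<in> Stab (full_sub C D2)" using \<sigma> S_Stab by auto
      then have \<sigma>s: "stability_condition (full_sub C D1) \<sigma>\<^sub>1" "stability_condition (full_sub C D2) \<sigma>\<^sub>2"
        unfolding Stab_def by auto
      obtain \<epsilon> where \<epsilon>: "0 < \<epsilon>" "\<epsilon> < 1/8" "stab_ball C \<epsilon> (gl C D1 D2 (\<sigma>\<^sub>1, \<sigma>\<^sub>2)) \<subseteq> U"
        using U inU unfolding stab_open_def by blast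
      obtain \<delta> where \<delta>: "0 < \<delta>" "\<delta> < 1/8" and close:
        "\<And>\<tau>\<^sub>1 \<tau>\<^sub>2. \<lbrakk>(\<tau>\<^sub>1, \<tau>\<^sub>2) \<in> ?S; \<tau>\<^sub>1 \<in> stab_ball (full_sub C D1) \<delta> \<sigma>\<^sub>1; \<tau>\<^sub>2 \<in> stab_ball (full_sub C D2) \<delta> \<sigma>\<^sub>2\<rbrakk>
          \<Longrightarrow> gl C D1 D2 (\<tau>\<^sub>1, \<tau>\<^sub>2) \<in> stab_ball C \<epsilon> (gl C D1 D2 (\<sigma>\<^sub>1, \<sigma>\<^sub>2))"
        by (rule gl_continuous_at[OF assms \<sigma> \<epsilon>(1,2)]) (rule that)
      let ?B = "stab_ball (full_sub C D1) \<delta> \<sigma>\<^sub>1 \<times> stab_ball (full_sub C D2) \<delta> \<sigma>\<^sub>2"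
      have "openin (prod_topology ?T1 ?T2) ?B"
        using stab_ball_open[OF D1.triangulated_full_sub \<sigma>s(1) \<delta>] stab_ball_open[OF D2.triangulated_full_sub \<sigma>s(2) \<delta>]
        by (simp add: openin_prod_Times_iff openin_stab_topology)
      then have "openin ?X (?S \<inter> ?B)" by (rule openin_subtopology_Int2)
      moreover have "x \<in> ?S \<inter> ?B"
        using \<sigma> stab_ball_center[OF D1.triangulated_full_sub \<sigma>S(1) \<delta>] stab_ball_center[OF D2.triangulated_full_sub \<sigma>S(2) \<delta>] x_eq by simp
      moreover have "?S \<inter> ?B \<subseteq> {x \<in> ?S. gl C D1 D2 x \<in> U}" using close \<epsilon>(3) by blast
      ultimately show "\<exists>T. openin ?X T \<and> x \<in> T \<and> T \<subseteq> {x \<in> ?S. gl C D1 D2 x \<in> U}" by blast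
    qed
  qed
qed

end
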